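(* Let $p\geq 5$ be a prime number and $K$ a field of characteristic $0$. Let $b,c,b',c'$ be nonzero elements of $K$, and let $C$ and $C'$ be the projective plane curves over $K$ defined by $x^p+by^p+cz^p=0$ and $x^p+b'y^p+c'z^p=0$ respectively. Then $C$ and $C'$ are isomorphic over $K$ if and only if one of the following pairs belongs to $K^{*p}\times K^{*p}$: $$\left(\frac{b}{b'},\frac{c}{c'}\right),\quad \left(\frac{b}{c'},\frac{b'}{c}\right),\quad \left(cb',\frac{b}{cc'}\right),\quad \left(bc',\frac{b'}{cc'}\right),\quad \left(\frac{bc'}{c},\frac{cb'}{c'}\right),\quad \left(cc',\frac{cb'}{b}\right).$$
   Context: $K^{*p}$ denotes the subgroup of $p$-th powers of nonzero elements of $K$. *)

theory Defs
  imports "HOL-Algebra.Algebraic_Closure_Type" "HOL-Computational_Algebra.Primes"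
begin

text \<open>
  Algebraic sets in the projective plane over a field \<open>'k\<close> are represented by their points
  over the algebraic closure \<open>'k alg_closure\<close>; being defined over \<open>'k\<close> is a
  condition on the coefficients of the forms involved.
\<close>

type_synonym 'a triple = "'a \<times> 'a \<times> 'a"

text \<open>
  The point \<open>[x : y : z]\<close>, as the set of all its homogeneous coordinate vectors. It is only
  meaningful for \<open>(x, y, z) \<noteq> (0, 0, 0)\<close>.
\<close>

definition proj_point :: "'a::field triple \<Rightarrow> 'a triple set" where
  "proj_point = (\<lambda>(x, y, z). {(t * x, t * y, t * z) | t. t \<noteq> 0})"

lemma proj_point_eq_iff:
  "proj_point (x, y, z) = proj_point (x', y', z') \<longleftrightarrow>
     (\<exists>t. t \<noteq> 0 \<and> x' = t * x \<and> y' = t * y \<and> z' = t * z)" (is "?L \<longleftrightarrow> ?R")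
proof
  assume ?L
  moreover have "(x', y', z') \<in> proj_point (x', y', z')"
    unfolding proj_point_def by (auto intro!: exI[of _ 1])
  ultimately have "(x', y', z') \<in> proj_point (x, y, z)" by simp
  then show ?R unfolding proj_point_def by auto
next
  assume ?R
  then obtain t where t: "t \<noteq> 0" "x' = t * x" "y' = t * y" "z' = t * z" by blast
  have "\<exists>r. s * x = r * (t * x) \<and> s * y = r * (t * y) \<and> s * z = r * (t * z) \<and> r \<noteq> 0"
    if "s \<noteq> 0" for s
    using that t(1) by (intro exI[of _ "s / t"]) simp
  moreover have "\<exists>r. s * (t * x) = r * x \<and> s * (t * y) = r * y \<and> s * (t * z) = r * z \<and> r \<noteq> 0"
    if "s \<noteq> 0" for s
    using that t(1) by (intro exI[of _ "s * t"]) simp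
  ultimately show ?L
    using t by (auto simp: proj_point_def)
qed

text \<open>
  A form of degree \<open>d\<close> over \<open>'k\<close> in three variables is given by its coefficients
  \<open>a (i, j, k)\<close> with \<open>i + j + k = d\<close>; other values of \<open>a\<close> are ignored.
\<close>

definition form_eval :: "nat \<Rightarrow> (nat triple \<Rightarrow> 'k::field) \<Rightarrow> 'k alg_closure triple \<Rightarrow> 'k alg_closure"
  where "form_eval d a = (\<lambda>(x, y, z).
    \<Sum>(i, j, k) \<in> {(i, j, k). i + j + k = d}. to_ac (a (i, j, k)) * x ^ i * y ^ j * z ^ k)"

lemma finite_exponents: "finite {(i, j, k). i + j + k = (d::nat)}"
  by (rule finite_subset[of _ "{..d} \<times> {..d} \<times> {..d}"]) auto

lemma form_eval_scale:
  "form_eval d a (t * x, t * y, t * z) = t ^ d * form_eval d a (x, y, z)"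
  unfolding form_eval_def
  by (auto simp: sum_distrib_left power_mult_distrib power_add mult_ac intro!: sum.cong)

definition forms_eval ::
    "nat \<Rightarrow> (nat triple \<Rightarrow> 'k::field) triple \<Rightarrow> 'k alg_closure triple \<Rightarrow> 'k alg_closure triple"
  where "forms_eval d = (\<lambda>(a\<^sub>0, a\<^sub>1, a\<^sub>2) v.
    (form_eval d a\<^sub>0 v, form_eval d a\<^sub>1 v, form_eval d a\<^sub>2 v))"

text \<open>
  Morphisms over \<open>'k\<close> between projective algebraic sets \<open>C\<close> and \<open>C'\<close>: near each
  point the map is \<open>[F\<^sub>0 : F\<^sub>1 : F\<^sub>2]\<close> for forms \<open>F\<^sub>0, F\<^sub>1, F\<^sub>2\<close> over \<open>'k\<close> of the same
  degree. Requiring this representation at all points of \<open>C\<close> where the \<open>F\<^sub>i\<close> do not all vanish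
  is no restriction: if it holds on the open set \<open>G \<noteq> 0\<close>, use \<open>G F\<^sub>0, G F\<^sub>1, G F\<^sub>2\<close> instead.
\<close>

definition is_morphism_over ::
    "'k::field itself \<Rightarrow> 'k alg_closure triple set set \<Rightarrow> 'k alg_closure triple set set \<Rightarrow>
     ('k alg_closure triple set \<Rightarrow> 'k alg_closure triple set) \<Rightarrow> bool"
  where "is_morphism_over _ C C' f \<longleftrightarrow> f ` C \<subseteq> C' \<and>
    (\<forall>u. u \<noteq> (0, 0, 0) \<and> proj_point u \<in> C \<longrightarrow>
      (\<exists>d (F :: (nat triple \<Rightarrow> 'k) triple). forms_eval d F u \<noteq> (0, 0, 0) \<and>
        (\<forall>v. v \<noteq> (0, 0, 0) \<and> proj_point v \<in> C \<and> forms_eval d F v \<noteq> (0, 0, 0) \<longrightarrow>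
          f (proj_point v) = proj_point (forms_eval d F v))))"

definition isomorphic_over ::
    "'k::field itself \<Rightarrow> 'k alg_closure triple set set \<Rightarrow> 'k alg_closure triple set set \<Rightarrow> bool"
  where "isomorphic_over K C C' \<longleftrightarrow>
    (\<exists>f g. is_morphism_over K C C' f \<and> is_morphism_over K C' C g \<and>
      (\<forall>P\<in>C. g (f P) = P) \<and> (\<forall>Q\<in>C'. f (g Q) = Q))"

text \<open>The plane curve \<open>x\<^sup>p + b y\<^sup>p + c z\<^sup>p = 0\<close>.\<close>

definition fermat_curve :: "nat \<Rightarrow> 'k::field \<Rightarrow> 'k \<Rightarrow> 'k alg_closure triple set set" where
  "fermat_curve p b c = {proj_point (x, y, z) | x y z.
     (x, y, z) \<noteq> (0, 0, 0) \<and> x ^ p + to_ac b * y ^ p + to_ac c * z ^ p = 0}"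

text \<open>The subgroup of \<open>p\<close>-th powers of nonzero elements.\<close>

definition nonzero_powers :: "nat \<Rightarrow> 'k::field set" where
  "nonzero_powers p = {t ^ p | t. t \<noteq> 0}"

end

theory Submission
  imports Defs "HOL-Computational_Algebra.Formal_Laurent_Series"
begin

text \<open>
  An isomorphism \<open>f: C \<rightarrow> C'\<close> of smooth plane curves of degree \<open>p\<close> pulls regular
  differentials back to regular differentials, and these are given by forms of degree \<open>p - 3\<close>.
  A form of degree \<open>p - 3\<close> with \<open>p - 2\<close> zeros on a line vanishes on the line. Hence \<open>f\<close> maps
  the points of \<open>C\<close> on a general line \<open>y = const\<close> to collinear points: otherwise a product of
  \<open>p - 3\<close> lines would pass through \<open>p - 2\<close> of them and miss another. Pulling back the product of \<open>p - 4\<close> lines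
  obtained this way with an arbitrary line, one can divide the resulting form by \<open>p - 4\<close>
  linear factors, so \<open>f\<close> is linear. Comparing mixed derivatives of the two equations shows that
  \<open>f\<close> is monomial, and the ratios of its coefficients lie in the base field because \<open>f\<close> is defined
  there. The six pairs correspond to the six permutations of the coordinates.

  That the pullback \<open>h\<close> of a differential is a form is checked explicitly: averaging over
  \<open>x \<mapsto> \<zeta> x\<close> with \<open>\<zeta>\<^sup>p = 1\<close> isolates the terms of \<open>h = \<Sum> h\<^sub>k(y) x\<^sup>k\<close>, and Laurent expansions at
  all places show that the rational functions \<open>h\<^sub>k\<close> have no finite poles and degree at most
  \<open>p - 3 - k\<close>.
\<close>

section \<open>Polynomials in two variables and roots of unity\<close>

text \<open>Write n for p. On C the differential dy / x^(n-1) has no zeros or poles at finite places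
  (at a branch point dy and x^(n-1) both have order n - 1) and order n - 3 at infinity; this is the
  origin of the degree n - 3. The pullback is h dy / x^(n-1). The obstacle is that a bound for the
  order of h at a place says little about its single terms, which may cancel. The rotations x ->
  \<zeta> x send places to places and keep these orders, so an average over them obeys the same
  bound and consists of one term.

  For the terms to have a denominator in y alone, the first coordinate of f is turned into a
  polynomial d(y): all three coordinates are multiplied by the product of its other conjugates. The
  same norm shows that a function not vanishing on C has zeros over finitely many y only. So one can
  work in the chart z = 1 with a single representation of f by forms, up to finitely many y. The
  inverse of f provides injectivity, which keeps the image of f out of every line.\<close>

locale ring_map =
  fixes h :: "'a::comm_ring_1 \<Rightarrow> 'b::comm_ring_1"
  assumes map_0: "h 0 = 0" and map_1: "h 1 = 1"
    and map_add: "\<And>x y. h (x + y) = h x + h y"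
    and map_mult: "\<And>x y. h (x * y) = h x * h y"

definition eval1 :: "('a::comm_ring_1 \<Rightarrow> 'b::comm_ring_1) \<Rightarrow> 'b \<Rightarrow> 'a poly \<Rightarrow> 'b" where
  "eval1 h \<eta> q = poly (map_poly h q) \<eta>"

text \<open>An element \<open>A\<close> of \<open>'a[y][x]\<close> is of type \<open>'a poly poly\<close>; \<open>x\<close> is the outer variable.\<close>

definition eval2 :: "('a::comm_ring_1 \<Rightarrow> 'b::comm_ring_1) \<Rightarrow> 'b \<Rightarrow> 'b \<Rightarrow> 'a poly poly \<Rightarrow> 'b" where
  "eval2 h \<xi> \<eta> A = poly (map_poly (eval1 h \<eta>) A) \<xi>"

lemma eval1_id [simp]: "eval1 (\<lambda>x. x) y = (\<lambda>q. poly q y)"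
  by (simp add: eval1_def fun_eq_iff)

context ring_map begin

lemmas map_simps = map_0 map_1 map_add map_mult

lemma eval1_0 [simp]: "eval1 h \<eta> 0 = 0"
  by (simp add: eval1_def map_simps)

lemma eval1_pCons [simp]: "eval1 h \<eta> (pCons a q) = h a + \<eta> * eval1 h \<eta> q"
  by (simp add: eval1_def map_poly_pCons map_simps)

lemma eval1_1 [simp]: "eval1 h \<eta> 1 = 1"
  by (simp add: one_pCons map_simps)

lemma eval1_add [simp]: "eval1 h \<eta> (p + q) = eval1 h \<eta> p + eval1 h \<eta> q"
  by (induction p q rule: poly_induct2) (simp_all add: algebra_simps map_simps)

lemma eval1_smult [simp]: "eval1 h \<eta> (smult a q) = h a * eval1 h \<eta> q"
  by (induction q) (simp_all add: algebra_simps map_simps)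

lemma eval1_mult [simp]: "eval1 h \<eta> (p * q) = eval1 h \<eta> p * eval1 h \<eta> q"
  by (induction p) (simp_all add: algebra_simps map_simps)

lemma eval1_power [simp]: "eval1 h \<eta> (p ^ k) = eval1 h \<eta> p ^ k"
  by (induction k) simp_all

lemma map_minus: "h (- x) = - h x"
proof -
  have "h (- x) + h x = h 0" by (subst map_add [symmetric]) simp
  then show ?thesis by (simp add: map_0 eq_neg_iff_add_eq_0)
qed

lemma eval1_minus [simp]: "eval1 h \<eta> (- p) = - eval1 h \<eta> p"
  by (induction p) (simp_all add: map_minus)

lemma eval1_diff [simp]: "eval1 h \<eta> (p - q) = eval1 h \<eta> p - eval1 h \<eta> q"
  using eval1_add[of \<eta> p "- q"] by simp

lemma eval1_monom [simp]: "eval1 h \<eta> (monom a k) = h a * \<eta> ^ k"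
  by (induction k) (simp_all add: monom_0 monom_Suc algebra_simps map_simps)

lemma eval2_0 [simp]: "eval2 h \<xi> \<eta> 0 = 0"
  by (simp add: eval2_def)

lemma eval2_pCons [simp]: "eval2 h \<xi> \<eta> (pCons a q) = eval1 h \<eta> a + \<xi> * eval2 h \<xi> \<eta> q"
  by (simp add: eval2_def map_poly_pCons)

lemma eval2_1 [simp]: "eval2 h \<xi> \<eta> 1 = 1"
  by (simp add: one_pCons map_simps)

lemma eval2_add [simp]: "eval2 h \<xi> \<eta> (p + q) = eval2 h \<xi> \<eta> p + eval2 h \<xi> \<eta> q"
  by (induction p q rule: poly_induct2) (simp_all add: algebra_simps map_simps)

lemma eval2_smult [simp]: "eval2 h \<xi> \<eta> (smult a q) = eval1 h \<eta> a * eval2 h \<xi> \<eta> q"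
  by (induction q) (simp_all add: algebra_simps map_simps)

lemma eval2_mult [simp]: "eval2 h \<xi> \<eta> (p * q) = eval2 h \<xi> \<eta> p * eval2 h \<xi> \<eta> q"
  by (induction p) (simp_all add: algebra_simps map_simps)

lemma eval2_power [simp]: "eval2 h \<xi> \<eta> (p ^ k) = eval2 h \<xi> \<eta> p ^ k"
  by (induction k) simp_all

lemma eval2_minus [simp]: "eval2 h \<xi> \<eta> (- p) = - eval2 h \<xi> \<eta> p"
  by (induction p) simp_all

lemma eval2_diff [simp]: "eval2 h \<xi> \<eta> (p - q) = eval2 h \<xi> \<eta> p - eval2 h \<xi> \<eta> q"
  using eval2_add[of \<xi> \<eta> p "- q"] by simp

lemma eval2_monom [simp]: "eval2 h \<xi> \<eta> (monom a k) = eval1 h \<eta> a * \<xi> ^ k"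
  by (induction k) (simp_all add: monom_0 monom_Suc algebra_simps map_simps)

lemma eval2_sum: "eval2 h \<xi> \<eta> (\<Sum>i\<in>I. f i) = (\<Sum>i\<in>I. eval2 h \<xi> \<eta> (f i))"
  by (induction I rule: infinite_finite_induct) simp_all

lemma eval2_prod: "eval2 h \<xi> \<eta> (\<Prod>i\<in>I. f i) = (\<Prod>i\<in>I. eval2 h \<xi> \<eta> (f i))"
  by (induction I rule: infinite_finite_induct) simp_all

lemma eval2_low:
  assumes "\<forall>i\<ge>n. coeff R i = 0"
  shows "eval2 h \<xi> \<eta> R = (\<Sum>i<n. eval1 h \<eta> (coeff R i) * \<xi> ^ i)"
proof -
  have "R = (\<Sum>i<n. monom (coeff R i) i)"
    using assms by (intro poly_eqI) (auto simp: coeff_sum coeff_monom not_less)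
  then have "eval2 h \<xi> \<eta> R = eval2 h \<xi> \<eta> (\<Sum>i<n. monom (coeff R i) i)" by simp
  then show ?thesis by (simp add: eval2_sum)
qed

end

lemma ring_map_id [simp]: "ring_map (\<lambda>x. x)"
  by unfold_locales auto

lemma ring_map_to_ac [simp]: "ring_map to_ac"
  by unfold_locales auto

lemma ring_map_fls_const [simp]: "ring_map (fls_const :: 'a::field \<Rightarrow> 'a fls)"
  by unfold_locales (auto simp: fls_plus_const)

interpretation id_map: ring_map "\<lambda>x::'a::comm_ring_1. x" by simp
interpretation ac_map: ring_map to_ac by simp
interpretation fls_map: ring_map "fls_const :: 'a::field \<Rightarrow> 'a fls" by simp

definition curve_poly :: "nat \<Rightarrow> 'a::comm_ring_1 \<Rightarrow> 'a \<Rightarrow> 'a poly poly" where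
  "curve_poly n b c = monom 1 n + [:monom b n + [:c:]:]"

lemma (in ring_map) eval2_curve_poly [simp]:
  "eval2 h \<xi> \<eta> (curve_poly n b c) = \<xi> ^ n + h b * \<eta> ^ n + h c"
  by (simp add: curve_poly_def algebra_simps)

text \<open>The coefficient ring \<open>'a poly\<close> is not a field, but
  \<open>curve_poly\<close> is monic in the outer variable, so pseudo-division is an honest
  division.\<close>

lemma reduce_mod_curve_poly:
  fixes A :: "'a::field poly poly"
  assumes "n > 0"
  obtains Q R where "A = curve_poly n b c * Q + R" "\<forall>i\<ge>n. coeff R i = 0"
proof -
  let ?P = "curve_poly n b c"
  have lc: "coeff ?P n = 1"
    using assms by (simp add: curve_poly_def coeff_pCons split: nat.split)
  have deg: "degree ?P = n"
  proof (rule antisym)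
    show "degree ?P \<le> n"
      unfolding curve_poly_def by (intro degree_add_le) (auto simp: degree_monom_le)
    show "n \<le> degree ?P" using lc by (intro le_degree) simp
  qed
  have nz: "?P \<noteq> 0" using lc by auto
  obtain Q R where qr: "pseudo_divmod A ?P = (Q, R)" by (cases "pseudo_divmod A ?P")
  note * = pseudo_divmod[OF nz qr]
  have "A = ?P * Q + R" using *(1) lc deg by simp
  moreover have "\<forall>i\<ge>n. coeff R i = 0"
    using *(2) deg by (auto intro: coeff_eq_0)
  ultimately show ?thesis using that by blast
qed

section \<open>Averages over the n-th roots of unity\<close>

locale prime_root =
  fixes n :: nat and \<zeta> :: "'a::{alg_closed_field, field_char_0}"
  assumes n_prime: "prime n" and zeta_power [simp]: "\<zeta> ^ n = 1" and zeta_neq_1: "\<zeta> \<noteq> 1"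
begin

lemma n_pos: "n > 0"
  using n_prime by (simp add: prime_gt_0_nat)

lemma zeta_nz: "\<zeta> \<noteq> 0"
  using n_pos zeta_power by (metis zero_neq_one zero_power)

text \<open>Primality enters here: an exponent not divisible by \<open>n\<close> is invertible
  modulo \<open>n\<close>, so \<zeta> is a power of \<open>\<zeta> ^ k\<close>.\<close>

lemma zeta_power_neq_1:
  assumes "\<not> n dvd k"
  shows "\<zeta> ^ k \<noteq> 1"
proof
  assume k: "\<zeta> ^ k = 1"
  have "coprime k n"
    using prime_imp_coprime[OF n_prime assms] by (simp add: coprime_commute)
  moreover have "k \<noteq> 0" using assms dvd_0_right by metis
  ultimately obtain x y where "k * x = n * y + 1"
    using bezout_nat[of k n] by (auto simp: coprime_iff_gcd_eq_1)
  then have "\<zeta> ^ (k * x) = \<zeta> ^ (n * y + 1)" by simp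
  then have "\<zeta> = 1" using k by (simp add: power_mult)
  then show False using zeta_neq_1 by simp
qed

lemma zeta_power_power [simp]: "(\<zeta> ^ j) ^ n = 1"
  by (metis mult.commute power_mult power_one zeta_power)

lemma zeta_sum:
  assumes "i < n" "k < n"
  shows "(\<Sum>j<n. \<zeta> ^ (j * (n - k)) * \<zeta> ^ (j * i)) = (if i = k then of_nat n else 0)"
proof -
  let ?r = "\<zeta> ^ (n - k + i)"
  have eq: "\<zeta> ^ (j * (n - k)) * \<zeta> ^ (j * i) = ?r ^ j" for j
    by (simp add: power_mult [symmetric] power_add [symmetric] algebra_simps)
  have sum_eq: "(\<Sum>j<n. \<zeta> ^ (j * (n - k)) * \<zeta> ^ (j * i)) = (\<Sum>j<n. ?r ^ j)"
    by (intro sum.cong refl eq)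
  show ?thesis
  proof (cases "i = k")
    case True
    then have "?r = 1" using assms by simp
    then show ?thesis using True unfolding sum_eq by simp
  next
    case False
    have "\<not> n dvd n - k + i"
    proof
      assume "n dvd n - k + i"
      then obtain m where m: "n - k + i = n * m" by blast
      have "0 < n - k + i" "n - k + i < n * 2" using assms by auto
      with m have "0 < n * m" "n * m < n * 2" by auto
      then have "m = 1" by auto
      with m False assms show False by simp
    qed
    then have "?r \<noteq> 1" by (rule zeta_power_neq_1)
    moreover have "?r ^ n = 1" by simp
    ultimately have "(\<Sum>j<n. ?r ^ j) = 0"
      by (simp add: geometric_sum)
    then show ?thesis using False unfolding sum_eq by simp
  qed
qed

text \<open>Fourier inversion: weighting the rotated sums isolates the term of degree
  \<open>k\<close>. The target is only a commutative ring, so the factor \<open>n\<close> is left in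
  place.\<close>

lemma zeta_average:
  assumes "ring_map (h :: 'a \<Rightarrow> 'b::comm_ring_1)" and "k < n"
  shows "(\<Sum>j<n. h (\<zeta> ^ (j * (n - k))) * (\<Sum>i<n. r i * (h (\<zeta> ^ j) * \<xi>) ^ i))
    = of_nat n * (r k * \<xi> ^ k)"
proof -
  interpret ring_map h by fact
  have pw: "h z ^ m = h (z ^ m)" for z m by (induction m) (simp_all add: map_simps)
  have sm: "h (\<Sum>j\<in>J. f j) = (\<Sum>j\<in>J. h (f j))" for f and J :: "nat set"
    by (induction J rule: infinite_finite_induct) (simp_all add: map_simps)
  have nt: "h (of_nat m) = of_nat m" for m by (induction m) (simp_all add: map_simps)
  have "(\<Sum>j<n. h (\<zeta> ^ (j * (n - k))) * (\<Sum>i<n. r i * (h (\<zeta> ^ j) * \<xi>) ^ i))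
     = (\<Sum>j<n. \<Sum>i<n. h (\<zeta> ^ (j * (n - k)) * \<zeta> ^ (j * i)) * (r i * \<xi> ^ i))"
    unfolding sum_distrib_left
    by (intro sum.cong refl) (simp add: map_mult power_mult_distrib pw power_mult mult_ac)
  also have "\<dots> = (\<Sum>i<n. (\<Sum>j<n. h (\<zeta> ^ (j * (n - k)) * \<zeta> ^ (j * i))) * (r i * \<xi> ^ i))"
    unfolding sum_distrib_right by (rule sum.swap)
  also have "\<dots> = (\<Sum>i<n. if i = k then of_nat n * (r i * \<xi> ^ i) else 0)"
  proof (intro sum.cong refl)
    fix i assume "i \<in> {..<n}"
    then have "(\<Sum>j<n. h (\<zeta> ^ (j * (n - k)) * \<zeta> ^ (j * i))) = h (if i = k then of_nat n else 0)"
      using zeta_sum[of i k] assms(2) unfolding sm [symmetric] by simp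
    then show "(\<Sum>j<n. h (\<zeta> ^ (j * (n - k)) * \<zeta> ^ (j * i))) * (r i * \<xi> ^ i)
       = (if i = k then of_nat n * (r i * \<xi> ^ i) else 0)"
      by (simp add: nt map_simps)
  qed
  also have "\<dots> = of_nat n * (r k * \<xi> ^ k)"
    using assms(2) by simp
  finally show ?thesis .
qed

lemma inj_on_zeta: "inj_on (\<lambda>j. \<zeta> ^ j) {..<n}"
proof -
  have *: "\<zeta> ^ i \<noteq> \<zeta> ^ j" if "i < j" "j < n" for i j
  proof
    assume "\<zeta> ^ i = \<zeta> ^ j"
    also have "\<zeta> ^ j = \<zeta> ^ i * \<zeta> ^ (j - i)"
      using that by (simp flip: power_add)
    finally have "\<zeta> ^ (j - i) = 1" using zeta_nz by simp
    moreover have "\<not> n dvd j - i" using that by (auto dest: dvd_imp_le)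
    ultimately show False using zeta_power_neq_1 by blast
  qed
  show ?thesis
    by (rule inj_onI) (metis * lessThan_iff linorder_neqE_nat)
qed

end

lemma prime_root_exists:
  assumes "prime n"
  obtains \<zeta> :: "'a::{alg_closed_field, field_char_0}" where "prime_root n \<zeta>"
proof -
  have n: "n > 1" using assms by (rule prime_gt_1_nat)
  \<comment> \<open>A root of 1 + X + ... + X^(n-1). This polynomial has the value n at 1, which is
    not 0 in characteristic 0, so the root differs from 1.\<close>
  obtain \<zeta> :: 'a where z: "(\<Sum>k\<le>n - 1. 1 * \<zeta> ^ k) = 0"
    using alg_closed[of "n - 1" "\<lambda>_. 1"] n by auto
  then have s: "(\<Sum>k<n. \<zeta> ^ k) = 0"
    using n by (simp add: lessThan_Suc_atMost [symmetric])
  then have "\<zeta> \<noteq> 1" using n by auto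
  moreover have "\<zeta> ^ n = 1"
    using s power_diff_1_eq[of \<zeta> n] by simp
  ultimately show ?thesis using that assms by (simp add: prime_root_def)
qed

section \<open>The affine curve and its fibres over y\<close>

locale affine_fermat =
  fixes n :: nat and b c :: "'a::{alg_closed_field, field_char_0}"
  assumes n_prime: "prime n" and n_ge: "n \<ge> 5" and b_nz: "b \<noteq> 0" and c_nz: "c \<noteq> 0"
begin

definition on_curve :: "'a \<Rightarrow> 'a \<Rightarrow> bool" where
  "on_curve x y \<longleftrightarrow> x ^ n + b * y ^ n + c = 0"

abbreviation ev :: "'a poly poly \<Rightarrow> 'a \<Rightarrow> 'a \<Rightarrow> 'a" where
  "ev A x y \<equiv> eval2 (\<lambda>x. x) x y A"

definition vanishes :: "'a poly poly \<Rightarrow> bool" where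
  "vanishes A \<longleftrightarrow> (\<forall>x y. on_curve x y \<longrightarrow> ev A x y = 0)"

lemma n_pos: "n > 0" using n_ge by simp

lemma on_curve_exists: "\<exists>x. on_curve x y"
proof -
  obtain x where "x ^ n = - (b * y ^ n + c)" using nth_root_exists[OF n_pos] by blast
  then show ?thesis by (auto simp: on_curve_def algebra_simps intro!: exI[of _ x])
qed

lemma finite_branch: "finite {y. b * y ^ n + c = 0}"
proof -
  have "monom b n + [:c:] \<noteq> 0"
  proof
    assume "monom b n + [:c:] = 0"
    then have "coeff (monom b n + [:c:]) n = 0" by simp
    then show False using b_nz n_pos by (simp add: coeff_pCons split: nat.splits)
  qed
  from poly_roots_finite[OF this] show ?thesis
    by (simp add: poly_monom)
qed

lemma fibre:
  assumes "b * y ^ n + c \<noteq> 0"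
  shows "finite {x. on_curve x y}" "card {x. on_curve x y} \<ge> n"
proof -
  obtain \<zeta> :: 'a where "prime_root n \<zeta>" using prime_root_exists[OF n_prime] .
  then interpret prime_root n \<zeta> .
  have "monom 1 n + [:b * y ^ n + c:] \<noteq> 0"
  proof
    assume "monom 1 n + [:b * y ^ n + c:] = 0"
    then have "coeff (monom 1 n + [:b * y ^ n + c:]) n = 0" by simp
    then show False using n_pos by (simp add: coeff_pCons split: nat.splits)
  qed
  from poly_roots_finite[OF this] show fin: "finite {x. on_curve x y}"
    by (simp add: poly_monom on_curve_def add.assoc)
  obtain x where x: "on_curve x y" using on_curve_exists by blast
  have "x \<noteq> 0" using x assms n_pos by (auto simp: on_curve_def zero_power)
  then have "inj_on (\<lambda>j. \<zeta> ^ j * x) {..<n}"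
    using inj_on_zeta by (auto simp: inj_on_def)
  then have "card ((\<lambda>j. \<zeta> ^ j * x) ` {..<n}) = n" by (simp add: card_image)
  moreover have "(\<lambda>j. \<zeta> ^ j * x) ` {..<n} \<subseteq> {x. on_curve x y}"
    using x by (auto simp: on_curve_def power_mult_distrib)
  ultimately show "card {x. on_curve x y} \<ge> n" using card_mono[OF fin] by metis
qed

lemma fibre_poly_eq_0:
  assumes "b * y ^ n + c \<noteq> 0" and "\<And>x. on_curve x y \<Longrightarrow> poly q x = 0" and "\<forall>i\<ge>n. coeff q i = 0"
  shows "q = 0"
proof (rule ccontr)
  assume q: "q \<noteq> 0"
  have "degree q < n"
    using q assms(3) by (meson leading_coeff_0_iff linorder_not_le)
  moreover have "card {x. on_curve x y} \<le> card {x. poly q x = 0}"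
    using assms(2) by (intro card_mono poly_roots_finite[OF q]) auto
  then have "n \<le> card {x. poly q x = 0}" using fibre(2)[OF assms(1)] by linarith
  ultimately show False using card_poly_roots_bound[OF q] by linarith
qed

text \<open>Over each unbranched y of the infinite set the polynomial in x has more roots than its
  degree permits, so every coefficient vanishes at infinitely many y.\<close>

lemma low_vanishing_eq_0:
  assumes "infinite {y. \<forall>x. on_curve x y \<longrightarrow> ev R x y = 0}" and "\<forall>i\<ge>n. coeff R i = 0"
  shows "R = 0"
proof (rule ccontr)
  assume "R \<noteq> 0"
  then obtain i where i: "coeff R i \<noteq> 0" by (metis leading_coeff_0_iff)
  let ?\<eta> = "{y. \<forall>x. on_curve x y \<longrightarrow> ev R x y = 0} - {y. b * y ^ n + c = 0}"
  have "infinite ?\<eta>" using assms(1) finite_branch by (simp add: Diff_infinite_finite)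
  moreover have "?\<eta> \<subseteq> {y. poly (coeff R i) y = 0}"
  proof clarify
    fix y assume y: "\<forall>x. on_curve x y \<longrightarrow> ev R x y = 0" "b * y ^ n + c \<noteq> 0"
    have "map_poly (\<lambda>q. poly q y) R = 0"
      using y assms(2)
      by (intro fibre_poly_eq_0[OF y(2)]) (auto simp: eval2_def coeff_map_poly)
    then have "coeff (map_poly (\<lambda>q. poly q y) R) i = 0" by simp
    then show "poly (coeff R i) y = 0" by (simp add: coeff_map_poly)
  qed
  ultimately show False using poly_roots_finite[OF i] finite_subset by blast
qed

text \<open>This replaces the Nullstellensatz: the remainder modulo the equation has degree less
  than \<open>n\<close> in x and falls under \<open>low_vanishing_eq_0\<close>.\<close>

lemma curve_poly_dvd:
  assumes "infinite {y. \<forall>x. on_curve x y \<longrightarrow> ev A x y = 0}"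
  obtains Q where "A = curve_poly n b c * Q"
proof -
  obtain Q R where A: "A = curve_poly n b c * Q + R" and R: "\<forall>i\<ge>n. coeff R i = 0"
    using reduce_mod_curve_poly[OF n_pos] .
  have "ev A x y = ev R x y" if "on_curve x y" for x y
    using that by (simp add: A on_curve_def)
  then have "R = 0" using assms low_vanishing_eq_0[OF _ R] by simp
  with A have "A = curve_poly n b c * Q" by simp
  then show ?thesis by (rule that)
qed

end

section \<open>Orders of Laurent series\<close>

unbundle Formal_Power_Series.fps_syntax
unbundle Formal_Laurent_Series.fps_syntax

text \<open>\<open>fls_subdegree 0\<close> is 0, so a bound on the subdegree would be wrong for the
  zero series. Stated for coefficients, the bound holds there for every \<open>m\<close>.\<close>

definition ord_ge :: "int \<Rightarrow> 'a::zero fls \<Rightarrow> bool" where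
  "ord_ge m f \<longleftrightarrow> (\<forall>i<m. f $$ i = 0)"

lemma ord_ge_iff: "ord_ge m f \<longleftrightarrow> f = 0 \<or> m \<le> fls_subdegree f"
  unfolding ord_ge_def
  by (metis fls_eq0_below_subdegree fls_subdegree_geI fls_zero_nth less_le_trans)

lemma ord_ge_0 [simp]: "ord_ge m 0"
  by (simp add: ord_ge_def)

lemma ord_ge_const [simp]: "ord_ge 0 (fls_const a)"
  by (simp add: ord_ge_def)

lemma ord_ge_1 [simp]: "ord_ge 0 (1 :: 'a::{zero_neq_one,monoid_mult} fls)"
  by (simp add: ord_ge_def)

lemma ord_ge_add: "ord_ge m f \<Longrightarrow> ord_ge m g \<Longrightarrow> ord_ge m (f + g)"
  by (simp add: ord_ge_def)

lemma ord_ge_diff: "ord_ge m f \<Longrightarrow> ord_ge m g \<Longrightarrow> ord_ge m (f - (g :: 'a::ring_1 fls))"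
  by (simp add: ord_ge_def)

lemma ord_ge_sum: "(\<And>i. i \<in> I \<Longrightarrow> ord_ge m (f i)) \<Longrightarrow> ord_ge m (\<Sum>i\<in>I. f i)"
  by (induction I rule: infinite_finite_induct) (auto intro: ord_ge_add)

lemma ord_ge_mult:
  fixes f g :: "'a::field fls"
  assumes "ord_ge k f" "ord_ge m g"
  shows "ord_ge (k + m) (f * g)"
  using assms by (cases "f = 0"; cases "g = 0") (auto simp: ord_ge_iff)

lemma ord_ge_mult_0:
  fixes f g :: "'a::field fls"
  shows "ord_ge 0 f \<Longrightarrow> ord_ge 0 g \<Longrightarrow> ord_ge 0 (f * g)"
  using ord_ge_mult[of 0 f 0 g] by simp

lemma ord_ge_deriv: "ord_ge 0 f \<Longrightarrow> ord_ge 0 (fls_deriv (f :: 'a::ring_1 fls))"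
  unfolding ord_ge_def
proof (intro allI impI)
  fix i :: int assume f: "\<forall>i<0. f $$ i = 0" and "i < 0"
  then show "fls_deriv f $$ i = 0" by (cases "i = -1") auto
qed

lemma ord_ge_cancel:
  fixes f g :: "'a::field fls"
  assumes "g \<noteq> 0" "ord_ge (m + fls_subdegree g) (f * g)"
  shows "ord_ge m f"
  using assms by (cases "f = 0") (auto simp: ord_ge_iff)

text \<open>The triple holds the coefficients of a line. The map \<open>h\<close> allows the same
  line to be evaluated at points, at polynomials and at Laurent series.\<close>

definition linear_form :: "('a \<Rightarrow> 'b::comm_ring_1) \<Rightarrow> 'b \<Rightarrow> 'b \<Rightarrow> 'b \<Rightarrow> 'a triple \<Rightarrow> 'b" where
  "linear_form h u v w = (\<lambda>(r, s, t). h r * u + h s * v + h t * w)"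

lemma linear_form_scale:
  "linear_form h (z * u) (z * v) (z * w) l = z * linear_form h u v w l"
  by (cases l) (simp add: linear_form_def algebra_simps)

lemma prod_linear_form_scale:
  "prod_list (map (linear_form h (z * u) (z * v) (z * w)) ls)
    = z ^ length ls * prod_list (map (linear_form h u v w) ls)"
  by (induction ls) (simp_all add: linear_form_scale)

lemma ord_ge_prod_linear_form:
  fixes u v w :: "'a::field fls"
  assumes "ord_ge 0 u" "ord_ge 0 v" "ord_ge 0 w"
  shows "ord_ge 0 (prod_list (map (linear_form fls_const u v w) ls))"
  using assms
  by (induction ls) (auto simp: linear_form_def intro!: ord_ge_mult_0 ord_ge_add)

text \<open>The hypotheses say that the vector with entries \<open>Ai * vi\<close> is orthogonal to
  u and to d; so it is parallel to the cross product of u and d. In the application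
  \<open>vi\<close> is \<open>ui ^ (n - 1)\<close> and \<open>di\<close> is the derivative of
  \<open>ui\<close>.\<close>

lemma cross_product_proportional:
  fixes A0 :: "'a::comm_ring_1"
  assumes "A0 * (u0 * v0) + A1 * (u1 * v1) + A2 * (u2 * v2) = 0"
    and "A0 * (v0 * d0) + A1 * (v1 * d1) + A2 * (v2 * d2) = 0"
  shows "A1 * v1 * (u1 * d2 - u2 * d1) = A0 * v0 * (u2 * d0 - u0 * d2)"
    and "A2 * v2 * (u1 * d2 - u2 * d1) = A0 * v0 * (u0 * d1 - u1 * d0)"
proof -
  have "A1 * v1 * (u1 * d2 - u2 * d1) - A0 * v0 * (u2 * d0 - u0 * d2)
    = d2 * (A0 * (u0 * v0) + A1 * (u1 * v1) + A2 * (u2 * v2))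
      - u2 * (A0 * (v0 * d0) + A1 * (v1 * d1) + A2 * (v2 * d2))"
    by (simp add: algebra_simps)
  then show "A1 * v1 * (u1 * d2 - u2 * d1) = A0 * v0 * (u2 * d0 - u0 * d2)"
    using assms by simp
  have "A2 * v2 * (u1 * d2 - u2 * d1) - A0 * v0 * (u0 * d1 - u1 * d0)
    = u1 * (A0 * (v0 * d0) + A1 * (v1 * d1) + A2 * (v2 * d2))
      - d1 * (A0 * (u0 * v0) + A1 * (u1 * v1) + A2 * (u2 * v2))"
    by (simp add: algebra_simps)
  then show "A2 * v2 * (u1 * d2 - u2 * d1) = A0 * v0 * (u0 * d1 - u1 * d0)"
    using assms by simp
qed

text \<open>
  The pullback of a regular differential is regular: after dividing by a coordinate of least
  order, one of the three expressions for the pullback has denominator 1.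
\<close>

lemma regular_pullback:
  fixes p0 p1 p2 :: "'a::field_char_0 fls"
  assumes n: "n \<ge> 5" and len: "length ls = n - 3"
    and nz: "a0 \<noteq> 0" "a1 \<noteq> 0" "a2 \<noteq> 0" and p0: "p0 \<noteq> 0"
    and eq: "fls_const a0 * p0 ^ n + fls_const a1 * p1 ^ n + fls_const a2 * p2 ^ n = 0"
  obtains q where "ord_ge 0 q"
    "prod_list (map (linear_form fls_const p0 p1 p2) ls) * (p1 * fls_deriv p2 - p2 * fls_deriv p1)
      = q * p0 ^ (n - 1)"
proof -
  note result = that
  \<comment> \<open>The claim is homogeneous: \<open>n - 3\<close> linear forms and the two factors
    in each Wronskian term scale like \<open>p0 ^ (n - 1)\<close>. So one may divide by
    \<open>T\<close>, after which all coordinates are regular and one of them is 1.\<close>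
  have main: thesis if T: "T \<noteq> 0" and u: "p0 = T * u0" "p1 = T * u1" "p2 = T * u2"
    and one: "u0 = 1 \<or> u1 = 1 \<or> u2 = 1" and ge: "ord_ge 0 u0" "ord_ge 0 u1" "ord_ge 0 u2"
    for T u0 u1 u2
  proof -
    let ?d = "fls_deriv"
    define G where "G = prod_list (map (linear_form fls_const u0 u1 u2) ls)"
    define W0 W1 W2 where "W0 = u1 * ?d u2 - u2 * ?d u1" "W1 = u2 * ?d u0 - u0 * ?d u2"
      "W2 = u0 * ?d u1 - u1 * ?d u0"
    have pw: "z ^ n = z * z ^ (n - 1)" for z :: "'a fls"
      using n by (metis Suc_diff_1 less_le_trans power_Suc zero_less_numeral)
    have "T ^ n * (fls_const a0 * u0 ^ n + fls_const a1 * u1 ^ n + fls_const a2 * u2 ^ n) = 0"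
      using eq unfolding u by (simp add: power_mult_distrib algebra_simps)
    then have e: "fls_const a0 * u0 ^ n + fls_const a1 * u1 ^ n + fls_const a2 * u2 ^ n = 0"
      using T by simp
    then have "?d (fls_const a0 * u0 ^ n + fls_const a1 * u1 ^ n + fls_const a2 * u2 ^ n) = 0"
      by simp
    then have "of_nat n * (fls_const a0 * (u0 ^ (n - 1) * ?d u0) + fls_const a1 * (u1 ^ (n - 1) * ?d u1)
        + fls_const a2 * (u2 ^ (n - 1) * ?d u2)) = 0"
      by (simp add: fls_deriv_power algebra_simps)
    moreover have "(of_nat n :: 'a fls) \<noteq> 0"
      using n by (simp add: fls_of_nat)
    ultimately have de: "fls_const a0 * (u0 ^ (n - 1) * ?d u0) + fls_const a1 * (u1 ^ (n - 1) * ?d u1)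
        + fls_const a2 * (u2 ^ (n - 1) * ?d u2) = 0" by simp
    define v0 v1 v2 where v: "v0 = u0 ^ (n - 1)" "v1 = u1 ^ (n - 1)" "v2 = u2 ^ (n - 1)"
    note e = e[unfolded pw, folded v] and de = de[folded v]
    \<comment> \<open>The three Wronskians are proportional to the \<open>ai * ui ^ (n - 1)\<close>.
      Once some \<open>ui\<close> is 1, this exhibits \<open>W0\<close> as \<open>v0\<close> times a
      regular series.\<close>
    have W1: "fls_const a1 * v1 * W0 = fls_const a0 * v0 * W1"
      unfolding W0_W1_W2_def using e de by (rule cross_product_proportional)
    have W2: "fls_const a2 * v2 * W0 = fls_const a0 * v0 * W2"
      unfolding W0_W1_W2_def using e de by (rule cross_product_proportional)
    have W: "p1 * ?d p2 - p2 * ?d p1 = T ^ 2 * W0"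
      unfolding u W0_W1_W2_def by (simp add: algebra_simps power2_eq_square)
    have "n - 1 = (n - 3) + 2" using n by simp
    then have LHS: "prod_list (map (linear_form fls_const p0 p1 p2) ls) * (p1 * ?d p2 - p2 * ?d p1)
        = T ^ (n - 1) * (G * W0)"
      unfolding W unfolding u prod_linear_form_scale G_def len
      by (simp add: power_add power2_eq_square)
    have pp: "p0 ^ (n - 1) = T ^ (n - 1) * v0" unfolding u v by (simp add: power_mult_distrib)
    have regG: "ord_ge 0 G" unfolding G_def using ge by (rule ord_ge_prod_linear_form)
    have regW: "ord_ge 0 W0" "ord_ge 0 W1" "ord_ge 0 W2"
      unfolding W0_W1_W2_def using ge by (auto intro!: ord_ge_diff ord_ge_mult_0 ord_ge_deriv)
    have fin: thesis if "ord_ge 0 q" "G * W0 = q * v0" for q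
      using that(1) by (rule result) (simp only: LHS pp that(2) mult_ac)
    consider "u0 = 1" | "u1 = 1" | "u2 = 1" using one by blast
    then show thesis
    proof cases
      case 1
      then show ?thesis using regG regW by (intro fin[of "G * W0"]) (auto simp: v intro: ord_ge_mult_0)
    next
      case 2
      then have "fls_const a1 * W0 = fls_const a0 * v0 * W1" using W1 by (simp add: v)
      then have "fls_const (inverse a1) * (fls_const a1 * W0) = fls_const (inverse a1) * (fls_const a0 * v0 * W1)"
        by simp
      then have "W0 = fls_const (inverse a1) * fls_const a0 * v0 * W1"
        using nz by (simp only: mult.assoc [symmetric] fls_const_mult_const) simp
      then have "G * W0 = (G * (fls_const (inverse a1) * fls_const a0) * W1) * v0"
        by (simp only: mult_ac)
      then show ?thesis
        by (rule fin[rotated]) (intro ord_ge_mult_0 regG regW ord_ge_const)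
    next
      case 3
      then have "fls_const a2 * W0 = fls_const a0 * v0 * W2" using W2 by (simp add: v)
      then have "fls_const (inverse a2) * (fls_const a2 * W0) = fls_const (inverse a2) * (fls_const a0 * v0 * W2)"
        by simp
      then have "W0 = fls_const (inverse a2) * fls_const a0 * v0 * W2"
        using nz by (simp only: mult.assoc [symmetric] fls_const_mult_const) simp
      then have "G * W0 = (G * (fls_const (inverse a2) * fls_const a0) * W2) * v0"
        by (simp only: mult_ac)
      then show ?thesis
        by (rule fin[rotated]) (intro ord_ge_mult_0 regG regW ord_ge_const)
    qed
  qed
  \<comment> \<open>A nonzero coordinate of least order is the right divisor
    \<open>T\<close>.\<close>
  define S where "S = {p \<in> {p0, p1, p2}. p \<noteq> 0}"
  have "finite S" "S \<noteq> {}" using p0 by (auto simp: S_def)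
  then obtain T where T: "T \<in> S" "\<And>p. p \<in> S \<Longrightarrow> fls_subdegree T \<le> fls_subdegree p"
    using ex_min_if_finite[of "fls_subdegree ` S"] by (metis (no_types, lifting) arg_min_if_finite(1) arg_min_least)
  have T0: "T \<noteq> 0" using T by (simp add: S_def)
  have quot: "ord_ge 0 (p / T)" if "p \<in> {p0, p1, p2}" for p
  proof (cases "p = 0")
    case False
    then have "fls_subdegree T \<le> fls_subdegree p" using T(2)[of p] that by (auto simp: S_def)
    moreover have "p = T * (p / T)" using T0 by simp
    then have "fls_subdegree p = fls_subdegree T + fls_subdegree (p / T)"
      using False T0 by (metis fls_subdegree_mult mult_zero_right)
    ultimately show ?thesis by (simp add: ord_ge_iff)
  qed simp
  show thesis
  proof (rule main[OF T0])
    show "p0 = T * (p0 / T)" "p1 = T * (p1 / T)" "p2 = T * (p2 / T)" using T0 by simp_all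
    show "p0 / T = 1 \<or> p1 / T = 1 \<or> p2 / T = 1" using T(1) T0 by (auto simp: S_def)
  qed (use quot in auto)
qed

section \<open>Derivatives and orders of polynomials evaluated at Laurent series\<close>

lemma fls_deriv_eval1:
  "fls_deriv (eval1 fls_const \<eta> q) = eval1 fls_const \<eta> (pderiv q) * fls_deriv \<eta>"
  for \<eta> :: "'a::field fls"
  by (induction q) (simp_all add: pderiv_pCons algebra_simps)

lemma fls_deriv_eval2:
  fixes \<xi> \<eta> :: "'a::field fls"
  shows "fls_deriv (eval2 fls_const \<xi> \<eta> A) = eval2 fls_const \<xi> \<eta> (pderiv A) * fls_deriv \<xi>
    + eval2 fls_const \<xi> \<eta> (map_poly pderiv A) * fls_deriv \<eta>"
  by (induction A) (simp_all add: pderiv_pCons map_poly_pCons fls_deriv_eval1 algebra_simps)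

lemma eval1_fps:
  fixes u :: "'a::field fps"
  shows "\<exists>g. eval1 fls_const (fps_to_fls u) q = fps_to_fls g \<and> g $ 0 = poly q (u $ 0)"
proof (induction q)
  case (pCons a q)
  then obtain g where g: "eval1 fls_const (fps_to_fls u) q = fps_to_fls g" "g $ 0 = poly q (u $ 0)"
    by blast
  have "fls_const a + fps_to_fls u * fps_to_fls g = fps_to_fls (fps_const a + u * g)"
    by (simp add: fls_times_fps_to_fls)
  then show ?case using g by (intro exI[of _ "fps_const a + u * g"]) simp
qed (auto intro: exI[of _ 0])

text \<open>After \<open>[:- a, 1:] ^ order\<close> is split off, the cofactor is a unit at the
  place. The order of u - a is the ramification index of y there.\<close>

lemma eval1_order:
  fixes u :: "'a::field fps"
  assumes "q \<noteq> 0" and ne: "fps_to_fls u \<noteq> fls_const a" and pos: "u $ 0 = a"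
  shows "eval1 fls_const (fps_to_fls u) q \<noteq> 0"
    and "fls_subdegree (eval1 fls_const (fps_to_fls u) q)
      = int (Polynomial.order a q) * fls_subdegree (fps_to_fls u - fls_const a)"
proof -
  obtain r where r: "q = [:- a, 1:] ^ Polynomial.order a q * r" "\<not> [:- a, 1:] dvd r"
    using order_decomp[OF assms(1)] by blast
  have "poly r a \<noteq> 0" using r(2) by (simp add: poly_eq_0_iff_dvd)
  then obtain g where g: "eval1 fls_const (fps_to_fls u) r = fps_to_fls g" "g $ 0 \<noteq> 0"
    using eval1_fps[of u r] pos by auto
  have "subdegree g = 0" using g(2) by (rule subdegree_eq_0)
  moreover have "g \<noteq> 0" using g(2) by auto
  moreover have "eval1 fls_const (fps_to_fls u) q
      = (fps_to_fls u - fls_const a) ^ Polynomial.order a q * fps_to_fls g"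
    by (subst r(1)) (simp add: g(1))
  ultimately show "eval1 fls_const (fps_to_fls u) q \<noteq> 0"
    "fls_subdegree (eval1 fls_const (fps_to_fls u) q)
      = int (Polynomial.order a q) * fls_subdegree (fps_to_fls u - fls_const a)"
    using ne by (simp_all add: fls_subdegree_pow fls_subdegree_fls_to_fps)
qed

text \<open>The leading term has the deepest pole: each Horner step multiplies by
  \<open>fls_X_inv\<close> and adds a constant, which cannot cancel it.\<close>

lemma eval1_infinity:
  fixes q :: "'a::field poly"
  assumes "q \<noteq> 0"
  shows "eval1 fls_const fls_X_inv q \<noteq> 0 \<and> fls_subdegree (eval1 fls_const fls_X_inv q) = - int (degree q)"
  using assms
proof (induction q)
  case (pCons a q)
  show ?case
  proof (cases "q = 0")
    case True
    then show ?thesis using pCons by simp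
  next
    case False
    let ?e = "fls_X_inv * eval1 fls_const fls_X_inv q"
    have e: "?e \<noteq> 0" "fls_subdegree ?e = - 1 - int (degree q)"
      using pCons False by simp_all
    then have "fls_subdegree (?e + fls_const a) = fls_subdegree ?e"
      by (intro fls_subdegree_add_eq1) simp_all
    moreover from this e have "?e + fls_const a \<noteq> 0"
      by (metis fls_zero_subdegree add.commute add_0 diff_0 diff_conv_add_uminus neg_equal_0_iff_equal of_nat_Suc of_nat_eq_0_iff nat.distinct(1) minus_add_distrib)
    ultimately show ?thesis using e False by (simp add: add.commute)
  qed
qed simp

lemma fps_root_exists:
  fixes s :: "'a::field_char_0 fps"
  assumes "n > 0" "z ^ n = s $ 0" "z \<noteq> 0"
  obtains u where "u ^ n = s" "u $ 0 = z"
proof -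
  obtain k where k: "n = Suc k" using assms(1) by (cases n) auto
  let ?u = "fps_radical (\<lambda>_ _. z) (Suc k) s"
  have "s $ 0 \<noteq> 0" using assms by (metis power_not_zero)
  then have "?u ^ Suc k = s" using power_radical[of s "\<lambda>_ _. z" k] assms(2) k by simp
  moreover have "?u $ 0 = z" by simp
  ultimately show thesis using that k by blast
qed

section \<open>Places of the Fermat curve\<close>

lemma (in ring_map) eval2_pcompose_scale:
  "eval2 h \<xi> \<eta> (pcompose R [:0, [:z:]:]) = eval2 h (h z * \<xi>) \<eta> R"
  by (induction R) (simp_all add: pcompose_pCons map_simps mult_ac)

lemma (in ring_map) eval2_linear_form:
  "eval2 h \<xi> \<eta> (linear_form (\<lambda>a. [:[:a:]:]) A B D l)
    = linear_form h (eval2 h \<xi> \<eta> A) (eval2 h \<xi> \<eta> B) (eval2 h \<xi> \<eta> D) l"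
  by (cases l) (simp add: linear_form_def)

lemma (in ring_map) eval2_prod_linear_form:
  "eval2 h \<xi> \<eta> (prod_list (map (linear_form (\<lambda>a. [:[:a:]:]) A B D) ls))
    = prod_list (map (linear_form h (eval2 h \<xi> \<eta> A) (eval2 h \<xi> \<eta> B) (eval2 h \<xi> \<eta> D)) ls)"
  by (induction ls) (simp_all add: eval2_linear_form)

lemma dvd_if_order_le:
  fixes D q :: "'a::alg_closed_field poly"
  assumes "D \<noteq> 0" "q \<noteq> 0" "\<And>a. Polynomial.order a D \<le> Polynomial.order a q"
  shows "D dvd q"
  using assms
proof (induction "degree D" arbitrary: D q)
  case 0
  then show ?case by (metis is_unit_iff_degree unit_imp_dvd)
next
  case (Suc m)
  then obtain a where "poly D a = 0" using alg_closed_imp_poly_has_root[of D] by auto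
  then obtain D' where D: "D = [:- a, 1:] * D'" by (auto simp: poly_eq_0_iff_dvd elim: dvdE)
  have "Polynomial.order a q \<noteq> 0"
    using Suc.prems(3)[of a] \<open>poly D a = 0\<close> Suc.prems(1) by (metis le_zero_eq order_root)
  then have "poly q a = 0" by (metis order_0I)
  then obtain q' where q: "q = [:- a, 1:] * q'" by (auto simp: poly_eq_0_iff_dvd elim: dvdE)
  have "D' dvd q'"
  proof (rule Suc.hyps(1))
    show nz: "D' \<noteq> 0" "q' \<noteq> 0" using Suc.prems D q by auto
    show "m = degree D'" using Suc.hyps(2) nz by (simp add: D degree_mult_eq del: mult_pCons_left)
    fix x
    have nz': "[:- a, 1:] * D' \<noteq> 0" "[:- a, 1:] * q' \<noteq> 0" using nz by (simp_all del: mult_pCons_left)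
    show "Polynomial.order x D' \<le> Polynomial.order x q'"
      using Suc.prems(3)[of x] unfolding D q order_mult[OF nz'(1)] order_mult[OF nz'(2)] by simp
  qed
  then show ?case unfolding D q by (rule mult_dvd_mono[OF dvd_refl])
qed

context affine_fermat begin

text \<open>The derivation x^(n-1) d/dy along the curve, where dx/dy = - b y^(n-1) / x^(n-1); the
  factor x^(n-1) keeps it polynomial. Here \<open>pderiv\<close> differentiates with respect to x
  and \<open>map_poly pderiv\<close> with respect to y.\<close>

definition tangent :: "'a poly poly \<Rightarrow> 'a poly poly" where
  "tangent A = monom 1 (n - 1) * map_poly pderiv A - smult (monom b (n - 1)) (pderiv A)"

end

text \<open>A parametrised formal branch of the curve, possibly at infinity. That \<eta> has nonzero
  derivative makes y nonconstant on it, so the order of dy can be subtracted in estimates.\<close>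

locale fermat_place = affine_fermat +
  fixes \<xi> \<eta> :: "'a fls"
  assumes place_eq: "\<xi> ^ n + fls_const b * \<eta> ^ n + fls_const c = 0"
    and xi_nz: "\<xi> \<noteq> 0" and eta_deriv_nz: "fls_deriv \<eta> \<noteq> 0"
begin

abbreviation pull :: "'a poly poly \<Rightarrow> 'a fls" where
  "pull \<equiv> eval2 fls_const \<xi> \<eta>"

text \<open>Vanishing at all points passes to Laurent series through its algebraic form,
  divisibility by the equation.\<close>

lemma place_vanishes:
  assumes "vanishes A"
  shows "pull A = 0"
proof -
  have "{y. \<forall>x. on_curve x y \<longrightarrow> ev A x y = 0} = UNIV" using assms by (auto simp: vanishes_def)
  then have "infinite {y. \<forall>x. on_curve x y \<longrightarrow> ev A x y = 0}"
    using infinite_UNIV_char_0[where ?'a = 'a] by simp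
  then obtain Q where "A = curve_poly n b c * Q" by (rule curve_poly_dvd)
  then show ?thesis using place_eq by simp
qed

lemma place_deriv: "\<xi> ^ (n - 1) * fls_deriv \<xi> = - (fls_const b * \<eta> ^ (n - 1) * fls_deriv \<eta>)"
proof -
  have "fls_deriv (\<xi> ^ n + fls_const b * \<eta> ^ n + fls_const c) = 0" by (simp add: place_eq)
  then have "of_nat n * (\<xi> ^ (n - 1) * fls_deriv \<xi> + fls_const b * \<eta> ^ (n - 1) * fls_deriv \<eta>) = 0"
    by (simp add: fls_deriv_power algebra_simps)
  moreover have "(of_nat n :: 'a fls) \<noteq> 0" using n_pos by (simp add: fls_of_nat)
  ultimately have "\<xi> ^ (n - 1) * fls_deriv \<xi> + fls_const b * \<eta> ^ (n - 1) * fls_deriv \<eta> = 0" by simp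
  then show ?thesis by (simp add: add_eq_0_iff2)
qed

lemma place_tangent: "\<xi> ^ (n - 1) * fls_deriv (pull A) = fls_deriv \<eta> * pull (tangent A)"
proof -
  have "\<xi> ^ (n - 1) * fls_deriv (pull A)
    = pull (pderiv A) * (\<xi> ^ (n - 1) * fls_deriv \<xi>) + pull (map_poly pderiv A) * \<xi> ^ (n - 1) * fls_deriv \<eta>"
    by (simp add: fls_deriv_eval2 algebra_simps)
  also have "\<dots> = fls_deriv \<eta> * pull (tangent A)"
    unfolding place_deriv by (simp add: tangent_def algebra_simps)
  finally show ?thesis .
qed

lemma place_rotate:
  assumes "z ^ n = 1"
  shows "fermat_place n b c (fls_const z * \<xi>) \<eta>"
proof unfold_locales
  show "(fls_const z * \<xi>) ^ n + fls_const b * \<eta> ^ n + fls_const c = 0"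
    using place_eq assms by (simp add: power_mult_distrib fls_const_power [symmetric])
  have "z \<noteq> 0" using assms n_pos by (metis zero_neq_one zero_power)
  then show "fls_const z * \<xi> \<noteq> 0" using xi_nz by simp
qed (rule eta_deriv_nz)

end

context affine_fermat begin

text \<open>Here y - a is a local parameter, and x is an n-th root of a series with nonzero constant
  term.\<close>

lemma unbranched_place:
  assumes "b * a ^ n + c \<noteq> 0"
  obtains \<xi> where "fermat_place n b c \<xi> (fps_to_fls (fps_const a + fps_X))" "fls_subdegree \<xi> = 0"
proof -
  let ?e = "fps_const a + fps_X :: 'a fps"
  let ?s = "- (fps_const b * ?e ^ n + fps_const c)"
  have s0: "?s $ 0 = - (b * a ^ n + c)" by (simp add: fps_power_zeroth)
  obtain z where z: "z ^ n = ?s $ 0" using nth_root_exists[OF n_pos] by blast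
  have z0: "z \<noteq> 0" using z assms s0 n_pos by (metis neg_equal_0_iff_equal zero_power)
  obtain u where u: "u ^ n = ?s" "u $ 0 = z" using fps_root_exists[OF n_pos z z0] .
  have "fps_to_fls u ^ n = fps_to_fls ?s" by (simp only: u(1) [symmetric] fps_to_fls_power)
  then have eq: "fps_to_fls u ^ n + fls_const b * fps_to_fls ?e ^ n + fls_const c = 0"
    by (simp add: fls_times_fps_to_fls fps_to_fls_power)
  have "fls_deriv (fps_to_fls ?e) = 1" by simp
  moreover have "u \<noteq> 0" using u z0 by auto
  ultimately have "fermat_place n b c (fps_to_fls u) (fps_to_fls ?e)"
    using eq by unfold_locales auto
  moreover have "fls_subdegree (fps_to_fls u) = 0"
    using u z0 by (simp add: fls_subdegree_fls_to_fps)
  ultimately show thesis by (rule that)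
qed

text \<open>Here x is the local parameter and y an n-th root of - (c + X^n) / b. In u^n - a^n = -
  X^n / b the cofactor of u - a is a unit, which gives the order \<open>n\<close>; differentiating
  the equation gives the order \<open>n - 1\<close>.\<close>

lemma branch_place:
  assumes a: "b * a ^ n + c = 0"
  obtains u where "fermat_place n b c fls_X (fps_to_fls u)" "u $ 0 = a"
    "fps_to_fls u \<noteq> fls_const a" "fls_subdegree (fps_to_fls u - fls_const a) = int n"
    "fls_subdegree (fls_deriv (fps_to_fls u)) = int (n - 1)"
proof -
  have a0: "a \<noteq> 0" using a c_nz n_pos by (auto simp: zero_power)
  let ?s = "- (fps_const (inverse b) * (fps_const c + fps_X ^ n))"
  have "?s $ 0 = - (inverse b * c)" using n_pos by (simp add: fps_power_zeroth)
  also have "\<dots> = a ^ n" using a b_nz by (simp add: field_simps add_eq_0_iff2)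
  finally have "a ^ n = ?s $ 0" by simp
  then obtain u where u: "u ^ n = ?s" "u $ 0 = a" using fps_root_exists[OF n_pos _ a0] by metis
  have bu: "fps_const b * u ^ n = - (fps_const c + fps_X ^ n)"
  proof -
    have "fps_const b * u ^ n = - (fps_const (b * inverse b) * (fps_const c + fps_X ^ n))"
      unfolding u by (simp only: mult_minus_right mult.assoc [symmetric] fps_const_mult)
    then show ?thesis using b_nz by simp
  qed
  have "b * a ^ n = - c" using a by (simp add: add_eq_0_iff2)
  then have "fps_const b * fps_const a ^ n = - fps_const c"
    by (simp only: fps_const_mult fps_const_power fps_const_neg)
  then have "fps_const b * (u ^ n - fps_const a ^ n) = - (fps_X ^ n)"
    by (simp only: right_diff_distrib bu) simp
  then have fac: "fps_const b * ((u - fps_const a) * (\<Sum>i<n. fps_const a ^ (n - Suc i) * u ^ i)) = - (fps_X ^ n)"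
    by (simp only: power_diff_sumr2)
  define S where "S = (\<Sum>i<n. fps_const a ^ (n - Suc i) * u ^ i)"
  have "S $ 0 = (\<Sum>i<n. a ^ (n - Suc i) * a ^ i)"
    by (simp add: S_def fps_sum_nth fps_power_zeroth u(2))
  also have "\<dots> = (\<Sum>i<n. a ^ (n - 1))"
    by (intro sum.cong refl) (simp add: power_add [symmetric])
  finally have "S $ 0 \<noteq> 0" using a0 n_pos by simp
  then have S: "subdegree S = 0" "S \<noteq> 0" by auto
  note fac = fac[folded S_def]
  have ne: "u - fps_const a \<noteq> 0"
  proof
    assume "u - fps_const a = 0"
    then have "(fps_X :: 'a fps) ^ n = 0" using fac by simp
    then show False by simp
  qed
  have "subdegree (fps_const b * ((u - fps_const a) * S)) = subdegree (u - fps_const a)"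
    using ne S b_nz by simp
  then have sub: "subdegree (u - fps_const a) = n" unfolding fac by simp
  have fls: "fps_to_fls u - fls_const a = fps_to_fls (u - fps_const a)" by simp
  have eq: "fls_X ^ n + fls_const b * fps_to_fls u ^ n + fls_const c = 0"
  proof -
    have "fls_const b * fps_to_fls u ^ n = fps_to_fls (fps_const b * u ^ n)"
      by (simp add: fls_times_fps_to_fls fps_to_fls_power)
    then show ?thesis unfolding bu by (simp add: fps_to_fls_power)
  qed
  have "fls_deriv (fls_X ^ n + fls_const b * fps_to_fls u ^ n + fls_const c) = 0" by (simp only: eq) simp
  then have "of_nat n * (fls_X ^ (n - 1) + fls_const b * (fps_to_fls u ^ (n - 1) * fls_deriv (fps_to_fls u))) = 0"
    by (simp add: fls_deriv_power algebra_simps del: fls_deriv_fps_to_fls)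
  moreover have "(of_nat n :: 'a fls) \<noteq> 0" using n_pos by (simp add: fls_of_nat)
  ultimately have d: "fls_const b * (fps_to_fls u ^ (n - 1) * fls_deriv (fps_to_fls u)) = - (fls_X ^ (n - 1))"
    by (simp add: add_eq_0_iff)
  have d0: "fls_deriv (fps_to_fls u) \<noteq> 0"
  proof
    assume "fls_deriv (fps_to_fls u) = 0"
    then have "(fls_X :: 'a fls) ^ (n - 1) = 0" using d by simp
    then show False by simp
  qed
  have u0: "fps_to_fls u \<noteq> 0" "fls_subdegree (fps_to_fls u) = 0"
    using u(2) a0 by (auto simp: fls_subdegree_fls_to_fps)
  have "fls_subdegree (fls_const b * (fps_to_fls u ^ (n - 1) * fls_deriv (fps_to_fls u)))
    = fls_subdegree (fls_deriv (fps_to_fls u))"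
    using u0 d0 b_nz by (simp add: fls_subdegree_pow)
  then have "fls_subdegree (fls_deriv (fps_to_fls u)) = int (n - 1)" unfolding d by simp
  moreover have "fermat_place n b c fls_X (fps_to_fls u)"
    using eq d0 by unfold_locales auto
  moreover have "fps_to_fls u \<noteq> fls_const a"
  proof
    assume "fps_to_fls u = fls_const a"
    then have "fps_to_fls (u - fps_const a) = 0" by simp
    then show False using ne by (simp only: fps_to_fls_eq_0_iff)
  qed
  moreover have "fls_subdegree (fps_to_fls u - fls_const a) = int n"
    unfolding fls fls_subdegree_fls_to_fps sub ..
  ultimately show thesis using u(2) that by blast
qed

text \<open>With y = 1 / X and x = u / X the equation becomes u^n = - (b + c X^n), which has a root
  with nonzero constant term.\<close>

lemma infinite_place:
  obtains \<xi> where "fermat_place n b c \<xi> fls_X_inv" "fls_subdegree \<xi> = - 1"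
proof -
  let ?s = "- (fps_const b + fps_const c * fps_X ^ n)"
  have s0: "?s $ 0 = - b" using n_pos by (simp add: fps_power_zeroth)
  obtain z where z: "z ^ n = ?s $ 0" using nth_root_exists[OF n_pos] by blast
  have z0: "z \<noteq> 0" using z b_nz s0 n_pos by (metis neg_equal_0_iff_equal zero_power)
  obtain u where u: "u ^ n = ?s" "u $ 0 = z" using fps_root_exists[OF n_pos z z0] .
  have "fps_to_fls u ^ n = fps_to_fls ?s" by (simp only: u(1) [symmetric] fps_to_fls_power)
  then have un: "fps_to_fls u ^ n = - (fls_const b + fls_const c * fls_X ^ n)"
    by (simp add: fls_times_fps_to_fls fps_to_fls_power)
  have X1: "(fls_X_inv :: 'a fls) * fls_X = 1" by (simp add: fls_X_inv_times_conv_shift)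
  then have X: "(fls_X_inv :: 'a fls) ^ n * fls_X ^ n = 1" by (simp flip: power_mult_distrib)
  have "(fls_X_inv * fps_to_fls u) ^ n = - (fls_const b * fls_X_inv ^ n + fls_const c * (fls_X_inv ^ n * fls_X ^ n))"
    by (simp add: power_mult_distrib un algebra_simps)
  then have eq: "(fls_X_inv * fps_to_fls u) ^ n + fls_const b * fls_X_inv ^ n + fls_const c = 0"
    unfolding X by simp
  have u0: "fps_to_fls u \<noteq> 0" "fls_subdegree (fps_to_fls u) = 0"
    using u(2) z0 by (auto simp: fls_subdegree_fls_to_fps)
  have "fermat_place n b c (fls_X_inv * fps_to_fls u) fls_X_inv"
    using eq u0 by unfold_locales auto
  moreover have "fls_subdegree (fls_X_inv * fps_to_fls u) = - 1" using u0 by simp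
  ultimately show thesis by (rule that)
qed

text \<open>
  At a branch point the terms of \<open>\<Sum>k<n. R\<^sub>k(y) x\<^sup>k\<close> have orders in different residue classes
  modulo \<open>n\<close>, hence do not cancel.
\<close>

lemma branch_place_nonzero:
  fixes u :: "'a fps" and a z :: 'a and R :: "'a poly poly"
  assumes u: "u $ 0 = a" "fps_to_fls u \<noteq> fls_const a"
    "fls_subdegree (fps_to_fls u - fls_const a) = int n"
    and R: "\<forall>i\<ge>n. coeff R i = 0" "R \<noteq> 0" and z: "z \<noteq> 0"
  shows "eval2 fls_const (fls_const z * fls_X) (fps_to_fls u) R \<noteq> 0"
proof -
  define f where "f i = eval1 fls_const (fps_to_fls u) (coeff R i) * (fls_const z * fls_X) ^ i" for i
  define v where "v i = n * Polynomial.order a (coeff R i) + i" for i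
  have f: "f i \<noteq> 0" "fls_subdegree (f i) = int (v i)" if "coeff R i \<noteq> 0" for i
    using eval1_order[OF that u(2,1)] z u(3)
    by (simp_all add: f_def v_def fls_subdegree_pow)
  let ?S = "{i. i < n \<and> coeff R i \<noteq> 0}"
  have "?S \<noteq> {}"
  proof -
    have "coeff R (degree R) \<noteq> 0" using R(2) by simp
    moreover from this have "degree R < n" using R(1) by (meson not_le)
    ultimately show ?thesis by blast
  qed
  then obtain k where k: "k \<in> ?S" "\<And>i. i \<in> ?S \<Longrightarrow> v k \<le> v i"
    using ex_has_least_nat[of "\<lambda>i. i \<in> ?S" _ v] by blast
  have other: "f i $$ int (v k) = 0" if "i < n" "i \<noteq> k" for i
  proof (cases "coeff R i = 0")
    case False
    then have le: "v k \<le> v i" using k(2) that by blast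
    have "v i mod n = i" "v k mod n = k" using that k(1) by (auto simp: v_def)
    then have "v i \<noteq> v k" using that by auto
    then show ?thesis using le f(2)[OF False] by simp
  qed (simp add: f_def)
  have "eval2 fls_const (fls_const z * fls_X) (fps_to_fls u) R = (\<Sum>i<n. f i)"
    using R(1) by (simp add: fls_map.eval2_low f_def)
  then have "eval2 fls_const (fls_const z * fls_X) (fps_to_fls u) R $$ int (v k) = (\<Sum>i<n. f i $$ int (v k))"
    by (simp add: fls_nth_sum)
  also have "\<dots> = f k $$ int (v k)"
    using k(1) other by (subst sum.remove[of _ k]) auto
  also have "\<dots> \<noteq> 0" using f k(1) by (metis (mono_tags, lifting) mem_Collect_eq nth_fls_subdegree_nonzero)
  finally show ?thesis by auto
qed

text \<open>The norm from the function field to the rational functions in y. With \<open>R\<close>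
  the remainder of \<open>A\<close>, the product \<open>N\<close> of the R(\<zeta>^j x, y) is
  invariant under x -> \<zeta> x, so it involves only powers of x^n, which the equation expresses by
  y. \<open>U\<close> is the product without the factor j = 0. At a branch place no factor vanishes,
  hence \<open>d\<close> is nonzero.\<close>

lemma norm_exists:
  assumes "\<not> vanishes A"
  shows "\<exists>U d. d \<noteq> 0 \<and> (\<forall>x y. on_curve x y \<longrightarrow> ev U x y * ev A x y = poly d y)"
proof -
  obtain \<zeta> :: 'a where "prime_root n \<zeta>" using prime_root_exists[OF n_prime] .
  then interpret prime_root n \<zeta> .
  obtain Q R where A: "A = curve_poly n b c * Q + R" and R: "\<forall>i\<ge>n. coeff R i = 0"
    using reduce_mod_curve_poly[OF n_pos] .
  have AR: "ev A x y = ev R x y" if "on_curve x y" for x y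
    using that by (simp add: A on_curve_def)
  have R0: "R \<noteq> 0" using assms AR by (auto simp: vanishes_def)
  define rot where "rot j = pcompose R [:0, [:\<zeta> ^ j:]:]" for j
  define N where "N = (\<Prod>j<n. rot j)"
  define d where "d = (\<Sum>m\<le>degree N. coeff N (n * m) * (- (monom b n + [:c:])) ^ m)"
  have one: "[:1:] = (1 :: 'a poly)" by (simp add: one_pCons)
  have rot_0: "rot 0 = R" unfolding rot_def power_0 one by simp
  have N_inv: "pcompose N [:0, [:\<zeta>:]:] = N"
  proof -
    have rot_Suc: "pcompose (rot j) [:0, [:\<zeta>:]:] = rot (Suc j)" for j
      unfolding rot_def by (subst pcompose_assoc [symmetric]) (simp add: pcompose_pCons mult.commute)
    have "rot n = rot 0" unfolding rot_def by simp
    moreover have "(\<Prod>j<n. rot (Suc j)) * rot 0 = (\<Prod>j<n. rot j) * rot n"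
      using prod.lessThan_Suc[of rot n] prod.lessThan_Suc_shift[of rot n]
      by (simp add: mult.commute)
    moreover have "rot 0 \<noteq> 0" using R0 by (simp add: rot_0)
    ultimately have "(\<Prod>j<n. rot (Suc j)) = (\<Prod>j<n. rot j)" by simp
    then show ?thesis by (simp add: N_def pcompose_prod rot_Suc)
  qed
  have coeff_N: "coeff N k = 0" if "\<not> n dvd k" for k
  proof -
    have "[:\<zeta>:] ^ k * coeff N k = coeff N k"
      using N_inv coeff_pcompose_linear[of N "[:\<zeta>:]" k] by simp
    then have "([:\<zeta> ^ k:] - 1) * coeff N k = 0"
      by (simp add: poly_const_pow left_diff_distrib)
    moreover have "[:\<zeta> ^ k:] - 1 \<noteq> 0"
      using zeta_power_neq_1[OF that] by (simp add: one_pCons)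
    ultimately show ?thesis by simp
  qed
  have N_sum: "N = (\<Sum>m\<le>degree N. monom (coeff N (n * m)) (n * m))"
  proof (rule poly_eqI)
    fix k
    show "coeff N k = coeff (\<Sum>m\<le>degree N. monom (coeff N (n * m)) (n * m)) k"
    proof (cases "n dvd k")
      case False
      then have "coeff (\<Sum>m\<le>degree N. monom (coeff N (n * m)) (n * m)) k = 0"
        by (auto simp: coeff_sum coeff_monom intro!: sum.neutral)
      then show ?thesis using coeff_N[OF False] by simp
    next
      case True
      then obtain m0 where k: "k = n * m0" by blast
      have "coeff (\<Sum>m\<le>degree N. monom (coeff N (n * m)) (n * m)) k
        = (\<Sum>m\<le>degree N. if m = m0 then coeff N k else 0)"
        unfolding coeff_sum coeff_monom using n_pos by (intro sum.cong refl) (simp add: k)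
      also have "\<dots> = coeff N k"
      proof (cases "m0 \<le> degree N")
        case False
        then have "degree N < k" using n_pos unfolding k
          by (metis One_nat_def Suc_leI less_le_trans mult_le_mono1 nat_mult_1 not_le)
        then show ?thesis by (simp add: coeff_eq_0)
      qed simp
      finally show ?thesis by simp
    qed
  qed
  \<comment> \<open>Needed for two ring maps: at points to get the equation for \<open>d\<close>,
    and at a place to see that \<open>d\<close> is nonzero.\<close>
  have eval_N: "eval2 h \<xi> \<eta> N = eval1 h \<eta> d"
    if h: "ring_map h" and eq: "\<xi> ^ n = - (h b * \<eta> ^ n + h c)" for h :: "'a \<Rightarrow> 'b::comm_ring_1" and \<xi> \<eta>
  proof -
    interpret ring_map h by fact
    have sum1: "eval1 h \<eta> (\<Sum>i\<in>I. f i) = (\<Sum>i\<in>I. eval1 h \<eta> (f i))" for f and I :: "nat set"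
      by (induction I rule: infinite_finite_induct) simp_all
    have "eval2 h \<xi> \<eta> N = (\<Sum>m\<le>degree N. eval1 h \<eta> (coeff N (n * m)) * (\<xi> ^ n) ^ m)"
      by (subst N_sum) (simp add: eval2_sum power_mult)
    also have "eval1 h \<eta> (- (monom b n + [:c:])) = - (h b * \<eta> ^ n + h c)"
      by (simp add: map_minus map_0)
    then have "(\<Sum>m\<le>degree N. eval1 h \<eta> (coeff N (n * m)) * (\<xi> ^ n) ^ m) = eval1 h \<eta> d"
      unfolding eq d_def by (simp only: sum1 eval1_mult eval1_power)
    finally show ?thesis .
  qed
  have eval_N_prod: "eval2 h \<xi> \<eta> N = (\<Prod>j<n. eval2 h (h (\<zeta> ^ j) * \<xi>) \<eta> R)"
    if h: "ring_map h" for h :: "'a \<Rightarrow> 'b::comm_ring_1" and \<xi> \<eta>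
  proof -
    interpret ring_map h by fact
    show ?thesis by (simp add: N_def rot_def eval2_prod eval2_pcompose_scale)
  qed
  have "d \<noteq> 0"
  proof
    assume d: "d = 0"
    obtain a where "a ^ n = - c / b" using nth_root_exists[OF n_pos] by blast
    then have a: "b * a ^ n + c = 0" using b_nz by simp
    obtain u where u: "fermat_place n b c fls_X (fps_to_fls u)" "u $ 0 = a"
      "fps_to_fls u \<noteq> fls_const a" "fls_subdegree (fps_to_fls u - fls_const a) = int n"
      using branch_place[OF a] .
    interpret pl: fermat_place n b c fls_X "fps_to_fls u" by (rule u)
    have "fls_X ^ n = - (fls_const b * fps_to_fls u ^ n + fls_const c)"
      using pl.place_eq by (simp add: add_eq_0_iff2 add.assoc)
    then have "eval2 fls_const fls_X (fps_to_fls u) N = 0"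
      using eval_N[of fls_const fls_X "fps_to_fls u"] d by simp
    then obtain j where "eval2 fls_const (fls_const (\<zeta> ^ j) * fls_X) (fps_to_fls u) R = 0"
      unfolding eval_N_prod[OF ring_map_fls_const] by auto
    then show False
      using branch_place_nonzero[OF u(2-4) R R0, of "\<zeta> ^ j"] zeta_nz by simp
  qed
  moreover have "ev (\<Prod>j\<in>{1..<n}. rot j) x y * ev A x y = poly d y" if "on_curve x y" for x y
  proof -
    have "{..<n} = insert 0 {1..<n}" using n_pos by auto
    then have "N = rot 0 * (\<Prod>j\<in>{1..<n}. rot j)" by (simp add: N_def)
    moreover have "ev N x y = poly d y"
      using eval_N[of "\<lambda>x. x" x y] that by (simp add: on_curve_def add_eq_0_iff2 add.assoc)
    ultimately show ?thesis using AR[OF that] rot_0 by (simp add: mult.commute)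
  qed
  ultimately show ?thesis by blast
qed

lemma finite_zeros:
  assumes "\<not> vanishes A"
  shows "finite {y. \<exists>x. on_curve x y \<and> ev A x y = 0}"
proof -
  obtain U d where d: "d \<noteq> 0" "\<forall>x y. on_curve x y \<longrightarrow> ev U x y * ev A x y = poly d y"
    using norm_exists[OF assms] by blast
  have "{y. \<exists>x. on_curve x y \<and> ev A x y = 0} \<subseteq> {y. poly d y = 0}" using d(2) by fastforce
  then show ?thesis using poly_roots_finite[OF d(1)] finite_subset by blast
qed

end

section \<open>Maps between Fermat curves\<close>

definition finitely_many_points :: "('a::field triple \<Rightarrow> bool) \<Rightarrow> bool" where
  "finitely_many_points Q \<longleftrightarrow> (\<exists>S. finite S \<and>
    (\<forall>w0 w1 w2. Q (w0, w1, w2) \<longrightarrow>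
      (\<exists>t s0 s1 s2. t \<noteq> 0 \<and> (s0, s1, s2) \<in> S \<and> w0 = t * s0 \<and> w1 = t * s1 \<and> w2 = t * s2)))"

lemma finitely_many_pointsI:
  assumes "finite S" and "\<And>w0 w1 w2. Q (w0, w1, w2) \<Longrightarrow>
    \<exists>t s0 s1 s2. t \<noteq> 0 \<and> (s0, s1, s2) \<in> S \<and> w0 = t * s0 \<and> w1 = t * s1 \<and> w2 = t * s2"
  shows "finitely_many_points Q"
  unfolding finitely_many_points_def by (intro exI[of _ S] conjI allI impI assms)

lemma finitely_many_pointsE:
  assumes "finitely_many_points Q"
  obtains S where "finite S" "\<forall>w0 w1 w2. Q (w0, w1, w2) \<longrightarrow>
    (\<exists>t s0 s1 s2. t \<noteq> 0 \<and> (s0, s1, s2) \<in> S \<and> w0 = t * s0 \<and> w1 = t * s1 \<and> w2 = t * s2)"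
  using assms unfolding finitely_many_points_def by blast

lemma finitely_many_points_swap:
  assumes "finitely_many_points Q"
  shows "finitely_many_points (\<lambda>(x, y, z). Q (y, x, z))"
proof -
  obtain S where S: "finite S" "\<forall>w0 w1 w2. Q (w0, w1, w2) \<longrightarrow>
    (\<exists>t s0 s1 s2. t \<noteq> 0 \<and> (s0, s1, s2) \<in> S \<and> w0 = t * s0 \<and> w1 = t * s1 \<and> w2 = t * s2)"
    using assms by (rule finitely_many_pointsE)
  show ?thesis
  proof (rule finitely_many_pointsI)
    show "finite ((\<lambda>(x, y, z). (y, x, z)) ` S)" using S(1) by simp
    fix w0 w1 w2 assume "case (w0, w1, w2) of (x, y, z) \<Rightarrow> Q (y, x, z)"
    then obtain t s0 s1 s2 where st: "t \<noteq> 0" "(s1, s0, s2) \<in> S" "w1 = t * s1" "w0 = t * s0" "w2 = t * s2"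
      using S(2)[rule_format, of w1 w0 w2] by auto
    have "(s0, s1, s2) \<in> (\<lambda>(x, y, z). (y, x, z)) ` S" using st(2) by (rule rev_image_eqI) simp
    then show "\<exists>t s0 s1 s2. t \<noteq> 0 \<and> (s0, s1, s2) \<in> (\<lambda>(x, y, z). (y, x, z)) ` S
        \<and> w0 = t * s0 \<and> w1 = t * s1 \<and> w2 = t * s2"
      using st by metis
  qed
qed

lemma finitely_many_points_rotate:
  assumes "finitely_many_points Q"
  shows "finitely_many_points (\<lambda>(x, y, z). Q (z, x, y))"
proof -
  obtain S where S: "finite S" "\<forall>w0 w1 w2. Q (w0, w1, w2) \<longrightarrow>
    (\<exists>t s0 s1 s2. t \<noteq> 0 \<and> (s0, s1, s2) \<in> S \<and> w0 = t * s0 \<and> w1 = t * s1 \<and> w2 = t * s2)"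
    using assms by (rule finitely_many_pointsE)
  show ?thesis
  proof (rule finitely_many_pointsI)
    show "finite ((\<lambda>(z, x, y). (x, y, z)) ` S)" using S(1) by simp
    fix w0 w1 w2 assume "case (w0, w1, w2) of (x, y, z) \<Rightarrow> Q (z, x, y)"
    then obtain t s0 s1 s2 where st: "t \<noteq> 0" "(s2, s0, s1) \<in> S" "w2 = t * s2" "w0 = t * s0" "w1 = t * s1"
      using S(2)[rule_format, of w2 w0 w1] by auto
    have "(s0, s1, s2) \<in> (\<lambda>(z, x, y). (x, y, z)) ` S" using st(2) by (rule rev_image_eqI) simp
    then show "\<exists>t s0 s1 s2. t \<noteq> 0 \<and> (s0, s1, s2) \<in> (\<lambda>(z, x, y). (x, y, z)) ` S
        \<and> w0 = t * s0 \<and> w1 = t * s1 \<and> w2 = t * s2"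
      using st by metis
  qed
qed

text \<open>Solve the line for \<open>w0\<close> and restrict the equation to it. If the resulting
  polynomial \<open>q\<close> were 0, its derivative at 0 would force r = 0 or s = 0, and then
  \<open>a1\<close> or \<open>a2\<close> would be 0.\<close>

lemma line_inter_fermat_aux:
  fixes a0 a1 a2 l0 l1 l2 :: "'a::field_char_0"
  assumes n: "n > 1" and nz: "a0 \<noteq> 0" "a1 \<noteq> 0" "a2 \<noteq> 0" and l0: "l0 \<noteq> 0"
  shows "finitely_many_points (\<lambda>(w0, w1, w2). l0 * w0 + l1 * w1 + l2 * w2 = 0
    \<and> a0 * w0 ^ n + a1 * w1 ^ n + a2 * w2 ^ n = 0 \<and> (w0, w1, w2) \<noteq> (0, 0, 0))"
proof -
  define r s where "r = - l1 / l0" and "s = - l2 / l0"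
  define q where "q = smult a0 ([:s, r:] ^ n) + monom a1 n + [:a2:]"
  have q_ev: "poly q u = a0 * (s + u * r) ^ n + a1 * u ^ n + a2" for u
    by (simp add: q_def poly_monom)
  have "q \<noteq> 0"
  proof
    assume q: "q = 0"
    have "poly (pderiv q) u = of_nat n * (a0 * (s + u * r) ^ (n - 1) * r + a1 * u ^ (n - 1))" for u
      by (simp add: q_def pderiv_add pderiv_smult pderiv_power pderiv_monom pderiv_pCons poly_monom algebra_simps)
    then have d: "of_nat n * (a0 * (s + u * r) ^ (n - 1) * r + a1 * u ^ (n - 1)) = 0" for u
      unfolding q by simp
    then have d: "a0 * (s + u * r) ^ (n - 1) * r + a1 * u ^ (n - 1) = 0" for u
      using n by (metis gr_implies_not0 mult_eq_0_iff of_nat_eq_0_iff)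
    have "a0 * s ^ (n - 1) * r = 0" using d[of 0] n by (simp add: zero_power)
    then have "r = 0 \<or> s = 0" using nz by auto
    then show False
    proof
      assume "r = 0"
      then show False using d[of 1] nz by simp
    next
      assume "s = 0"
      then show False using q_ev[of 0] q nz n by (simp add: zero_power)
    qed
  qed
  then have fin: "finite {u. poly q u = 0}" by (rule poly_roots_finite)
  \<comment> \<open>The point of the line with third coordinate 0, followed by the points normalised
    to third coordinate 1.\<close>
  let ?S = "insert (r, 1, 0) ((\<lambda>u. (r * u + s, u, 1)) ` {u. poly q u = 0})"
  show ?thesis
  proof (rule finitely_many_pointsI)
    show "finite ?S" using fin by simp
    fix w0 w1 w2 assume "case (w0, w1, w2) of (w0, w1, w2) \<Rightarrow> l0 * w0 + l1 * w1 + l2 * w2 = 0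
      \<and> a0 * w0 ^ n + a1 * w1 ^ n + a2 * w2 ^ n = 0 \<and> (w0, w1, w2) \<noteq> (0, 0, 0)"
    then have l: "l0 * w0 + l1 * w1 + l2 * w2 = 0" and eq: "a0 * w0 ^ n + a1 * w1 ^ n + a2 * w2 ^ n = 0"
      and nz': "(w0, w1, w2) \<noteq> (0, 0, 0)" by auto
    have "l0 * w0 = - (l1 * w1 + l2 * w2)" using l by (simp add: add_eq_0_iff2 add.assoc)
    then have "w0 = - (l1 * w1 + l2 * w2) / l0" using l0 by (simp add: nonzero_eq_divide_eq mult.commute)
    then have "w0 = r * w1 + s * w2" by (simp add: r_def s_def add_divide_distrib diff_divide_distrib)
    note w = this eq nz'
    show "\<exists>t s0 s1 s2. t \<noteq> 0 \<and> (s0, s1, s2) \<in> ?S \<and> w0 = t * s0 \<and> w1 = t * s1 \<and> w2 = t * s2"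
  proof (cases "w2 = 0")
    case True
    then have "w1 \<noteq> 0" "w0 = w1 * r" "w1 = w1 * 1" "w2 = w1 * 0" using w by auto
    moreover have "(r, 1, 0) \<in> ?S" by simp
    ultimately show ?thesis by blast
  next
    case False
    have "w2 ^ n * poly q (w1 / w2) = a0 * (w2 * (s + w1 / w2 * r)) ^ n + a1 * (w2 * (w1 / w2)) ^ n + a2 * w2 ^ n"
      unfolding q_ev by (simp only: power_mult_distrib) (simp add: algebra_simps)
    also have "w2 * (s + w1 / w2 * r) = w0" using False w(1) by (simp add: field_simps)
    also have "w2 * (w1 / w2) = w1" using False by simp
    finally have "poly q (w1 / w2) = 0" using w(2) False by simp
    then have "(r * (w1 / w2) + s, w1 / w2, 1) \<in> ?S" by blast
    moreover have "w0 = w2 * (r * (w1 / w2) + s)" "w1 = w2 * (w1 / w2)" "w2 = w2 * 1"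
      using False w(1) by (simp_all add: field_simps)
    ultimately show ?thesis using False by blast
  qed
  qed
qed

lemma line_inter_fermat_finite:
  fixes a0 a1 a2 l0 l1 l2 :: "'a::field_char_0"
  assumes n: "n > 1" and nz: "a0 \<noteq> 0" "a1 \<noteq> 0" "a2 \<noteq> 0" and l: "(l0, l1, l2) \<noteq> (0, 0, 0)"
  shows "finitely_many_points (\<lambda>(w0, w1, w2). l0 * w0 + l1 * w1 + l2 * w2 = 0
    \<and> a0 * w0 ^ n + a1 * w1 ^ n + a2 * w2 ^ n = 0 \<and> (w0, w1, w2) \<noteq> (0, 0, 0))"
proof -
  consider "l0 \<noteq> 0" | "l1 \<noteq> 0" | "l2 \<noteq> 0" using l by auto
  then show ?thesis
  proof cases
    case 1
    then show ?thesis using line_inter_fermat_aux[OF n nz] by blast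
  next
    case 2
    show ?thesis
      using finitely_many_points_swap[OF line_inter_fermat_aux[OF n nz(2,1,3) 2, of l0 l2]]
      by (rule back_subst[where P = finitely_many_points]) (auto simp: fun_eq_iff add_ac)
  next
    case 3
    show ?thesis
      using finitely_many_points_rotate[OF line_inter_fermat_aux[OF n nz(3,1,2) 3, of l0 l1]]
      by (rule back_subst[where P = finitely_many_points]) (auto simp: fun_eq_iff add_ac)
  qed
qed

lemma prod_roots_dvd:
  fixes q :: "'a::field poly"
  assumes "distinct ys" "\<And>y. y \<in> set ys \<Longrightarrow> poly q y = 0"
  shows "prod_list (map (\<lambda>y. [:- y, 1:]) ys) dvd q"
  using assms
proof (induction ys arbitrary: q)
  case (Cons y ys)
  have "poly q y = 0" using Cons.prems by simp
  then obtain r where q: "q = [:- y, 1:] * r" unfolding poly_eq_0_iff_dvd by (rule dvdE)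
  have "poly r z = 0" if "z \<in> set ys" for z
    using Cons.prems that by (auto simp: q)
  then have "prod_list (map (\<lambda>y. [:- y, 1:]) ys) dvd r" using Cons by auto
  then show ?case unfolding q list.map prod_list.Cons by (rule mult_dvd_mono[OF dvd_refl])
qed simp

abbreviation line_value :: "'a::comm_ring_1 \<Rightarrow> 'a \<Rightarrow> 'a \<Rightarrow> 'a triple \<Rightarrow> 'a" where
  "line_value \<equiv> linear_form (\<lambda>x. x)"

abbreviation line_poly :: "'a::comm_ring_1 poly poly \<Rightarrow> 'a poly poly \<Rightarrow> 'a poly poly \<Rightarrow> 'a triple \<Rightarrow> 'a poly poly" where
  "line_poly \<equiv> linear_form (\<lambda>a. [:[:a:]:])"

section \<open>Irreducibility of the curve\<close>

context affine_fermat begin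

lemma finite_nonvanishing:
  assumes "\<And>A. A \<in> \<A> \<Longrightarrow> \<not> vanishes A" "finite \<A>"
  shows "finite {y. \<exists>x. on_curve x y \<and> (\<exists>A\<in>\<A>. ev A x y = 0)}"
proof -
  have "{y. \<exists>x. on_curve x y \<and> (\<exists>A\<in>\<A>. ev A x y = 0)} = (\<Union>A\<in>\<A>. {y. \<exists>x. on_curve x y \<and> ev A x y = 0})"
    by auto
  then show ?thesis using assms finite_zeros by auto
qed

lemma exists_good:
  assumes "finite B"
  shows "\<exists>x y. on_curve x y \<and> y \<notin> B \<and> b * y ^ n + c \<noteq> 0"
proof -
  have "infinite (UNIV :: 'a set)" by (rule infinite_UNIV_char_0)
  then obtain y where "y \<notin> B \<union> {y. b * y ^ n + c = 0}"
    using assms finite_branch by (metis finite_Un ex_new_if_finite)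
  then show ?thesis using on_curve_exists[of y] by auto
qed

text \<open>Irreducibility of the curve: otherwise \<open>A\<close> and \<open>B\<close> would have
  zeros over finitely many y only, and any other y would give a point where the product is not
  0.\<close>

lemma vanishes_mult:
  assumes "vanishes (A * B)"
  shows "vanishes A \<or> vanishes B"
proof (rule ccontr)
  assume "\<not> ?thesis"
  then have "finite {y. \<exists>x. on_curve x y \<and> (\<exists>A'\<in>{A, B}. ev A' x y = 0)}"
    by (intro finite_nonvanishing) auto
  from exists_good[OF this] obtain x y where "on_curve x y" "ev A x y \<noteq> 0" "ev B x y \<noteq> 0"
    by auto
  then show False using assms by (auto simp: vanishes_def)
qed

lemma vanishes_prod_list: "vanishes (prod_list As) \<Longrightarrow> \<exists>A\<in>set As. vanishes A"
proof (induction As)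
  case Nil
  then show ?case using exists_good[of "{}"] by (auto simp: vanishes_def)
next
  case (Cons A As)
  then show ?case using vanishes_mult by auto
qed

lemma vanishes_const_y: "vanishes [:q:] \<Longrightarrow> q = 0"
proof (rule ccontr)
  assume v: "vanishes [:q:]" and "q \<noteq> 0"
  then have "finite {y. poly q y = 0}" using poly_roots_finite by blast
  from exists_good[OF this] v show False by (auto simp: vanishes_def)
qed

lemma vanishes_cofinite:
  assumes "finite B" "\<And>x y. on_curve x y \<Longrightarrow> y \<notin> B \<Longrightarrow> ev A x y = 0"
  shows "vanishes A"
proof (rule ccontr)
  assume "\<not> vanishes A"
  then have "finite (B \<union> {y. \<exists>x. on_curve x y \<and> ev A x y = 0})" using assms(1) finite_zeros by simp
  from exists_good[OF this] assms(2) show False by blast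
qed

end

text \<open>A rational map in homogeneous coordinates from the chart to the curve with coefficients
  \<open>a0\<close>, \<open>a1\<close>, \<open>a2\<close>. The triple may vanish at some points, so
  injectivity is asked only where it does not.\<close>

locale fermat_map = affine_fermat +
  fixes a0 a1 a2 :: 'a and P0 P1 P2 :: "'a poly poly"
  assumes a_nz: "a0 \<noteq> 0" "a1 \<noteq> 0" "a2 \<noteq> 0"
    and P_eq: "\<And>x y. on_curve x y \<Longrightarrow> a0 * ev P0 x y ^ n + a1 * ev P1 x y ^ n + a2 * ev P2 x y ^ n = 0"
    and P_nz: "\<not> (vanishes P0 \<and> vanishes P1 \<and> vanishes P2)"
    and P_inj: "\<And>x y x' y' t. on_curve x y \<Longrightarrow> on_curve x' y' \<Longrightarrow> t \<noteq> 0 \<Longrightarrow>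
      (ev P0 x y, ev P1 x y, ev P2 x y) \<noteq> (0, 0, 0) \<Longrightarrow>
      ev P0 x' y' = t * ev P0 x y \<Longrightarrow> ev P1 x' y' = t * ev P1 x y \<Longrightarrow> ev P2 x' y' = t * ev P2 x y \<Longrightarrow>
      x = x' \<and> y = y'"
begin

text \<open>A line meets the target curve in finitely many points. If it contained the image, two
  points with different y would have the same image, against \<open>P_inj\<close>.\<close>

lemma image_not_in_line:
  assumes l: "l \<noteq> (0, 0, 0)"
  shows "\<not> vanishes (line_poly P0 P1 P2 l)"
proof
  assume v: "vanishes (line_poly P0 P1 P2 l)"
  obtain l0 l1 l2 where l_eq: "l = (l0, l1, l2)" by (cases l)
  obtain A where A: "A \<in> {P0, P1, P2}" "\<not> vanishes A" using P_nz by blast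
  define Z where "Z = {y. \<exists>x. on_curve x y \<and> ev A x y = 0}"
  have Z: "finite Z" unfolding Z_def using A(2) by (rule finite_zeros)
  have n1: "n > 1" using n_ge by simp
  obtain S where "finite S" and S': "\<forall>w0 w1 w2. l0 * w0 + l1 * w1 + l2 * w2 = 0
      \<and> a0 * w0 ^ n + a1 * w1 ^ n + a2 * w2 ^ n = 0 \<and> (w0, w1, w2) \<noteq> (0, 0, 0) \<longrightarrow>
      (\<exists>t s0 s1 s2. t \<noteq> 0 \<and> (s0, s1, s2) \<in> S \<and> w0 = t * s0 \<and> w1 = t * s1 \<and> w2 = t * s2)"
    using line_inter_fermat_finite[OF n1 a_nz l[unfolded l_eq]]
    unfolding finitely_many_points_def prod.case by blast
  note S = S'[rule_format, OF conjI, OF _ conjI]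
  define pick where "pick y = (SOME x. on_curve x y)" for y
  have pick: "on_curve (pick y) y" for y
    unfolding pick_def using on_curve_exists by (rule someI_ex)
  have nz: "(ev P0 (pick y) y, ev P1 (pick y) y, ev P2 (pick y) y) \<noteq> (0, 0, 0)" if "y \<notin> Z" for y
  proof -
    have "ev A (pick y) y \<noteq> 0" using that pick unfolding Z_def by blast
    then show ?thesis using A(1) by auto
  qed
  have "\<exists>s. s \<in> S \<and> (\<exists>t. t \<noteq> 0 \<and> ev P0 (pick y) y = t * fst s \<and> ev P1 (pick y) y = t * fst (snd s)
      \<and> ev P2 (pick y) y = t * snd (snd s))" if "y \<notin> Z" for y
  proof -
    have "ev (line_poly P0 P1 P2 l) (pick y) y = 0" using v pick by (simp add: vanishes_def)
    then have "l0 * ev P0 (pick y) y + l1 * ev P1 (pick y) y + l2 * ev P2 (pick y) y = 0"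
      by (simp add: id_map.eval2_linear_form l_eq linear_form_def)
    from S[OF this P_eq[OF pick] nz[OF that]] show ?thesis by fastforce
  qed
  then obtain s where s: "\<And>y. y \<notin> Z \<Longrightarrow> s y \<in> S \<and> (\<exists>t. t \<noteq> 0 \<and> ev P0 (pick y) y = t * fst (s y)
      \<and> ev P1 (pick y) y = t * fst (snd (s y)) \<and> ev P2 (pick y) y = t * snd (snd (s y)))" by metis
  have "infinite (- Z)" using Z infinite_UNIV_char_0[where ?'a = 'a]
    by (simp add: Compl_eq_Diff_UNIV Diff_infinite_finite)
  moreover have "finite (s ` (- Z))" using s \<open>finite S\<close> by (meson ComplD finite_subset image_subsetI)
  ultimately have "\<not> inj_on s (- Z)" using finite_imageD by blast
  then obtain y y' where yy: "y \<notin> Z" "y' \<notin> Z" "s y = s y'" "y \<noteq> y'" by (auto simp: inj_on_def)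
  obtain t where t: "t \<noteq> 0" "ev P0 (pick y) y = t * fst (s y)"
      "ev P1 (pick y) y = t * fst (snd (s y))" "ev P2 (pick y) y = t * snd (snd (s y))"
    using s[OF yy(1)] by blast
  obtain t' where t': "t' \<noteq> 0" "ev P0 (pick y') y' = t' * fst (s y)"
      "ev P1 (pick y') y' = t' * fst (snd (s y))" "ev P2 (pick y') y' = t' * snd (snd (s y))"
    using s[OF yy(2)] yy(3) by auto
  have "pick y = pick y' \<and> y = y'"
    by (rule P_inj[where t = "t' / t", OF pick pick _ nz[OF yy(1)]]) (use t t' in auto)
  then show False using yy by simp
qed

end

section \<open>Pullback of differentials\<close>

text \<open>With a first coordinate that depends on \<open>y\<close> alone, the denominator of the
  pullback can be compared with each coefficient separately, root by root.\<close>

locale fermat_map_monic = fermat_map n b c a0 a1 a2 "[:d:]" P1 P2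
  for n and b c a0 a1 a2 :: "'a::{alg_closed_field, field_char_0}" and d P1 P2 +
  assumes d_nz: "d \<noteq> 0"
begin

text \<open>On the curve this is x^(n-1) times P1 dP2/dy - P2 dP1/dy. Multiplied by the
  \<open>n - 3\<close> lines and divided by \<open>d ^ (n - 1)\<close>, it is the coefficient h of
  the pullback h dy / x^(n-1).\<close>

definition wronskian :: "'a poly poly" where
  "wronskian = P1 * tangent P2 - P2 * tangent P1"

lemma place_map_eq:
  assumes "fermat_place n b c \<xi> \<eta>"
  shows "fls_const a0 * eval1 fls_const \<eta> d ^ n + fls_const a1 * eval2 fls_const \<xi> \<eta> P1 ^ n
    + fls_const a2 * eval2 fls_const \<xi> \<eta> P2 ^ n = 0"
proof -
  interpret fermat_place n b c \<xi> \<eta> by fact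
  have "vanishes ([:[:a0:]:] * [:d:] ^ n + [:[:a1:]:] * P1 ^ n + [:[:a2:]:] * P2 ^ n)"
    using P_eq by (simp add: vanishes_def del: mult_pCons_left)
  from place_vanishes[OF this] show ?thesis by (simp del: mult_pCons_left)
qed

lemma place_wronskian:
  assumes "fermat_place n b c \<xi> \<eta>"
  defines "p1 \<equiv> eval2 fls_const \<xi> \<eta> P1" and "p2 \<equiv> eval2 fls_const \<xi> \<eta> P2"
  shows "fls_deriv \<eta> * eval2 fls_const \<xi> \<eta> wronskian
    = \<xi> ^ (n - 1) * (p1 * fls_deriv p2 - p2 * fls_deriv p1)"
proof -
  interpret fermat_place n b c \<xi> \<eta> by fact
  have "fls_deriv \<eta> * pull wronskian = p1 * (fls_deriv \<eta> * pull (tangent P2)) - p2 * (fls_deriv \<eta> * pull (tangent P1))"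
    by (simp add: wronskian_def p1_def p2_def algebra_simps)
  also have "\<dots> = \<xi> ^ (n - 1) * (p1 * fls_deriv p2 - p2 * fls_deriv p1)"
    unfolding place_tangent [symmetric] p1_def p2_def by (simp add: algebra_simps)
  finally show ?thesis .
qed

text \<open>By \<open>regular_pullback\<close>, R dy is a regular series times x^(n-1) d^(n-1),
  which bounds the order of all of \<open>R\<close>. The bound is the same at every rotated place,
  so it survives \<open>zeta_average\<close>, which leaves the single term of degree
  \<open>k\<close>.\<close>

lemma place_bound:
  assumes pl: "fermat_place n b c \<xi> \<eta>" and D: "eval1 fls_const \<eta> d \<noteq> 0" and len: "length ls = n - 3"
    and R: "\<forall>i\<ge>n. coeff R i = 0"
    and van: "vanishes (prod_list (map (line_poly [:d:] P1 P2) ls) * wronskian - R)"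
    and k: "k < n"
  shows "ord_ge (int (n - 1) * fls_subdegree (eval1 fls_const \<eta> d) + int (n - 1) * fls_subdegree \<xi>
      - fls_subdegree (fls_deriv \<eta>)) (eval1 fls_const \<eta> (coeff R k) * \<xi> ^ k)"
proof -
  define m where "m = int (n - 1) * fls_subdegree (eval1 fls_const \<eta> d)
    + int (n - 1) * fls_subdegree \<xi> - fls_subdegree (fls_deriv \<eta>)"
  interpret pl: fermat_place n b c \<xi> \<eta> by fact
  have one: "ord_ge m (eval2 fls_const (fls_const z * \<xi>) \<eta> R)" if z: "z ^ n = 1" for z
  proof -
    define \<xi>' where "\<xi>' = fls_const z * \<xi>"
    have z0: "z \<noteq> 0" using z n_pos by (metis zero_neq_one zero_power)
    have sub: "\<xi>' \<noteq> 0" "fls_subdegree \<xi>' = fls_subdegree \<xi>"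
      using z0 pl.xi_nz by (simp_all add: \<xi>'_def)
    have pl': "fermat_place n b c \<xi>' \<eta>" unfolding \<xi>'_def using z by (rule pl.place_rotate)
    interpret pl': fermat_place n b c \<xi>' \<eta> by fact
    define p0 p1 p2 where "p0 = eval1 fls_const \<eta> d" and "p1 = pl'.pull P1" and "p2 = pl'.pull P2"
    have p0: "p0 \<noteq> 0" using D by (simp add: p0_def)
    have n5: "n \<ge> 5" by (rule n_ge)
    obtain q where q: "ord_ge 0 q" "prod_list (map (linear_form fls_const p0 p1 p2) ls)
        * (p1 * fls_deriv p2 - p2 * fls_deriv p1) = q * p0 ^ (n - 1)"
      using regular_pullback[OF n5 len a_nz p0 place_map_eq[OF pl', folded p0_def p1_def p2_def]] .
    have "pl'.pull (prod_list (map (line_poly [:d:] P1 P2) ls) * wronskian) = pl'.pull R"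
      using pl'.place_vanishes[OF van] by simp
    then have "prod_list (map (linear_form fls_const p0 p1 p2) ls) * pl'.pull wronskian = pl'.pull R"
      by (simp add: fls_map.eval2_prod_linear_form p0_def p1_def p2_def)
    then have "fls_deriv \<eta> * pl'.pull R
        = prod_list (map (linear_form fls_const p0 p1 p2) ls) * (fls_deriv \<eta> * pl'.pull wronskian)"
      by (simp add: mult_ac)
    also have "\<dots> = \<xi>' ^ (n - 1) * (prod_list (map (linear_form fls_const p0 p1 p2) ls)
        * (p1 * fls_deriv p2 - p2 * fls_deriv p1))"
      unfolding place_wronskian[OF pl', folded p1_def p2_def] by (simp only: mult_ac)
    also have "\<dots> = q * (\<xi>' ^ (n - 1) * p0 ^ (n - 1))" unfolding q(2) by (simp only: mult_ac)
    finally have eq: "pl'.pull R * fls_deriv \<eta> = q * (\<xi>' ^ (n - 1) * p0 ^ (n - 1))"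
      by (simp only: mult.commute)
    have "ord_ge (0 + fls_subdegree (\<xi>' ^ (n - 1) * p0 ^ (n - 1))) (q * (\<xi>' ^ (n - 1) * p0 ^ (n - 1)))"
      using q(1) by (rule ord_ge_mult) (simp add: ord_ge_iff)
    moreover have "fls_subdegree (\<xi>' ^ (n - 1) * p0 ^ (n - 1)) = m + fls_subdegree (fls_deriv \<eta>)"
      using sub p0 by (simp add: m_def fls_subdegree_pow p0_def)
    ultimately have "ord_ge (m + fls_subdegree (fls_deriv \<eta>)) (pl'.pull R * fls_deriv \<eta>)"
      unfolding eq by simp
    with pl.eta_deriv_nz have "ord_ge m (pl'.pull R)" by (rule ord_ge_cancel)
    then show ?thesis by (simp add: \<xi>'_def)
  qed
  obtain \<zeta> :: 'a where "prime_root n \<zeta>" using prime_root_exists[OF n_prime] .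
  then interpret prime_root n \<zeta> .
  have cm: "ord_ge m (fls_const z * f)" if "ord_ge m f" for z :: 'a and f
    using ord_ge_mult[OF ord_ge_const that, of z] by simp
  have "ord_ge m (\<Sum>j<n. fls_const (\<zeta> ^ (j * (n - k))) * eval2 fls_const (fls_const (\<zeta> ^ j) * \<xi>) \<eta> R)"
    by (intro ord_ge_sum cm one) simp
  then have "ord_ge m (of_nat n * (eval1 fls_const \<eta> (coeff R k) * \<xi> ^ k))"
    unfolding fls_map.eval2_low[OF R] zeta_average[OF ring_map_fls_const k] .
  then have "ord_ge m (fls_const (inverse (of_nat n)) * (of_nat n * (eval1 fls_const \<eta> (coeff R k) * \<xi> ^ k)))"
    by (rule cm)
  moreover have "fls_const (inverse (of_nat n)) * (of_nat n :: 'a fls) = 1"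
    unfolding fls_of_nat fls_const_mult_const using n_pos by simp
  ultimately show ?thesis unfolding m_def by (simp only: mult.assoc [symmetric] mult_1_left)
qed

text \<open>
  The pullback of the regular differential with numerator \<open>\<Prod> ls\<close> is a form of degree
  \<open>n - 3\<close>: its coefficients with respect to powers of \<open>x\<close> are rational functions of \<open>y\<close>
  without finite poles, and the place at infinity bounds their degrees.
\<close>

lemma pullback_form:
  assumes len: "length ls = n - 3"
  shows "\<exists>H. (\<forall>k. coeff H k \<noteq> 0 \<longrightarrow> k + degree (coeff H k) \<le> n - 3) \<and>
    (\<forall>x y. on_curve x y \<longrightarrow> ev H x y * poly d y ^ (n - 1)
      = prod_list (map (line_value (poly d y) (ev P1 x y) (ev P2 x y)) ls) * ev wronskian x y)"
proof -
  let ?A = "prod_list (map (line_poly [:d:] P1 P2) ls) * wronskian"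
  define D where "D = d ^ (n - 1)"
  have D: "D \<noteq> 0" using d_nz by (simp add: D_def)
  obtain Q R where A: "?A = curve_poly n b c * Q + R" and R: "\<forall>i\<ge>n. coeff R i = 0"
    using reduce_mod_curve_poly[OF n_pos] .
  have AR: "ev ?A x y = ev R x y" if "on_curve x y" for x y
    using that unfolding A by (simp add: on_curve_def)
  then have van: "vanishes (?A - R)" by (simp add: vanishes_def)
  note bound = place_bound[OF _ _ len R van]
  have ord_D: "Polynomial.order a D = (n - 1) * Polynomial.order a d" for a
  proof -
    have "Polynomial.order a (d ^ i) = i * Polynomial.order a d" for i
      by (induction i) (simp_all add: order_mult d_nz)
    then show ?thesis by (simp add: D_def)
  qed
  have k_lt: "k < n" if "coeff R k \<noteq> 0" for k using that R by (meson not_le)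
  have dvd: "D dvd coeff R k" if Rk: "coeff R k \<noteq> 0" for k
  proof (rule dvd_if_order_le[OF D Rk])
    fix a
    show "Polynomial.order a D \<le> Polynomial.order a (coeff R k)"
    proof (cases "b * a ^ n + c = 0")
      case False
      let ?u = "fps_const a + fps_X"
      obtain \<xi> where pl: "fermat_place n b c \<xi> (fps_to_fls ?u)" "fls_subdegree \<xi> = 0"
        using unbranched_place[OF False] .
      interpret fermat_place n b c \<xi> "fps_to_fls ?u" by fact
      have u: "fps_to_fls ?u \<noteq> fls_const a" "?u $ 0 = a" "fls_subdegree (fps_to_fls ?u - fls_const a) = 1"
        by simp_all
      note o = eval1_order[OF _ u(1,2)]
      have "ord_ge (int (n - 1) * int (Polynomial.order a d)) (eval1 fls_const (fps_to_fls ?u) (coeff R k) * \<xi> ^ k)"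
        using bound[OF pl(1) o(1)[OF d_nz] k_lt[OF Rk]] pl(2) o(2)[OF d_nz] u(3) by simp
      then have "int (n - 1) * int (Polynomial.order a d) \<le> int (Polynomial.order a (coeff R k))"
        using o[OF Rk] u(3) xi_nz pl(2) by (simp add: ord_ge_iff fls_subdegree_pow)
      then show ?thesis unfolding ord_D by (simp only: of_nat_mult [symmetric] of_nat_le_iff)
    next
      case True
      obtain u where pl: "fermat_place n b c fls_X (fps_to_fls u)" and u: "fps_to_fls u \<noteq> fls_const a" "u $ 0 = a"
        and sub: "fls_subdegree (fps_to_fls u - fls_const a) = int n"
          "fls_subdegree (fls_deriv (fps_to_fls u)) = int (n - 1)"
        using branch_place[OF True] by metis
      interpret fermat_place n b c fls_X "fps_to_fls u" by fact
      note o = eval1_order[OF _ u(1,2)]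
      \<comment> \<open>At a branch point x has order 1, so the contribution \<open>n - 1\<close> of
        x^(n-1) cancels the order of the derivative of y.\<close>
      have "ord_ge (int (n - 1) * (int (Polynomial.order a d) * int n))
          (eval1 fls_const (fps_to_fls u) (coeff R k) * fls_X ^ k)"
        using bound[OF pl o(1)[OF d_nz] k_lt[OF Rk]] o(2)[OF d_nz] unfolding sub by simp
      then have "int (n - 1) * (int (Polynomial.order a d) * int n) \<le> int (Polynomial.order a (coeff R k)) * int n + int k"
        using o[OF Rk] sub by (simp add: ord_ge_iff)
      then have "int ((n - 1) * Polynomial.order a d * n) \<le> int (Polynomial.order a (coeff R k) * n + k)"
        by (simp only: of_nat_mult of_nat_add mult.assoc)
      then have "(n - 1) * Polynomial.order a d * n \<le> Polynomial.order a (coeff R k) * n + k"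
        by (simp only: of_nat_le_iff)
      \<comment> \<open>All orders of polynomials in y are multiples of \<open>n\<close> here, so
        the surplus \<open>k < n\<close> coming from x^k cannot make up for a missing
        factor.\<close>
      also have "\<dots> < (Polynomial.order a (coeff R k) + 1) * n" using k_lt[OF Rk] by simp
      finally have "(n - 1) * Polynomial.order a d < Polynomial.order a (coeff R k) + 1"
        using mult_less_cancel2 by blast
      then show ?thesis unfolding ord_D by simp
    qed
  qed
  define H where "H = (\<Sum>k<n. monom (coeff R k div D) k)"
  have coeff_H: "coeff H k = coeff R k div D" for k
    using R by (auto simp: H_def coeff_sum coeff_monom)
  have HD: "coeff H k * D = coeff R k" for k
    using dvd[of k] by (cases "coeff R k = 0") (simp_all add: coeff_H)
  have "k + degree (coeff H k) \<le> n - 3" if Hk: "coeff H k \<noteq> 0" for k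
  proof -
    have Rk: "coeff R k \<noteq> 0" using HD[of k] Hk D by auto
    obtain \<xi> where pl: "fermat_place n b c \<xi> fls_X_inv" "fls_subdegree \<xi> = - 1"
      using infinite_place .
    interpret fermat_place n b c \<xi> fls_X_inv by fact
    note o = eval1_infinity[OF d_nz] eval1_infinity[OF Rk]
    define N where "N = n - 1"
    \<comment> \<open>At infinity the orders of \<open>d\<close>, x and dy/dX are
      \<open>- degree d\<close>, -1 and -2. The degree bound is therefore
      \<open>(n - 1) * degree d\<close> plus n - 1 - 2 = n - 3.\<close>
    have "fls_subdegree (fls_deriv (fls_X_inv :: 'a fls)) = - 2"
      by (simp only: fls_deriv_X_inv fls_uminus_subdegree fls_subdegree_fls_X_inv_pow)
    then have "int N * (- int (degree d)) - int N + 2 \<le> - int (degree (coeff R k)) - int k"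
      using bound[OF pl(1) conjunct1[OF o(1)] k_lt[OF Rk], folded N_def] o xi_nz pl(2)
      by (simp add: ord_ge_iff fls_subdegree_pow)
    moreover have "degree (coeff R k) = degree (coeff H k) + N * degree d"
      using HD[of k, symmetric] Hk d_nz by (simp add: D_def degree_mult_eq degree_power_eq N_def)
    ultimately have "int k + int (degree (coeff H k)) + 2 \<le> int N"
      by (simp add: algebra_simps)
    then have "int k + int (degree (coeff H k)) + 2 \<le> int (n - 1)" unfolding N_def .
    then show ?thesis using n_ge by linarith
  qed
  moreover have "ev H x y * poly d y ^ (n - 1)
      = prod_list (map (line_value (poly d y) (ev P1 x y) (ev P2 x y)) ls) * ev wronskian x y"
    if "on_curve x y" for x y
  proof -
    have H: "\<forall>i\<ge>n. coeff H i = 0" using R by (simp add: coeff_H)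
    have "ev H x y * poly D y = ev R x y"
      unfolding id_map.eval2_low[OF H] id_map.eval2_low[OF R] sum_distrib_right
      by (intro sum.cong refl) (simp add: HD [symmetric] mult_ac)
    also have "\<dots> = ev ?A x y" using AR[OF that] by simp
    finally show ?thesis by (simp add: D_def id_map.eval2_prod_linear_form)
  qed
  ultimately show ?thesis by blast
qed

text \<open>Otherwise P1 / P2 has derivative 0 at a place, so it is a constant k there, and the
  image would lie in the line given by (0, 1, - k).\<close>

lemma wronskian_nonvanishing: "\<not> vanishes wronskian"
proof
  assume W: "vanishes wronskian"
  have "infinite (UNIV :: 'a set)" by (rule infinite_UNIV_char_0)
  then obtain a where a: "b * a ^ n + c \<noteq> 0"
    using finite_branch by (metis (mono_tags, lifting) ex_new_if_finite mem_Collect_eq)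
  let ?u = "fps_const a + fps_X"
  obtain \<xi> where pl: "fermat_place n b c \<xi> (fps_to_fls ?u)"
    using unbranched_place[OF a] by metis
  interpret fermat_place n b c \<xi> "fps_to_fls ?u" by fact
  \<comment> \<open>A converse to \<open>place_vanishes\<close>: the norm of \<open>A\<close> is a
    nonzero polynomial in y, and y = a + X is not constant at this place.\<close>
  have nonzero: "pull A \<noteq> 0" if nv: "\<not> vanishes A" for A
  proof -
    obtain U e where Ue: "e \<noteq> 0" "\<forall>x y. on_curve x y \<longrightarrow> ev U x y * ev A x y = poly e y"
      using norm_exists[OF nv] by blast
    then have "vanishes (U * A - [:e:])" by (simp add: vanishes_def)
    from place_vanishes[OF this] have "pull U * pull A = eval1 fls_const (fps_to_fls ?u) e" by simp
    moreover have "eval1 fls_const (fps_to_fls ?u) e \<noteq> 0"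
      by (rule eval1_order(1)[OF Ue(1), of _ a]) simp_all
    ultimately show ?thesis by auto
  qed
  have p2: "pull P2 \<noteq> 0"
  proof (rule nonzero)
    have "\<not> vanishes (line_poly [:d:] P1 P2 (0, 0, 1))" by (rule image_not_in_line) simp
    then show "\<not> vanishes P2" by (simp add: linear_form_def vanishes_def)
  qed
  define q where "q = pull P1 / pull P2"
  have q: "pull P1 = q * pull P2" using p2 by (simp add: q_def)
  have "\<xi> ^ (n - 1) * (pull P1 * fls_deriv (pull P2) - pull P2 * fls_deriv (pull P1)) = 0"
    using place_wronskian[OF pl] place_vanishes[OF W] by simp
  then have "pull P1 * fls_deriv (pull P2) - pull P2 * fls_deriv (pull P1) = 0"
    using xi_nz by simp
  then have "pull P2 * (pull P2 * fls_deriv q) = 0"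
    unfolding q by (simp add: algebra_simps)
  then have "fls_deriv q = 0" using p2 by simp
  then obtain k where "q = fls_const k" by (metis fls_deriv_eq_0_iff)
  then have "pull (line_poly [:d:] P1 P2 (0, 1, - k)) = 0"
    using q by (simp add: linear_form_def fls_map.map_minus)
  moreover have "\<not> vanishes (line_poly [:d:] P1 P2 (0, 1, - k))" by (rule image_not_in_line) simp
  ultimately show False using nonzero by blast
qed

text \<open>The conditions provide at least n points in the fibre and make the form \<open>H\<close>
  of \<open>pullback_form\<close> vanish at such a point exactly if one of the lines does.\<close>

definition good :: "'a \<Rightarrow> bool" where
  "good y \<longleftrightarrow> b * y ^ n + c \<noteq> 0 \<and> poly d y \<noteq> 0 \<and> (\<forall>x. on_curve x y \<longrightarrow> ev wronskian x y \<noteq> 0)"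

lemma finite_bad: "finite {y. \<not> good y}"
proof -
  have "{y. \<not> good y} \<subseteq> {y. b * y ^ n + c = 0} \<union> {y. poly d y = 0}
      \<union> {y. \<exists>x. on_curve x y \<and> ev wronskian x y = 0}"
    by (auto simp: good_def)
  moreover have "finite {y. poly d y = 0}" using d_nz by (rule poly_roots_finite)
  ultimately show ?thesis
    using finite_branch finite_zeros[OF wronskian_nonvanishing] by (meson finite_UnI finite_subset)
qed

lemma fibre_form_eq_0:
  assumes y: "b * y ^ n + c \<noteq> 0" and H: "\<forall>k. coeff H k \<noteq> 0 \<longrightarrow> k + degree (coeff H k) \<le> n - 3"
    and T: "T \<subseteq> {x. on_curve x y}" "card T \<ge> n - 2" "\<And>x. x \<in> T \<Longrightarrow> ev H x y = 0"
  shows "map_poly (\<lambda>q. poly q y) H = 0"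
proof (rule ccontr)
  let ?q = "map_poly (\<lambda>q. poly q y) H"
  assume q: "?q \<noteq> 0"
  have "degree ?q \<le> n - 3"
  proof (rule degree_le, intro allI impI)
    fix i assume "n - 3 < i"
    then have "coeff H i = 0" using H by (metis add_leE not_le)
    then show "coeff ?q i = 0" by (simp add: coeff_map_poly)
  qed
  moreover have "card T \<le> card {x. poly ?q x = 0}"
    using T(3) by (intro card_mono poly_roots_finite q) (auto simp: eval2_def)
  ultimately show False using card_poly_roots_bound[OF q] T(2) n_ge by linarith
qed

text \<open>
  If \<open>n\<close> points with collinear images were not collinear, a product of \<open>n - 3\<close> lines would
  contain \<open>n - 2\<close> of them without containing all; its pullback is a form of degree \<open>n - 3\<close>
  with \<open>n - 2\<close> zeros on a line.
\<close>

lemma fibre_collinear: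
  assumes y: "good y"
  shows "\<exists>l. l \<noteq> (0, 0, 0) \<and> (\<forall>x. on_curve x y \<longrightarrow> line_value (poly d y) (ev P1 x y) (ev P2 x y) l = 0)"
proof -
  define D where "D = poly d y"
  define F where "F = {x. on_curve x y}"
  have br: "b * y ^ n + c \<noteq> 0" and D: "D \<noteq> 0" and W: "\<And>x. x \<in> F \<Longrightarrow> ev wronskian x y \<noteq> 0"
    using y by (auto simp: good_def D_def F_def)
  have F: "finite F" "n \<le> card F" unfolding F_def using fibre[OF br] by auto
  define u v where "u x = ev P1 x y" and "v x = ev P2 x y" for x
  have inj: "u x \<noteq> u x' \<or> v x \<noteq> v x'" if "x \<in> F" "x' \<in> F" "x \<noteq> x'" for x x'
    using P_inj[of x y x' y 1] that D by (auto simp: F_def u_def v_def D_def)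
  have "2 \<le> card F" using F(2) n_ge by linarith
  then obtain T' where "T' \<subseteq> F" "card T' = 2" using obtain_subset_with_card_n by metis
  then obtain x0 x1 where x01: "x0 \<in> F" "x1 \<in> F" "x0 \<noteq> x1" by (auto simp: card_2_iff)
  \<comment> \<open>The cross product of the images of \<open>x0\<close> and \<open>x1\<close>, that
    is, the line joining them.\<close>
  define l where "l = (u x0 * v x1 - v x0 * u x1, D * (v x0 - v x1), D * (u x1 - u x0))"
  have l_nz: "l \<noteq> (0, 0, 0)" using inj[OF x01] D by (auto simp: l_def)
  have l0: "line_value D (u x0) (v x0) l = 0" and l1: "line_value D (u x1) (v x1) l = 0"
    by (simp_all add: l_def linear_form_def algebra_simps)
  have "line_value D (u x2) (v x2) l = 0" if x2: "x2 \<in> F" for x2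
  proof (rule ccontr)
    assume l2: "line_value D (u x2) (v x2) l \<noteq> 0"
    have ne: "x2 \<noteq> x0" "x2 \<noteq> x1" using l0 l1 l2 by auto
    have "card (F - {x0, x1, x2}) = card F - 3"
      using x01 x2 ne F(1) by (subst card_Diff_subset) auto
    then have "n - 4 \<le> card (F - {x0, x1, x2})" using F(2) by linarith
    then obtain T where T: "T \<subseteq> F - {x0, x1, x2}" "card T = n - 4" "finite T"
      using obtain_subset_with_card_n by metis
    obtain xs where xs: "set xs = T" "distinct xs" using finite_distinct_list[OF T(3)] by blast
    \<comment> \<open>A line through the image of \<open>x\<close> that avoids the image of
      \<open>x2\<close>: fix whichever of the affine coordinates u / D and v / D distinguishes the
      two. There are \<open>n - 4\<close> of these; with \<open>l\<close> they make
      \<open>n - 3\<close> lines through \<open>n - 2\<close> images.\<close>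
    define m where "m x = (if u x \<noteq> u x2 then (- u x, D, 0) else (- v x, 0, D))" for x
    have m: "line_value D (u x) (v x) (m x) = 0" for x by (simp add: m_def linear_form_def)
    have m2: "line_value D (u x2) (v x2) (m x) \<noteq> 0" if "x \<in> T" for x
    proof -
      have "x \<in> F" "x \<noteq> x2" using that T(1) by auto
      then have "u x \<noteq> u x2 \<or> v x \<noteq> v x2" using inj x2 by blast
      then show ?thesis
        using D by (auto simp: m_def linear_form_def mult.commute [of D] left_diff_distrib [symmetric])
    qed
    define ls where "ls = l # map m xs"
    have len: "length ls = n - 3"
      using n_ge T(2) xs distinct_card[OF xs(2)] by (simp add: ls_def)
    obtain H where H: "\<forall>k. coeff H k \<noteq> 0 \<longrightarrow> k + degree (coeff H k) \<le> n - 3"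
      and H_ev: "\<forall>x y. on_curve x y \<longrightarrow> ev H x y * poly d y ^ (n - 1)
        = prod_list (map (line_value (poly d y) (ev P1 x y) (ev P2 x y)) ls) * ev wronskian x y"
      using pullback_form[OF len] by blast
    have ev_H: "ev H x y * D ^ (n - 1) = prod_list (map (line_value D (u x) (v x)) ls) * ev wronskian x y" if "x \<in> F" for x
      using H_ev that by (simp add: F_def D_def u_def v_def)
    have zero: "ev H x y = 0" if "x \<in> insert x0 (insert x1 T)" for x
    proof -
      have "\<exists>l'\<in>set ls. line_value D (u x) (v x) l' = 0" using that l0 l1 m xs(1) by (auto simp: ls_def)
      then have "prod_list (map (line_value D (u x) (v x)) ls) = 0" by (auto simp: prod_list_zero_iff)
      then show ?thesis using ev_H[of x] that x01 T(1) D by auto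
    qed
    have "card (insert x0 (insert x1 T)) = n - 2"
      using T x01 n_ge by (subst card_insert_disjoint; auto)+
    then have "map_poly (\<lambda>q. poly q y) H = 0"
      using T(1) x01 zero by (intro fibre_form_eq_0[OF br H, of "insert x0 (insert x1 T)"]) (auto simp: F_def)
    then have "ev H x2 y = 0" by (simp add: eval2_def)
    then have "prod_list (map (line_value D (u x2) (v x2)) ls) = 0"
      using ev_H[OF x2] W[OF x2] by simp
    then show False using l2 m2 xs(1) by (auto simp: ls_def prod_list_zero_iff)
  qed
  then show ?thesis using l_nz by (intro exI[of _ l]) (simp add: D_def F_def u_def v_def)
qed

lemma linear_representation_monic:
  "\<exists>m0 m1 m2 B. finite B \<and> (\<forall>x y. on_curve x y \<and> y \<notin> B \<longrightarrow>
    (\<exists>t. t \<noteq> 0 \<and> poly d y = t * line_value x y 1 m0 \<and> ev P1 x y = t * line_value x y 1 m1 \<and> ev P2 x y = t * line_value x y 1 m2))"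
proof -
  have "infinite {y. good y}"
  proof
    assume "finite {y. good y}"
    with finite_bad have "finite ({y. \<not> good y} \<union> {y. good y})" by (rule finite_UnI)
    moreover have "{y. \<not> good y} \<union> {y. good y} = UNIV" by auto
    ultimately show False using infinite_UNIV_char_0[where ?'a = 'a] by simp
  qed
  then obtain Y where Y: "finite Y" "card Y = n - 4" "Y \<subseteq> {y. good y}"
    using infinite_arbitrarily_large by metis
  obtain ys where ys: "set ys = Y" "distinct ys" using finite_distinct_list[OF Y(1)] by blast
  have "\<forall>y. \<exists>l. good y \<longrightarrow> l \<noteq> (0, 0, 0) \<and>
      (\<forall>x. on_curve x y \<longrightarrow> line_value (poly d y) (ev P1 x y) (ev P2 x y) l = 0)"
    using fibre_collinear by blast
  then obtain L where L: "\<And>y. good y \<Longrightarrow> L y \<noteq> (0, 0, 0)"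
    "\<And>x y. good y \<Longrightarrow> on_curve x y \<Longrightarrow> line_value (poly d y) (ev P1 x y) (ev P2 x y) (L y) = 0" by metis
  define \<pi> where "\<pi> = prod_list (map (\<lambda>y. [:- y, 1:]) ys)"
  have "degree (prod_list (map (\<lambda>y. [:- y, 1:]) zs)) = length zs \<and> prod_list (map (\<lambda>y. [:- y, 1:]) zs) \<noteq> 0"
    for zs :: "'a list"
    by (induction zs) (simp_all add: degree_mult_eq del: mult_pCons_left)
  then have pi_deg: "degree \<pi> = n - 4" "\<pi> \<noteq> 0"
    using distinct_card[OF ys(2)] ys(1) Y(2) by (simp_all add: \<pi>_def)
  \<comment> \<open>The part of the pullback that does not depend on the extra line
    \<open>l\<close>. As it is shared, the coordinate lines below give linear forms with one common
    ratio.\<close>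
  define K where "K x y = prod_list (map (line_value (poly d y) (ev P1 x y) (ev P2 x y)) (map L ys)) * ev wronskian x y" for x y
  have lin: "\<exists>m. \<forall>x y. on_curve x y \<longrightarrow>
      poly \<pi> y * poly d y ^ (n - 1) * line_value x y 1 m = K x y * line_value (poly d y) (ev P1 x y) (ev P2 x y) l" for l
  proof -
    have "length (l # map L ys) = n - 3"
      using distinct_card[OF ys(2)] ys(1) Y(2) n_ge by simp
    then obtain H where H: "\<forall>k. coeff H k \<noteq> 0 \<longrightarrow> k + degree (coeff H k) \<le> n - 3"
      and H_ev: "\<forall>x y. on_curve x y \<longrightarrow> ev H x y * poly d y ^ (n - 1)
        = prod_list (map (line_value (poly d y) (ev P1 x y) (ev P2 x y)) (l # map L ys)) * ev wronskian x y"
      using pullback_form by blast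
    have "\<pi> dvd coeff H k" for k
      unfolding \<pi>_def
    proof (rule prod_roots_dvd[OF ys(2)])
      fix y assume y: "y \<in> set ys"
      then have gy: "good y" using ys(1) Y(3) by auto
      then have br: "b * y ^ n + c \<noteq> 0" and dy: "poly d y \<noteq> 0" by (auto simp: good_def)
      have "map_poly (\<lambda>q. poly q y) H = 0"
      proof (rule fibre_form_eq_0[OF br H, of "{x. on_curve x y}"])
        show "card {x. on_curve x y} \<ge> n - 2" using fibre(2)[OF br] by linarith
        fix x assume "x \<in> {x. on_curve x y}"
        then have x: "on_curve x y" by simp
        have "prod_list (map (line_value (poly d y) (ev P1 x y) (ev P2 x y)) (l # map L ys)) = 0"
          using L(2)[OF gy x] y by (force simp: prod_list_zero_iff)
        then have "ev H x y * poly d y ^ (n - 1) = 0" using H_ev x by simp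
        then show "ev H x y = 0" using dy by simp
      qed simp
      then have "coeff (map_poly (\<lambda>q. poly q y) H) k = 0" by simp
      then show "poly (coeff H k) y = 0" by (simp add: coeff_map_poly)
    qed
    then have "\<forall>k. \<exists>g. coeff H k = \<pi> * g" by (auto simp: dvd_def)
    then obtain g where g: "\<And>k. coeff H k = \<pi> * g k" by metis
    have g_deg: "k + degree (g k) \<le> 1" if "g k \<noteq> 0" for k
    proof -
      have "k + (n - 4 + degree (g k)) \<le> n - 3"
        using H[rule_format, of k] that pi_deg by (simp add: g degree_mult_eq)
      then show ?thesis using n_ge by linarith
    qed
    \<comment> \<open>After division by \<pi>, of degree \<open>n - 4\<close>, total degree at most
      1 is left: x occurs at most linearly and only with a constant coefficient.\<close>
    have H2: "\<forall>i\<ge>2. coeff H i = 0" using g_deg g by (metis add_leE mult_zero_right not_less_eq_eq one_add_one plus_1_eq_Suc)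
    have "degree (g 0) \<le> 1" using g_deg[of 0] by (cases "g 0 = 0") auto
    then have "g 0 = [:coeff (g 0) 0, coeff (g 0) 1:]"
      by (intro poly_eqI) (auto simp: coeff_pCons coeff_eq_0 split: nat.split)
    then obtain \<alpha> \<beta> where g0: "g 0 = [:\<alpha>, \<beta>:]" by blast
    have "degree (g 1) = 0" using g_deg[of 1] by (cases "g 1 = 0") auto
    then obtain \<gamma> where g1: "g 1 = [:\<gamma>:]" by (metis degree_0_id)
    have "ev H x y = poly \<pi> y * line_value x y 1 (\<gamma>, \<beta>, \<alpha>)" for x y
    proof -
      have "ev H x y = poly (coeff H 0) y + poly (coeff H 1) y * x"
        unfolding id_map.eval2_low[OF H2] by (simp add: numeral_2_eq_2)
      then show ?thesis unfolding g g0 g1 by (simp add: linear_form_def algebra_simps)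
    qed
    then show ?thesis using H_ev
      by (intro exI[of _ "(\<gamma>, \<beta>, \<alpha>)"]) (auto simp: K_def mult_ac)
  qed
  obtain m0 m1 m2 where m: "\<And>x y. on_curve x y \<Longrightarrow>
      poly \<pi> y * poly d y ^ (n - 1) * line_value x y 1 m0 = K x y * line_value (poly d y) (ev P1 x y) (ev P2 x y) (1, 0, 0)"
    "\<And>x y. on_curve x y \<Longrightarrow>
      poly \<pi> y * poly d y ^ (n - 1) * line_value x y 1 m1 = K x y * line_value (poly d y) (ev P1 x y) (ev P2 x y) (0, 1, 0)"
    "\<And>x y. on_curve x y \<Longrightarrow>
      poly \<pi> y * poly d y ^ (n - 1) * line_value x y 1 m2 = K x y * line_value (poly d y) (ev P1 x y) (ev P2 x y) (0, 0, 1)"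
    using lin by metis
  define KP where "KP = prod_list (map (line_poly [:d:] P1 P2) (map L ys)) * wronskian"
  have KP: "ev KP x y = K x y" for x y
    by (simp add: KP_def K_def id_map.eval2_prod_linear_form del: map_map)
  have "\<not> vanishes KP"
  proof
    assume "vanishes KP"
    then have "vanishes (prod_list (map (line_poly [:d:] P1 P2) (map L ys)))"
      unfolding KP_def using vanishes_mult wronskian_nonvanishing by blast
    then obtain A where "A \<in> set (map (line_poly [:d:] P1 P2) (map L ys))" "vanishes A"
      using vanishes_prod_list by blast
    then obtain y where "y \<in> Y" "vanishes (line_poly [:d:] P1 P2 (L y))" using ys(1) by auto
    then show False using image_not_in_line L(1) Y(3) by blast
  qed
  \<comment> \<open>Away from these y the factor \<open>t\<close>, the quotient of \<pi> d^(n-1) by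
    \<open>K\<close>, is defined and nonzero.\<close>
  define B where "B = {y. poly \<pi> y = 0} \<union> {y. poly d y = 0} \<union> {y. \<exists>x. on_curve x y \<and> ev KP x y = 0}"
  have "finite B"
    unfolding B_def using finite_zeros[OF \<open>\<not> vanishes KP\<close>] poly_roots_finite pi_deg(2) d_nz by blast
  moreover have "\<exists>t. t \<noteq> 0 \<and> poly d y = t * line_value x y 1 m0 \<and> ev P1 x y = t * line_value x y 1 m1 \<and> ev P2 x y = t * line_value x y 1 m2"
    if xy: "on_curve x y" "y \<notin> B" for x y
  proof -
    let ?t = "poly \<pi> y * poly d y ^ (n - 1) / K x y"
    have K: "K x y \<noteq> 0" and "poly \<pi> y \<noteq> 0" "poly d y \<noteq> 0" using xy by (auto simp: B_def KP)
    then have "?t \<noteq> 0" by simp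
    moreover have "poly d y = ?t * line_value x y 1 m0" "ev P1 x y = ?t * line_value x y 1 m1" "ev P2 x y = ?t * line_value x y 1 m2"
      using m[OF xy(1)] K by (simp_all add: linear_form_def field_simps)
    ultimately show ?thesis by blast
  qed
  ultimately show ?thesis by blast
qed

end

text \<open>Multiplying all coordinates by the cofactor \<open>U\<close> in the norm of
  \<open>P0\<close> leaves the map unchanged where \<open>U\<close> is nonzero and turns the first
  coordinate into \<open>d\<close>, as \<open>fermat_map_monic\<close> requires.\<close>

lemma (in fermat_map) linear_representation:
  "\<exists>m0 m1 m2 B. finite B \<and> (\<forall>x y. on_curve x y \<and> y \<notin> B \<longrightarrow>
    (\<exists>t. t \<noteq> 0 \<and> ev P0 x y = t * line_value x y 1 m0 \<and> ev P1 x y = t * line_value x y 1 m1 \<and> ev P2 x y = t * line_value x y 1 m2))"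
proof -
  have "\<not> vanishes (line_poly P0 P1 P2 (1, 0, 0))" by (rule image_not_in_line) simp
  then have "\<not> vanishes P0" by (simp add: linear_form_def vanishes_def)
  then obtain U d where d: "d \<noteq> 0" and U: "\<forall>x y. on_curve x y \<longrightarrow> ev U x y * ev P0 x y = poly d y"
    using norm_exists by blast
  interpret M: fermat_map_monic n b c a0 a1 a2 d "U * P1" "U * P2"
  proof unfold_locales
    show "a0 \<noteq> 0" "a1 \<noteq> 0" "a2 \<noteq> 0" by (fact a_nz)+
    show "a0 * ev [:d:] x y ^ n + a1 * ev (U * P1) x y ^ n + a2 * ev (U * P2) x y ^ n = 0"
      if xy: "on_curve x y" for x y
    proof -
      have "a0 * ev [:d:] x y ^ n + a1 * ev (U * P1) x y ^ n + a2 * ev (U * P2) x y ^ n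
        = ev U x y ^ n * (a0 * ev P0 x y ^ n + a1 * ev P1 x y ^ n + a2 * ev P2 x y ^ n)"
        using U[rule_format, OF xy, symmetric] by (simp add: power_mult_distrib algebra_simps)
      then show ?thesis using P_eq[OF xy] by simp
    qed
    show "\<not> (vanishes [:d:] \<and> vanishes (U * P1) \<and> vanishes (U * P2))"
      using vanishes_const_y d by blast
    fix x y x' y' t
    assume xy: "on_curve x y" "on_curve x' y'" and t: "t \<noteq> 0"
      and nz: "(ev [:d:] x y, ev (U * P1) x y, ev (U * P2) x y) \<noteq> (0, 0, 0)"
      and eq: "ev [:d:] x' y' = t * ev [:d:] x y" "ev (U * P1) x' y' = t * ev (U * P1) x y"
        "ev (U * P2) x' y' = t * ev (U * P2) x y"
    have d_ev: "ev [:d:] x y = ev U x y * ev P0 x y" "ev [:d:] x' y' = ev U x' y' * ev P0 x' y'"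
      using U xy by simp_all
    have U0: "ev U x y \<noteq> 0" and P: "(ev P0 x y, ev P1 x y, ev P2 x y) \<noteq> (0, 0, 0)"
      using nz unfolding d_ev by auto
    have "(ev [:d:] x' y', ev (U * P1) x' y', ev (U * P2) x' y') \<noteq> (0, 0, 0)"
      using nz t unfolding eq by auto
    then have U0': "ev U x' y' \<noteq> 0" unfolding d_ev by auto
    show "x = x' \<and> y = y'"
      by (rule P_inj[where t = "t * ev U x y / ev U x' y'", OF xy _ P])
        (use t U0 U0' eq[unfolded d_ev] in \<open>simp_all add: field_simps\<close>)
  qed (rule d)
  obtain m0 m1 m2 B where B: "finite B" and m: "\<And>x y. on_curve x y \<and> y \<notin> B \<Longrightarrow>
    (\<exists>t. t \<noteq> 0 \<and> poly d y = t * line_value x y 1 m0 \<and> ev (U * P1) x y = t * line_value x y 1 m1 \<and> ev (U * P2) x y = t * line_value x y 1 m2)"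
    using M.linear_representation_monic by metis
  have "finite (B \<union> {y. poly d y = 0})" using B d poly_roots_finite by blast
  moreover have "\<exists>t. t \<noteq> 0 \<and> ev P0 x y = t * line_value x y 1 m0 \<and> ev P1 x y = t * line_value x y 1 m1 \<and> ev P2 x y = t * line_value x y 1 m2"
    if xy: "on_curve x y" "y \<notin> B \<union> {y. poly d y = 0}" for x y
  proof -
    obtain t where t: "t \<noteq> 0" "poly d y = t * line_value x y 1 m0" "ev (U * P1) x y = t * line_value x y 1 m1"
        "ev (U * P2) x y = t * line_value x y 1 m2"
      using m xy by blast
    have d_ev: "poly d y = ev U x y * ev P0 x y" using U xy by simp
    then have U0: "ev U x y \<noteq> 0" using xy by auto
    then have "ev P0 x y = t / ev U x y * line_value x y 1 m0" "ev P1 x y = t / ev U x y * line_value x y 1 m1"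
        "ev P2 x y = t / ev U x y * line_value x y 1 m2"
      using t(2-4) unfolding d_ev by (simp_all add: nonzero_eq_divide_eq mult.commute)
    then show ?thesis using t(1) U0 by (intro exI[of _ "t / ev U x y"]) simp
  qed
  ultimately show ?thesis by blast
qed

section \<open>Linear maps between Fermat curves are monomial\<close>

lemma coeff_linear_power_top:
  fixes u v :: "'a::comm_ring_1"
  shows "coeff ([:u, v:] ^ n) n = v ^ n \<and> (\<forall>i>n. coeff ([:u, v:] ^ n) i = 0)"
proof (induction n)
  case (Suc n)
  have "coeff ([:u, v:] ^ Suc n) (Suc i) = u * coeff ([:u, v:] ^ n) (Suc i) + v * coeff ([:u, v:] ^ n) i" for i
    by simp
  then show ?case using Suc by (auto simp: gr0_conv_Suc Suc_less_eq2)
qed (simp add: coeff_1)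

text \<open>An identity of functions on an infinite field is one of polynomials, so it may be
  differentiated; the common factor \<open>n\<close> cancels. Two applications in different
  variables yield mixed second derivatives.\<close>

lemma power_identity_deriv:
  fixes a0 a1 a2 :: "'a::field_char_0"
  assumes n: "n > 0" and eq: "\<And>x. a0 * (u0 + v0 * x) ^ n + a1 * (u1 + v1 * x) ^ n + a2 * (u2 + v2 * x) ^ n = k * x ^ n + e"
  shows "a0 * v0 * (u0 + v0 * x) ^ (n - 1) + a1 * v1 * (u1 + v1 * x) ^ (n - 1)
    + a2 * v2 * (u2 + v2 * x) ^ (n - 1) = k * x ^ (n - 1)"
proof -
  define p where "p = smult a0 ([:u0, v0:] ^ n) + smult a1 ([:u1, v1:] ^ n) + smult a2 ([:u2, v2:] ^ n)
    - monom k n - [:e:]"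
  have "poly p x = 0" for x using eq[of x] by (simp add: p_def poly_monom mult.commute)
  then have "p = 0" using poly_all_0_iff_0[of p] by blast
  then have "poly (pderiv p) x = 0" by simp
  then have "of_nat n * (a0 * v0 * (u0 + v0 * x) ^ (n - 1) + a1 * v1 * (u1 + v1 * x) ^ (n - 1)
    + a2 * v2 * (u2 + v2 * x) ^ (n - 1) - k * x ^ (n - 1)) = 0"
    by (simp add: p_def pderiv_add pderiv_diff pderiv_smult pderiv_power pderiv_monom pderiv_pCons poly_monom algebra_simps)
  then show ?thesis using n by simp
qed

text \<open>With determinant 0, the cross product of any two of the vectors x, y, z is orthogonal to
  all three. If all cross products are 0, the vectors are parallel, and a vector orthogonal to a
  nonzero one of them will do.\<close>

lemma singular_rows_dependent:
  fixes x0 :: "'a::field"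
  assumes det: "x0 * (y1 * z2 - y2 * z1) + x1 * (y2 * z0 - y0 * z2) + x2 * (y0 * z1 - y1 * z0) = 0"
  shows "\<exists>l0 l1 l2. (l0, l1, l2) \<noteq> (0, 0, 0) \<and> l0 * x0 + l1 * x1 + l2 * x2 = 0
    \<and> l0 * y0 + l1 * y1 + l2 * y2 = 0 \<and> l0 * z0 + l1 * z1 + l2 * z2 = 0"
proof -
  have witness: ?thesis if "(l0, l1, l2) \<noteq> (0, 0, 0)" "l0 * x0 + l1 * x1 + l2 * x2 = 0"
    "l0 * y0 + l1 * y1 + l2 * y2 = 0" "l0 * z0 + l1 * z1 + l2 * z2 = 0" for l0 l1 l2
    using that by blast
  show ?thesis
  proof (rule ccontr)
    assume no: "\<not> ?thesis"
    have yz: "y1 * z2 - y2 * z1 = 0" "y2 * z0 - y0 * z2 = 0" "y0 * z1 - y1 * z0 = 0"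
      using no witness[of "y1 * z2 - y2 * z1" "y2 * z0 - y0 * z2" "y0 * z1 - y1 * z0"] det
      by (auto simp: algebra_simps)
    have zx: "z1 * x2 - z2 * x1 = 0" "z2 * x0 - z0 * x2 = 0" "z0 * x1 - z1 * x0 = 0"
      using no witness[of "z1 * x2 - z2 * x1" "z2 * x0 - z0 * x2" "z0 * x1 - z1 * x0"] det
      by (auto simp: algebra_simps)
    have xy: "x1 * y2 - x2 * y1 = 0" "x2 * y0 - x0 * y2 = 0" "x0 * y1 - x1 * y0 = 0"
      using no witness[of "x1 * y2 - x2 * y1" "x2 * y0 - x0 * y2" "x0 * y1 - x1 * y0"] det
      by (auto simp: algebra_simps)
    have "x0 = 0" "x1 = 0" "x2 = 0"
      using no witness[of x1 "- x0" 0] witness[of x2 0 "- x0"] witness[of 0 x2 "- x1"] xy zx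
      by (auto simp: algebra_simps)
    moreover have "y0 = 0" "y1 = 0" "y2 = 0"
      using no witness[of y1 "- y0" 0] witness[of y2 0 "- y0"] witness[of 0 y2 "- y1"] xy yz
      by (auto simp: algebra_simps)
    moreover have "z0 = 0" "z1 = 0" "z2 = 0"
      using no witness[of z1 "- z0" 0] witness[of z2 0 "- z0"] witness[of 0 z2 "- z1"] yz zx
      by (auto simp: algebra_simps)
    ultimately have ?thesis by (intro witness[of 1 0 0]) simp_all
    then show False using no by blast
  qed
qed

lemma infinite_zeros_eq_0:
  fixes p :: "'a::field_char_0 poly"
  assumes "finite B" "\<And>x. x \<notin> B \<Longrightarrow> poly p x = 0"
  shows "poly p x = 0"
proof -
  have "- {x. poly p x = 0} \<subseteq> B" using assms(2) by auto
  then have "finite (- {x. poly p x = 0})" using assms(1) finite_subset by blast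
  then have "infinite {x. poly p x = 0}"
    using infinite_UNIV_char_0[where ?'a = 'a] by (metis finite_compl)
  then have "p = 0" using poly_roots_finite by blast
  then show ?thesis by simp
qed

context fermat_map begin

text \<open>Put the linear forms into the target equation and subtract \<open>k\<close> times the
  source equation. What remains has degree less than \<open>n\<close> in x and vanishes on almost
  all fibres, so it is 0. The determinant is nonzero because the image is not contained in a
  line.\<close>

lemma monomial_representation:
  obtains x0 y0 z0 x1 y1 z1 x2 y2 z2 B k where "finite B" "k \<noteq> 0"
    "\<forall>x y. on_curve x y \<and> y \<notin> B \<longrightarrow> (\<exists>t. t \<noteq> 0 \<and> ev P0 x y = t * (x0 * x + y0 * y + z0)
      \<and> ev P1 x y = t * (x1 * x + y1 * y + z1) \<and> ev P2 x y = t * (x2 * x + y2 * y + z2))"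
    "\<forall>x y z. a0 * (x0 * x + y0 * y + z0 * z) ^ n + a1 * (x1 * x + y1 * y + z1 * z) ^ n
      + a2 * (x2 * x + y2 * y + z2 * z) ^ n = k * (x ^ n + b * y ^ n + c * z ^ n)"
    "x0 * y0 = 0" "x0 * z0 = 0" "y0 * z0 = 0" "x1 * y1 = 0" "x1 * z1 = 0" "y1 * z1 = 0"
    "x2 * y2 = 0" "x2 * z2 = 0" "y2 * z2 = 0"
    "x0 * (y1 * z2 - y2 * z1) + x1 * (y2 * z0 - y0 * z2) + x2 * (y0 * z1 - y1 * z0) \<noteq> 0"
proof -
  obtain m0 m1 m2 B where B: "finite B" and m: "\<forall>x y. on_curve x y \<and> y \<notin> B \<longrightarrow>
    (\<exists>t. t \<noteq> 0 \<and> ev P0 x y = t * line_value x y 1 m0 \<and> ev P1 x y = t * line_value x y 1 m1 \<and> ev P2 x y = t * line_value x y 1 m2)"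
    using linear_representation by blast
  obtain x0 y0 z0 where m0: "m0 = (x0, y0, z0)" by (cases m0)
  obtain x1 y1 z1 where m1: "m1 = (x1, y1, z1)" by (cases m1)
  obtain x2 y2 z2 where m2: "m2 = (x2, y2, z2)" by (cases m2)
  have rep: "\<exists>t. t \<noteq> 0 \<and> ev P0 x y = t * (x0 * x + y0 * y + z0)
      \<and> ev P1 x y = t * (x1 * x + y1 * y + z1) \<and> ev P2 x y = t * (x2 * x + y2 * y + z2)"
    if "on_curve x y" "y \<notin> B" for x y
    using m that by (simp add: m0 m1 m2 linear_form_def)
  define L0 L1 L2 where "L0 x y z = x0 * x + y0 * y + z0 * z" and "L1 x y z = x1 * x + y1 * y + z1 * z"
    and "L2 x y z = x2 * x + y2 * y + z2 * z" for x y z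
  note L_defs = L0_def L1_def L2_def
  \<comment> \<open>The coefficient of x^n in the target equation composed with the linear
    forms.\<close>
  define k where "k = a0 * x0 ^ n + a1 * x1 ^ n + a2 * x2 ^ n"
  define \<Delta> where "\<Delta> = x0 * (y1 * z2 - y2 * z1) + x1 * (y2 * z0 - y0 * z2) + x2 * (y0 * z1 - y1 * z0)"
  have det: "\<Delta> \<noteq> 0"
  proof
    assume "\<Delta> = 0"
    from singular_rows_dependent[OF this[unfolded \<Delta>_def]]
    obtain l0 l1 l2 where l: "(l0, l1, l2) \<noteq> (0, 0, 0)" "l0 * x0 + l1 * x1 + l2 * x2 = 0"
      "l0 * y0 + l1 * y1 + l2 * y2 = 0" "l0 * z0 + l1 * z1 + l2 * z2 = 0"
      by blast
    have "vanishes (line_poly P0 P1 P2 (l0, l1, l2))"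
    proof (rule vanishes_cofinite[OF B])
      fix x y assume "on_curve x y" "y \<notin> B"
      then obtain t where t: "ev P0 x y = t * (x0 * x + y0 * y + z0)"
        "ev P1 x y = t * (x1 * x + y1 * y + z1)" "ev P2 x y = t * (x2 * x + y2 * y + z2)"
        using rep by blast
      have "ev (line_poly P0 P1 P2 (l0, l1, l2)) x y = t * ((l0 * x0 + l1 * x1 + l2 * x2) * x
          + (l0 * y0 + l1 * y1 + l2 * y2) * y + (l0 * z0 + l1 * z1 + l2 * z2))"
        by (simp add: id_map.eval2_linear_form linear_form_def t algebra_simps)
      then show "ev (line_poly P0 P1 P2 (l0, l1, l2)) x y = 0" by (simp add: l)
    qed
    then show False using image_not_in_line[OF l(1)] by blast
  qed
  have id1: "a0 * L0 x y 1 ^ n + a1 * L1 x y 1 ^ n + a2 * L2 x y 1 ^ n = k * (x ^ n + b * y ^ n + c)"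
    if y: "y \<notin> B \<union> {y. b * y ^ n + c = 0}" for x y
  proof -
    have br: "b * y ^ n + c \<noteq> 0" using y by simp
    define q where "q = smult a0 ([:y0 * y + z0, x0:] ^ n) + smult a1 ([:y1 * y + z1, x1:] ^ n)
      + smult a2 ([:y2 * y + z2, x2:] ^ n) - smult k (monom 1 n + [:b * y ^ n + c:])"
    have q_ev: "poly q x = a0 * L0 x y 1 ^ n + a1 * L1 x y 1 ^ n + a2 * L2 x y 1 ^ n - k * (x ^ n + b * y ^ n + c)" for x
      by (simp add: q_def L_defs poly_monom algebra_simps)
    have "q = 0"
    proof (rule fibre_poly_eq_0[OF br])
      fix x assume x: "on_curve x y"
      have "y \<notin> B" using y by simp
      from rep[OF x this]
      obtain t where t: "t \<noteq> 0" "ev P0 x y = t * L0 x y 1" "ev P1 x y = t * L1 x y 1" "ev P2 x y = t * L2 x y 1"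
        unfolding L_defs by auto
      have "t ^ n * (a0 * L0 x y 1 ^ n + a1 * L1 x y 1 ^ n + a2 * L2 x y 1 ^ n) = 0"
        using P_eq[OF x] unfolding t by (simp add: power_mult_distrib algebra_simps)
      then show "poly q x = 0" using t(1) x unfolding q_ev by (simp add: on_curve_def add.assoc)
    next
      show "\<forall>i\<ge>n. coeff q i = 0"
      proof (intro allI impI)
        fix i assume "n \<le> i"
        moreover have "coeff [:b * y ^ n + c:] i = 0" if "n \<le> i"
          using that n_pos by (simp add: coeff_pCons split: nat.split)
        ultimately show "coeff q i = 0"
          by (cases "i = n") (simp_all add: q_def k_def coeff_linear_power_top)
      qed
    qed
    then show ?thesis using q_ev[of x] by simp
  qed
  \<comment> \<open>Both sides are polynomials in y, so finitely many exceptions disappear. The same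
    argument, with scaling by z, then passes from z = 1 to all z.\<close>
  have id2: "a0 * L0 x y 1 ^ n + a1 * L1 x y 1 ^ n + a2 * L2 x y 1 ^ n = k * (x ^ n + b * y ^ n + c)" for x y
  proof -
    define q where "q = smult a0 ([:x0 * x + z0, y0:] ^ n) + smult a1 ([:x1 * x + z1, y1:] ^ n)
      + smult a2 ([:x2 * x + z2, y2:] ^ n) - smult k ([:x ^ n + c:] + monom b n)"
    have q_ev: "poly q y = a0 * L0 x y 1 ^ n + a1 * L1 x y 1 ^ n + a2 * L2 x y 1 ^ n - k * (x ^ n + b * y ^ n + c)" for y
      by (simp add: q_def L_defs poly_monom algebra_simps)
    have "finite (B \<union> {y. b * y ^ n + c = 0})" using B finite_branch by simp
    then have "poly q y = 0"
      by (rule infinite_zeros_eq_0) (simp add: q_ev id1)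
    then show ?thesis unfolding q_ev by simp
  qed
  have id: "a0 * L0 x y z ^ n + a1 * L1 x y z ^ n + a2 * L2 x y z ^ n = k * (x ^ n + b * y ^ n + c * z ^ n)" for x y z
  proof -
    define q where "q = smult a0 ([:x0 * x + y0 * y, z0:] ^ n) + smult a1 ([:x1 * x + y1 * y, z1:] ^ n)
      + smult a2 ([:x2 * x + y2 * y, z2:] ^ n) - smult k ([:x ^ n + b * y ^ n:] + monom c n)"
    have q_ev: "poly q z = a0 * L0 x y z ^ n + a1 * L1 x y z ^ n + a2 * L2 x y z ^ n - k * (x ^ n + b * y ^ n + c * z ^ n)" for z
      by (simp add: q_def L_defs poly_monom algebra_simps)
    have "poly q z = 0"
    proof (rule infinite_zeros_eq_0[of "{0}"])
      fix z :: 'a assume "z \<notin> {0}"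
      then have z: "z \<noteq> 0" by simp
      have L: "L0 x y z = z * L0 (x / z) (y / z) 1" "L1 x y z = z * L1 (x / z) (y / z) 1"
        "L2 x y z = z * L2 (x / z) (y / z) 1"
        using z by (simp_all add: L_defs distrib_left)
      have "a0 * L0 x y z ^ n + a1 * L1 x y z ^ n + a2 * L2 x y z ^ n = z ^ n * (a0 * L0 (x / z) (y / z) 1 ^ n
          + a1 * L1 (x / z) (y / z) 1 ^ n + a2 * L2 (x / z) (y / z) 1 ^ n)"
        unfolding L by (simp add: power_mult_distrib algebra_simps)
      also have "\<dots> = k * (x ^ n + b * y ^ n + c * z ^ n)"
        unfolding id2 using z by (simp add: power_divide field_simps)
      finally show "poly q z = 0" unfolding q_ev by simp
    qed simp
    then show ?thesis unfolding q_ev by simp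
  qed
  text \<open>The mixed second derivatives of the identity \<open>id\<close> vanish, and powers of independent
    linear forms are independent.\<close>
  have n2: "n - 1 > 0" "n - 1 - 1 = n - 2" using n_ge by simp_all
  have dx: "a0 * x0 * L0 x y z ^ (n - 1) + a1 * x1 * L1 x y z ^ (n - 1) + a2 * x2 * L2 x y z ^ (n - 1)
      = k * x ^ (n - 1)" for x y z
    using power_identity_deriv[OF n_pos, of a0 "y0 * y + z0 * z" x0 a1 "y1 * y + z1 * z" x1 a2 "y2 * y + z2 * z" x2
      k "k * (b * y ^ n + c * z ^ n)" x] id[of _ y z]
    by (simp add: L_defs algebra_simps)
  have dy: "a0 * y0 * L0 x y z ^ (n - 1) + a1 * y1 * L1 x y z ^ (n - 1) + a2 * y2 * L2 x y z ^ (n - 1)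
      = k * b * y ^ (n - 1)" for x y z
    using power_identity_deriv[OF n_pos, of a0 "x0 * x + z0 * z" y0 a1 "x1 * x + z1 * z" y1 a2 "x2 * x + z2 * z" y2
      "k * b" "k * (x ^ n + c * z ^ n)" y] id[of x _ z]
    by (simp add: L_defs algebra_simps)
  have dxy: "a0 * x0 * y0 * L0 x y z ^ (n - 2) + a1 * x1 * y1 * L1 x y z ^ (n - 2) + a2 * x2 * y2 * L2 x y z ^ (n - 2) = 0" for x y z
    using power_identity_deriv[OF n2(1), of "a0 * x0" "x0 * x + z0 * z" y0 "a1 * x1" "x1 * x + z1 * z" y1
      "a2 * x2" "x2 * x + z2 * z" y2 0 "k * x ^ (n - 1)" y] dx[of x _ z]
    unfolding n2(2) by (simp add: L_defs algebra_simps)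
  have dxz: "a0 * x0 * z0 * L0 x y z ^ (n - 2) + a1 * x1 * z1 * L1 x y z ^ (n - 2) + a2 * x2 * z2 * L2 x y z ^ (n - 2) = 0" for x y z
    using power_identity_deriv[OF n2(1), of "a0 * x0" "x0 * x + y0 * y" z0 "a1 * x1" "x1 * x + y1 * y" z1
      "a2 * x2" "x2 * x + y2 * y" z2 0 "k * x ^ (n - 1)" z] dx[of x y]
    unfolding n2(2) by (simp add: L_defs algebra_simps)
  have dyz: "a0 * y0 * z0 * L0 x y z ^ (n - 2) + a1 * y1 * z1 * L1 x y z ^ (n - 2) + a2 * y2 * z2 * L2 x y z ^ (n - 2) = 0" for x y z
    using power_identity_deriv[OF n2(1), of "a0 * y0" "x0 * x + y0 * y" z0 "a1 * y1" "x1 * x + y1 * y" z1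
      "a2 * y2" "x2 * x + y2 * y" z2 0 "k * b * y ^ (n - 1)" z] dy[of x y]
    unfolding n2(2) by (simp add: L_defs algebra_simps)
  have indep: "e0 = 0 \<and> e1 = 0 \<and> e2 = 0"
    if e: "\<And>x y z. e0 * L0 x y z ^ (n - 2) + e1 * L1 x y z ^ (n - 2) + e2 * L2 x y z ^ (n - 2) = 0" for e0 e1 e2
  proof -
    have n2: "n - 2 > 0" using n_ge by simp
    \<comment> \<open>The columns of the adjugate matrix: at each of these three points one linear
      form has the value \<Delta> and the other two vanish.\<close>
    have "L0 (y1 * z2 - y2 * z1) (z1 * x2 - z2 * x1) (x1 * y2 - x2 * y1) = \<Delta>"
      "L1 (y1 * z2 - y2 * z1) (z1 * x2 - z2 * x1) (x1 * y2 - x2 * y1) = 0"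
      "L2 (y1 * z2 - y2 * z1) (z1 * x2 - z2 * x1) (x1 * y2 - x2 * y1) = 0"
      "L1 (y2 * z0 - y0 * z2) (z2 * x0 - z0 * x2) (x2 * y0 - x0 * y2) = \<Delta>"
      "L2 (y2 * z0 - y0 * z2) (z2 * x0 - z0 * x2) (x2 * y0 - x0 * y2) = 0"
      "L0 (y2 * z0 - y0 * z2) (z2 * x0 - z0 * x2) (x2 * y0 - x0 * y2) = 0"
      "L2 (y0 * z1 - y1 * z0) (z0 * x1 - z1 * x0) (x0 * y1 - x1 * y0) = \<Delta>"
      "L0 (y0 * z1 - y1 * z0) (z0 * x1 - z1 * x0) (x0 * y1 - x1 * y0) = 0"
      "L1 (y0 * z1 - y1 * z0) (z0 * x1 - z1 * x0) (x0 * y1 - x1 * y0) = 0"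
      by (simp_all add: L_defs \<Delta>_def algebra_simps)
    note L = this
    show ?thesis
      using e[of "y1 * z2 - y2 * z1" "z1 * x2 - z2 * x1" "x1 * y2 - x2 * y1"]
        e[of "y2 * z0 - y0 * z2" "z2 * x0 - z0 * x2" "x2 * y0 - x0 * y2"]
        e[of "y0 * z1 - y1 * z0" "z0 * x1 - z1 * x0" "x0 * y1 - x1 * y0"] det n2
      unfolding L by (simp add: zero_power)
  qed
  \<comment> \<open>For k = 0 the second derivative with respect to x vanishes as well; by
    independence each \<open>xi\<close> is 0, against the determinant.\<close>
  have k0: "k \<noteq> 0"
  proof
    assume "k = 0"
    then have dx0: "a0 * x0 * L0 x y z ^ (n - 1) + a1 * x1 * L1 x y z ^ (n - 1) + a2 * x2 * L2 x y z ^ (n - 1) = 0" for x y z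
      using dx by simp
    have "a0 * x0 * x0 * L0 x y z ^ (n - 2) + a1 * x1 * x1 * L1 x y z ^ (n - 2) + a2 * x2 * x2 * L2 x y z ^ (n - 2) = 0" for x y z
      using power_identity_deriv[OF n2(1), of "a0 * x0" "y0 * y + z0 * z" x0 "a1 * x1" "y1 * y + z1 * z" x1
        "a2 * x2" "y2 * y + z2 * z" x2 0 0 x] dx0[of _ y z]
      unfolding n2(2) by (simp add: L_defs algebra_simps)
    from indep[OF this] have "x0 = 0 \<and> x1 = 0 \<and> x2 = 0" using a_nz by simp
    then show False using det by (simp add: \<Delta>_def)
  qed
  \<comment> \<open>Independence kills every coefficient \<open>ai * xi * yi\<close> and its
    analogues, so each linear form involves at most one variable.\<close>
  have zero: "x0 * y0 = 0" "x0 * z0 = 0" "y0 * z0 = 0" "x1 * y1 = 0" "x1 * z1 = 0" "y1 * z1 = 0"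
    "x2 * y2 = 0" "x2 * z2 = 0" "y2 * z2 = 0"
    using indep[OF dxy] indep[OF dxz] indep[OF dyz] a_nz by auto
  show thesis
  proof (rule that[OF B k0 _ _ zero det[unfolded \<Delta>_def]])
    show "\<forall>x y. on_curve x y \<and> y \<notin> B \<longrightarrow> (\<exists>t. t \<noteq> 0 \<and> ev P0 x y = t * (x0 * x + y0 * y + z0)
      \<and> ev P1 x y = t * (x1 * x + y1 * y + z1) \<and> ev P2 x y = t * (x2 * x + y2 * y + z2))"
      using rep by blast
    show "\<forall>x y z. a0 * (x0 * x + y0 * y + z0 * z) ^ n + a1 * (x1 * x + y1 * y + z1 * z) ^ n
      + a2 * (x2 * x + y2 * y + z2 * z) ^ n = k * (x ^ n + b * y ^ n + c * z ^ n)"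
      using id[unfolded L_defs] by blast
  qed
qed

end

section \<open>Descent to the base field\<close>

lemma eval2_lift:
  "eval2 (\<lambda>x. x) x y (map_poly (map_poly to_ac) A) = eval2 to_ac x y A"
proof (induction A)
  case (pCons q A)
  then show ?case by (simp add: map_poly_pCons eval1_def)
qed simp

definition form_poly :: "nat \<Rightarrow> (nat triple \<Rightarrow> 'k::field) \<Rightarrow> 'k poly poly" where
  "form_poly d a = (\<Sum>(i, j, k) \<in> {(i, j, k). i + j + k = d}. monom (monom (a (i, j, k)) j) i)"

lemma eval2_form_poly: "eval2 to_ac x y (form_poly d a) = form_eval d a (x, y, 1)"
  unfolding form_poly_def form_eval_def prod.case ac_map.eval2_sum
  by (intro sum.cong refl) (auto simp: mult_ac)

definition fermat_form :: "nat \<Rightarrow> 'k::field \<Rightarrow> 'k \<Rightarrow> 'k alg_closure triple \<Rightarrow> 'k alg_closure" where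
  "fermat_form p b c = (\<lambda>(x, y, z). x ^ p + to_ac b * y ^ p + to_ac c * z ^ p)"

lemma proj_point_in_fermat_curve:
  assumes "v \<noteq> (0, 0, 0)"
  shows "proj_point v \<in> fermat_curve p b c \<longleftrightarrow> fermat_form p b c v = 0"
proof
  assume v: "proj_point v \<in> fermat_curve p b c"
  obtain x y z where v_eq: "v = (x, y, z)" by (cases v)
  obtain x' y' z' where w: "proj_point (x, y, z) = proj_point (x', y', z')"
    "x' ^ p + to_ac b * y' ^ p + to_ac c * z' ^ p = 0"
    using v unfolding fermat_curve_def v_eq by blast
  obtain t where t: "t \<noteq> 0" "x' = t * x" "y' = t * y" "z' = t * z"
    using w(1) unfolding proj_point_eq_iff by blast
  have "t ^ p * fermat_form p b c v = 0"
    using w(2) unfolding t(2-4) v_eq fermat_form_def by (simp add: power_mult_distrib algebra_simps)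
  then show "fermat_form p b c v = 0" using t(1) by simp
next
  assume "fermat_form p b c v = 0"
  then show "proj_point v \<in> fermat_curve p b c"
    using assms unfolding fermat_curve_def fermat_form_def by (cases v) auto
qed

lemma fermat_curve_cases:
  assumes "P \<in> fermat_curve p b c"
  obtains v where "P = proj_point v" "v \<noteq> (0, 0, 0)" "fermat_form p b c v = 0"
  using assms unfolding fermat_curve_def fermat_form_def by auto

lemma nonzero_powers_inverse:
  assumes "q \<in> nonzero_powers p"
  shows "inverse q \<in> nonzero_powers p"
proof -
  obtain t where "t \<noteq> 0" "q = t ^ p" using assms unfolding nonzero_powers_def by blast
  then have "inverse t \<noteq> 0" "inverse q = inverse t ^ p" by (simp_all add: power_inverse)
  then show ?thesis unfolding nonzero_powers_def by blast
qed

text \<open>Dividing the two equations cancels \<open>k\<close>. The quotient of the p-th powers is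
  the p-th power of an element of the base field, and \<open>to_ac\<close> is injective.\<close>

lemma power_quotient_in_nonzero_powers:
  fixes a a' e e' :: "'k::field"
  assumes "to_ac a * \<mu> ^ p = k * to_ac e" "to_ac a' * \<mu>' ^ p = k * to_ac e'" "\<mu> / \<mu>' \<in> range to_ac"
    and nz: "k \<noteq> 0" "\<mu> \<noteq> 0" "\<mu>' \<noteq> 0" "a \<noteq> 0" "a' \<noteq> 0" "e \<noteq> 0" "e' \<noteq> 0"
  shows "(e / a) / (e' / a') \<in> nonzero_powers p"
proof -
  obtain r where r: "\<mu> / \<mu>' = to_ac r" using assms(3) by blast
  have "\<mu> ^ p = k * to_ac e / to_ac a" "\<mu>' ^ p = k * to_ac e' / to_ac a'"
    using assms(1,2) nz by (simp_all add: nonzero_eq_divide_eq mult.commute)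
  then have "\<mu> ^ p / \<mu>' ^ p = to_ac ((e / a) / (e' / a'))"
    using nz by simp
  then have "to_ac ((e / a) / (e' / a')) = to_ac (r ^ p)"
    by (simp only: power_divide [symmetric] r to_ac_power)
  then have "(e / a) / (e' / a') = r ^ p" unfolding to_ac_eq_iff .
  moreover have "r \<noteq> 0" using r nz by auto
  ultimately show ?thesis unfolding nonzero_powers_def by blast
qed

locale fermat_over =
  fixes n :: nat and b c :: "'k::field_char_0"
  assumes n_prime: "prime n" and n_ge: "n \<ge> 5" and b_nz: "b \<noteq> 0" and c_nz: "c \<noteq> 0"
begin

sublocale L: affine_fermat n "to_ac b" "to_ac c"
  using n_prime n_ge b_nz c_nz by unfold_locales simp_all

abbreviation lift :: "'k poly poly \<Rightarrow> 'k alg_closure poly poly" where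
  "lift \<equiv> map_poly (map_poly to_ac)"

text \<open>Division by the equation takes place over the base field and remainders are determined
  by their values on the curve. So \<open>R'\<close> is r times \<open>R\<close> coefficient by
  coefficient, and r is a quotient of two coefficients.\<close>

lemma ratio_in_base_field:
  assumes "\<not> L.vanishes (lift A)"
    and "\<And>x y. L.on_curve x y \<Longrightarrow> eval2 to_ac x y A' = r * eval2 to_ac x y A"
  shows "r \<in> range to_ac"
proof -
  obtain Q R where A: "A = curve_poly n b c * Q + R" and R: "\<forall>i\<ge>n. coeff R i = 0"
    using reduce_mod_curve_poly[OF L.n_pos] .
  obtain Q' R' where A': "A' = curve_poly n b c * Q' + R'" and R': "\<forall>i\<ge>n. coeff R' i = 0"
    using reduce_mod_curve_poly[OF L.n_pos] .
  have AR: "eval2 to_ac x y A = eval2 to_ac x y R" "eval2 to_ac x y A' = eval2 to_ac x y R'"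
    if "L.on_curve x y" for x y
    using that by (simp_all add: A A' L.on_curve_def)
  define S where "S = lift R' - smult [:r:] (lift R)"
  have "L.ev S x y = 0" if "L.on_curve x y" for x y
    using assms(2)[OF that] AR[OF that] by (simp add: S_def eval2_lift)
  then have "{y. \<forall>x. L.on_curve x y \<longrightarrow> L.ev S x y = 0} = UNIV" by auto
  then have "infinite {y. \<forall>x. L.on_curve x y \<longrightarrow> L.ev S x y = 0}"
    using infinite_UNIV_char_0[where ?'a = "'k alg_closure"] by simp
  then have "S = 0"
    by (rule L.low_vanishing_eq_0) (use R R' in \<open>simp add: S_def coeff_map_poly\<close>)
  then have "coeff (coeff S i) j = 0" for i j by simp
  then have co: "to_ac (coeff (coeff R' i) j) = r * to_ac (coeff (coeff R i) j)" for i j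
    by (simp add: S_def coeff_map_poly)
  have "R \<noteq> 0" using assms(1) AR by (auto simp: L.vanishes_def eval2_lift)
  then obtain i where "coeff R i \<noteq> 0" by (metis leading_coeff_0_iff)
  then obtain j where j: "coeff (coeff R i) j \<noteq> 0" by (metis leading_coeff_0_iff)
  have "r = to_ac (coeff (coeff R' i) j / coeff (coeff R i) j)"
    using co[of i j] j by simp
  then show ?thesis by blast
qed

lemma coordinates_nonvanishing:
  "\<not> L.vanishes (lift [:0, 1:])" "\<not> L.vanishes (lift [:[:0, 1:]:])" "\<not> L.vanishes (lift 1)"
proof -
  obtain x y where xy: "L.on_curve x y" "y \<notin> {0}" "to_ac b * y ^ n + to_ac c \<noteq> 0"
    using L.exists_good[of "{0}"] by auto
  then have "x \<noteq> 0" using L.n_pos by (auto simp: L.on_curve_def zero_power)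
  then show "\<not> L.vanishes (lift [:0, 1:])" "\<not> L.vanishes (lift [:[:0, 1:]:])" "\<not> L.vanishes (lift 1)"
    using xy(1,2) unfolding L.vanishes_def eval2_lift by (fastforce simp del: map_poly_1)+
qed

text \<open>Eliminating \<open>t\<close> gives P M' = (\<mu> / \<mu>') P' M on the curve, which is
  the situation of \<open>ratio_in_base_field\<close>.\<close>

lemma monomial_ratio:
  assumes B: "finite B" and nz: "\<mu> \<noteq> 0" "\<mu>' \<noteq> 0"
    and mono: "\<not> L.vanishes (lift M)" "\<not> L.vanishes (lift M')"
    and rep: "\<And>x y. L.on_curve x y \<Longrightarrow> y \<notin> B \<Longrightarrow> \<exists>t. t \<noteq> 0 \<and>
      eval2 to_ac x y P = t * (\<mu> * eval2 to_ac x y M) \<and> eval2 to_ac x y P' = t * (\<mu>' * eval2 to_ac x y M')"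
  shows "\<mu> / \<mu>' \<in> range to_ac"
proof (rule ratio_in_base_field)
  show "\<not> L.vanishes (lift (P' * M))"
  proof
    assume v: "L.vanishes (lift (P' * M))"
    have "finite (B \<union> {y. \<exists>x. L.on_curve x y \<and> L.ev (lift M) x y = 0}
        \<union> {y. \<exists>x. L.on_curve x y \<and> L.ev (lift M') x y = 0})"
      using B L.finite_zeros[OF mono(1)] L.finite_zeros[OF mono(2)] by simp
    from L.exists_good[OF this] obtain x y where xy: "L.on_curve x y" "y \<notin> B"
      "eval2 to_ac x y M \<noteq> 0" "eval2 to_ac x y M' \<noteq> 0"
      by (auto simp: eval2_lift)
    from rep[OF xy(1,2)] have "eval2 to_ac x y P' \<noteq> 0" using nz xy by auto
    moreover have "eval2 to_ac x y (P' * M) = 0" using v xy(1) by (simp add: L.vanishes_def eval2_lift)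
    ultimately show False using xy(3) by simp
  qed
  have "L.vanishes (lift (P * M') - smult [:\<mu> / \<mu>':] (lift (P' * M)))"
  proof (rule L.vanishes_cofinite[OF B])
    fix x y assume "L.on_curve x y" "y \<notin> B"
    from rep[OF this] show "L.ev (lift (P * M') - smult [:\<mu> / \<mu>':] (lift (P' * M))) x y = 0"
      using nz by (auto simp: eval2_lift)
  qed
  then show "eval2 to_ac x y (P * M') = \<mu> / \<mu>' * eval2 to_ac x y (P' * M)" if "L.on_curve x y" for x y
    using that by (simp add: L.vanishes_def eval2_lift)
qed

text \<open>The triple \<open>e0\<close>, \<open>e1\<close>, \<open>e2\<close> will be a permutation
  of 1, b, c, and \<open>qi\<close> is \<open>ei\<close> divided by the target coefficient 1, b' or
  c'. Since the n-th power of \<open>\<mu>i\<close> is k \<open>qi\<close>, quotients of the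
  \<open>qi\<close> are n-th powers. The quotients listed are those that occur in the six
  pairs.\<close>

lemma monomial_power_conditions:
  assumes "b' \<noteq> 0" "c' \<noteq> 0" and B: "finite B" and nz: "k \<noteq> 0" "\<mu>0 \<noteq> 0" "\<mu>1 \<noteq> 0" "\<mu>2 \<noteq> 0" "e0 \<noteq> 0" "e1 \<noteq> 0" "e2 \<noteq> 0"
    and mono: "\<not> L.vanishes (lift M0)" "\<not> L.vanishes (lift M1)" "\<not> L.vanishes (lift M2)"
    and rep: "\<forall>x y. L.on_curve x y \<and> y \<notin> B \<longrightarrow> (\<exists>t. t \<noteq> 0 \<and>
      eval2 to_ac x y P0 = t * (\<mu>0 * eval2 to_ac x y M0) \<and> eval2 to_ac x y P1 = t * (\<mu>1 * eval2 to_ac x y M1) \<and>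
      eval2 to_ac x y P2 = t * (\<mu>2 * eval2 to_ac x y M2))"
    and pw: "\<mu>0 ^ n = k * to_ac e0" "to_ac b' * \<mu>1 ^ n = k * to_ac e1" "to_ac c' * \<mu>2 ^ n = k * to_ac e2"
  defines "q0 \<equiv> e0" and "q1 \<equiv> e1 / b'" and "q2 \<equiv> e2 / c'"
  shows "q0 / q1 \<in> nonzero_powers n" "q1 / q0 \<in> nonzero_powers n" "q0 / q2 \<in> nonzero_powers n"
    "q2 / q0 \<in> nonzero_powers n" "q2 / q1 \<in> nonzero_powers n"
proof -
  have r01: "\<mu>0 / \<mu>1 \<in> range to_ac" by (rule monomial_ratio[OF B nz(2,3) mono(1,2)]) (use rep in blast)
  have r02: "\<mu>0 / \<mu>2 \<in> range to_ac" by (rule monomial_ratio[OF B nz(2,4) mono(1,3)]) (use rep in blast)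
  have r21: "\<mu>2 / \<mu>1 \<in> range to_ac" by (rule monomial_ratio[OF B nz(4,3) mono(3,2)]) (use rep in blast)
  have pw0: "to_ac 1 * \<mu>0 ^ n = k * to_ac e0" using pw(1) by simp
  show 01: "q0 / q1 \<in> nonzero_powers n"
    using power_quotient_in_nonzero_powers[OF pw0 pw(2) r01] nz assms(1,2) by (simp add: q0_def q1_def)
  show 02: "q0 / q2 \<in> nonzero_powers n"
    using power_quotient_in_nonzero_powers[OF pw0 pw(3) r02] nz assms(1,2) by (simp add: q0_def q2_def)
  show "q2 / q1 \<in> nonzero_powers n"
    using power_quotient_in_nonzero_powers[OF pw(3,2) r21] nz assms(1,2) by (simp add: q1_def q2_def)
  show "q1 / q0 \<in> nonzero_powers n" "q2 / q0 \<in> nonzero_powers n"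
    using nonzero_powers_inverse[OF 01] nonzero_powers_inverse[OF 02] by simp_all
qed

lemma isomorphic_imp_powers:
  fixes b' c' :: 'k
  assumes nz': "b' \<noteq> 0" "c' \<noteq> 0"
    and iso: "isomorphic_over TYPE('k) (fermat_curve n b c) (fermat_curve n b' c')"
  shows "\<exists>q \<in> {(b / b', c / c'), (b / c', b' / c), (c * b', b / (c * c')),
            (b * c', b' / (c * c')), (b * c' / c, c * b' / c'), (c * c', c * b' / b)}.
       q \<in> nonzero_powers n \<times> nonzero_powers n"
proof -
  obtain f g where f: "is_morphism_over TYPE('k) (fermat_curve n b c) (fermat_curve n b' c') f"
    and gf: "\<forall>P\<in>fermat_curve n b c. g (f P) = P"
    using iso unfolding isomorphic_over_def by (elim exE conjE)
  have C: "proj_point (x, y, 1) \<in> fermat_curve n b c" if "L.on_curve x y" for x y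
    using that by (simp add: proj_point_in_fermat_curve fermat_form_def L.on_curve_def)
  obtain x0 where x0: "L.on_curve x0 0" using L.on_curve_exists by blast
  have "(x0, 0, 1) \<noteq> (0, 0, 0 :: 'k alg_closure)" by simp
  \<comment> \<open>One representation is fixed, chosen near the point (x0 : 0 : 1). It does not
    vanish there, which gives the nonvanishing condition of \<open>fermat_map\<close>.\<close>
  then obtain d F where F_u: "forms_eval d F (x0, 0, 1) \<noteq> (0, 0, 0)"
    and F: "\<forall>v. v \<noteq> (0, 0, 0) \<and> proj_point v \<in> fermat_curve n b c \<and> forms_eval d F v \<noteq> (0, 0, 0) \<longrightarrow>
      f (proj_point v) = proj_point (forms_eval d F v)"
    using f C[OF x0] unfolding is_morphism_over_def by blast
  obtain F0 F1 F2 where F_eq: "F = (F0, F1, F2)" by (cases F)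
  define P0 P1 P2 where "P0 = form_poly d F0" and "P1 = form_poly d F1" and "P2 = form_poly d F2"
  have P_ev: "forms_eval d F (x, y, 1) = (eval2 to_ac x y P0, eval2 to_ac x y P1, eval2 to_ac x y P2)" for x y
    by (simp add: F_eq forms_eval_def P0_def P1_def P2_def eval2_form_poly)
  have f_ev: "f (proj_point (x, y, 1)) = proj_point (eval2 to_ac x y P0, eval2 to_ac x y P1, eval2 to_ac x y P2)"
    if "L.on_curve x y" "(eval2 to_ac x y P0, eval2 to_ac x y P1, eval2 to_ac x y P2) \<noteq> (0, 0, 0)" for x y
    using F[rule_format, of "(x, y, 1)"] C[OF that(1)] that(2) unfolding P_ev by simp
  interpret M: fermat_map n "to_ac b" "to_ac c" 1 "to_ac b'" "to_ac c'" "lift P0" "lift P1" "lift P2"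
  proof unfold_locales
    show "(1 :: 'k alg_closure) \<noteq> 0" "to_ac b' \<noteq> 0" "to_ac c' \<noteq> 0" using nz' by simp_all
    show "1 * L.ev (lift P0) x y ^ n + to_ac b' * L.ev (lift P1) x y ^ n + to_ac c' * L.ev (lift P2) x y ^ n = 0"
      if xy: "L.on_curve x y" for x y
    proof (cases "(eval2 to_ac x y P0, eval2 to_ac x y P1, eval2 to_ac x y P2) = (0, 0, 0)")
      case True
      then show ?thesis using L.n_pos by (simp add: eval2_lift zero_power)
    next
      case False
      have "f (proj_point (x, y, 1)) \<in> fermat_curve n b' c'"
        using f C[OF xy] unfolding is_morphism_over_def by blast
      then show ?thesis
        unfolding f_ev[OF xy False] proj_point_in_fermat_curve[OF False]
        by (simp add: fermat_form_def eval2_lift)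
    qed
    show "\<not> (L.vanishes (lift P0) \<and> L.vanishes (lift P1) \<and> L.vanishes (lift P2))"
      using F_u x0 unfolding P_ev by (auto simp: L.vanishes_def eval2_lift)
    fix x y x' y' t
    assume xy: "L.on_curve x y" "L.on_curve x' y'" and t: "t \<noteq> 0"
      and nz: "(L.ev (lift P0) x y, L.ev (lift P1) x y, L.ev (lift P2) x y) \<noteq> (0, 0, 0)"
      and eq: "L.ev (lift P0) x' y' = t * L.ev (lift P0) x y" "L.ev (lift P1) x' y' = t * L.ev (lift P1) x y"
        "L.ev (lift P2) x' y' = t * L.ev (lift P2) x y"
    note nz = nz[unfolded eval2_lift] and eq = eq[unfolded eval2_lift]
    have nz': "(eval2 to_ac x' y' P0, eval2 to_ac x' y' P1, eval2 to_ac x' y' P2) \<noteq> (0, 0, 0)"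
      using nz t unfolding eq by auto
    have "f (proj_point (x, y, 1)) = f (proj_point (x', y', 1))"
      unfolding f_ev[OF xy(1) nz] f_ev[OF xy(2) nz'] proj_point_eq_iff
      by (intro exI[of _ t] conjI t eq)
    then have "g (f (proj_point (x, y, 1))) = g (f (proj_point (x', y', 1)))" by (rule arg_cong)
    then have "proj_point (x, y, 1) = proj_point (x', y', 1)"
      unfolding bspec[OF gf C[OF xy(1)]] bspec[OF gf C[OF xy(2)]] .
    then show "x = x' \<and> y = y'" by (auto simp: proj_point_eq_iff)
  qed
  obtain x0 y0 z0 x1 y1 z1 x2 y2 z2 B k where B: "finite B" and k: "k \<noteq> 0"
    and rep: "\<forall>x y. L.on_curve x y \<and> y \<notin> B \<longrightarrow> (\<exists>t. t \<noteq> 0 \<and> L.ev (lift P0) x y = t * (x0 * x + y0 * y + z0)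
      \<and> L.ev (lift P1) x y = t * (x1 * x + y1 * y + z1) \<and> L.ev (lift P2) x y = t * (x2 * x + y2 * y + z2))"
    and id: "\<forall>x y z. 1 * (x0 * x + y0 * y + z0 * z) ^ n + to_ac b' * (x1 * x + y1 * y + z1 * z) ^ n
      + to_ac c' * (x2 * x + y2 * y + z2 * z) ^ n = k * (x ^ n + to_ac b * y ^ n + to_ac c * z ^ n)"
    and zero: "x0 * y0 = 0" "x0 * z0 = 0" "y0 * z0 = 0" "x1 * y1 = 0" "x1 * z1 = 0" "y1 * z1 = 0"
      "x2 * y2 = 0" "x2 * z2 = 0" "y2 * z2 = 0"
    and det: "x0 * (y1 * z2 - y2 * z1) + x1 * (y2 * z0 - y0 * z2) + x2 * (y0 * z1 - y1 * z0) \<noteq> 0"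
    by (rule M.monomial_representation)
  note rep = rep[unfolded eval2_lift]
  have idx: "x0 ^ n + to_ac b' * x1 ^ n + to_ac c' * x2 ^ n = k"
    using id[rule_format, of 1 0 0] L.n_pos by (simp add: zero_power)
  have idy: "y0 ^ n + to_ac b' * y1 ^ n + to_ac c' * y2 ^ n = k * to_ac b"
    using id[rule_format, of 0 1 0] L.n_pos by (simp add: zero_power)
  have idz: "z0 ^ n + to_ac b' * z1 ^ n + to_ac c' * z2 ^ n = k * to_ac c"
    using id[rule_format, of 0 0 1] L.n_pos by (simp add: zero_power)
  note conditions = monomial_power_conditions[OF nz' B k]
  have n0: "(0 :: 'k alg_closure) ^ n = 0" using L.n_pos by (simp add: zero_power)
  note co = coordinates_nonvanishing
  \<comment> \<open>Some term in the Leibniz expansion of the determinant is nonzero. Together with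
    the vanishing products it fixes the permutation and makes all other coefficients 0.\<close>
  have sum_nz: "A \<noteq> 0 \<or> A1 \<noteq> 0 \<or> A2 \<noteq> 0 \<or> A3 \<noteq> 0 \<or> A4 \<noteq> 0 \<or> A5 \<noteq> 0"
    if "A - A1 + A2 + A3 - A4 - A5 \<noteq> 0" for A A1 A2 A3 A4 A5 :: "'k alg_closure"
    using that by auto
  have "x0 * y1 * z2 - x0 * z1 * y2 + z0 * x1 * y2 + y0 * z1 * x2 - y0 * x1 * z2 - z0 * y1 * x2 \<noteq> 0"
    using det by (simp add: algebra_simps)
  from sum_nz[OF this]
  consider "x0 * y1 * z2 \<noteq> 0" | "x0 * z1 * y2 \<noteq> 0" | "z0 * x1 * y2 \<noteq> 0" | "y0 * z1 * x2 \<noteq> 0"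
    | "y0 * x1 * z2 \<noteq> 0" | "z0 * y1 * x2 \<noteq> 0"
    by blast
  then show ?thesis
  proof cases
    case 1
    then have *: "x0 \<noteq> 0" "y1 \<noteq> 0" "z2 \<noteq> 0" "y0 = 0" "z0 = 0" "x1 = 0" "z1 = 0" "x2 = 0" "y2 = 0"
      using zero by auto
    have "x0 ^ n = k * to_ac 1" "to_ac b' * y1 ^ n = k * to_ac b" "to_ac c' * z2 ^ n = k * to_ac c"
      using idx idy idz by (simp_all add: * n0)
    from conditions[OF *(1-3) _ b_nz c_nz co(1,2,3) _ this, of P0 P1 P2] rep *(4-9)
    have "(b / b', c / c') \<in> nonzero_powers n \<times> nonzero_powers n" by simp
    then show ?thesis by blast
  next
    case 2
    then have *: "x0 \<noteq> 0" "z1 \<noteq> 0" "y2 \<noteq> 0" "y0 = 0" "z0 = 0" "x1 = 0" "y1 = 0" "x2 = 0" "z2 = 0"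
      using zero by auto
    have "x0 ^ n = k * to_ac 1" "to_ac b' * z1 ^ n = k * to_ac c" "to_ac c' * y2 ^ n = k * to_ac b"
      using idx idy idz by (simp_all add: * n0)
    from conditions[OF *(1-3) _ c_nz b_nz co(1,3,2) _ this, of P0 P1 P2] rep *(4-9)
    have "(b / c', b' / c) \<in> nonzero_powers n \<times> nonzero_powers n" by simp
    then show ?thesis by blast
  next
    case 3
    then have *: "z0 \<noteq> 0" "x1 \<noteq> 0" "y2 \<noteq> 0" "x0 = 0" "y0 = 0" "y1 = 0" "z1 = 0" "x2 = 0" "z2 = 0"
      using zero by auto
    have "z0 ^ n = k * to_ac c" "to_ac b' * x1 ^ n = k * to_ac 1" "to_ac c' * y2 ^ n = k * to_ac b"
      using idx idy idz by (simp_all add: * n0)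
    from conditions[OF *(1-3) c_nz _ b_nz co(3,1,2) _ this, of P0 P1 P2] rep *(4-9)
    have "(c * b', b / (c * c')) \<in> nonzero_powers n \<times> nonzero_powers n" by (simp add: mult.commute)
    then show ?thesis by blast
  next
    case 4
    then have *: "y0 \<noteq> 0" "z1 \<noteq> 0" "x2 \<noteq> 0" "x0 = 0" "z0 = 0" "x1 = 0" "y1 = 0" "y2 = 0" "z2 = 0"
      using zero by auto
    have "y0 ^ n = k * to_ac b" "to_ac b' * z1 ^ n = k * to_ac c" "to_ac c' * x2 ^ n = k * to_ac 1"
      using idx idy idz by (simp_all add: * n0)
    from conditions[OF *(1-3) b_nz c_nz _ co(2,3,1) _ this, of P0 P1 P2] rep *(4-9)
    have "(b * c', b' / (c * c')) \<in> nonzero_powers n \<times> nonzero_powers n" by (simp add: mult.commute)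
    then show ?thesis by blast
  next
    case 5
    then have *: "y0 \<noteq> 0" "x1 \<noteq> 0" "z2 \<noteq> 0" "x0 = 0" "z0 = 0" "y1 = 0" "z1 = 0" "x2 = 0" "y2 = 0"
      using zero by auto
    have "y0 ^ n = k * to_ac b" "to_ac b' * x1 ^ n = k * to_ac 1" "to_ac c' * z2 ^ n = k * to_ac c"
      using idx idy idz by (simp_all add: * n0)
    from conditions[OF *(1-3) b_nz _ c_nz co(2,1,3) _ this, of P0 P1 P2] rep *(4-9)
    have "(b * c' / c, c * b' / c') \<in> nonzero_powers n \<times> nonzero_powers n" by simp
    then show ?thesis by blast
  next
    case 6
    then have *: "z0 \<noteq> 0" "y1 \<noteq> 0" "x2 \<noteq> 0" "x0 = 0" "y0 = 0" "x1 = 0" "z1 = 0" "y2 = 0" "z2 = 0"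
      using zero by auto
    have "z0 ^ n = k * to_ac c" "to_ac b' * y1 ^ n = k * to_ac b" "to_ac c' * x2 ^ n = k * to_ac 1"
      using idx idy idz by (simp_all add: * n0)
    from conditions[OF *(1-3) c_nz b_nz _ co(3,2,1) _ this, of P0 P1 P2] rep *(4-9)
    have "(c * c', c * b' / b) \<in> nonzero_powers n \<times> nonzero_powers n" by simp
    then show ?thesis by blast
  qed
qed

end

section \<open>Monomial isomorphisms\<close>

definition linear_map :: "'k::field triple triple \<Rightarrow> 'k alg_closure triple \<Rightarrow> 'k alg_closure triple" where
  "linear_map = (\<lambda>(m0, m1, m2) (x, y, z).
    (linear_form to_ac x y z m0, linear_form to_ac x y z m1, linear_form to_ac x y z m2))"

lemma linear_map_image_proj_point:
  "linear_map M ` proj_point v = proj_point (linear_map M v)"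
  for M :: "'a::field triple triple"
proof -
  obtain m0 m1 m2 where M: "M = (m0, m1, m2)" by (cases M)
  obtain x y z where v: "v = (x, y, z)" by (cases v)
  have "linear_map M (t * x, t * y, t * z) = (t * linear_form to_ac x y z m0, t * linear_form to_ac x y z m1,
      t * linear_form to_ac x y z m2)" for t
    by (simp add: linear_map_def M linear_form_scale)
  moreover have "proj_point (r, s, w) = (\<lambda>t. (t * r, t * s, t * w)) ` {t. t \<noteq> 0}" for r s w :: "'a alg_closure"
    unfolding proj_point_def by blast
  ultimately show ?thesis
    by (simp add: v image_image) (simp add: linear_map_def M)
qed

text \<open>The default value \<open>t\<close> serves the exponent (0, 0, 1); in degree 1 no further
  exponents are read.\<close>

definition linear_coeffs :: "'k::field triple \<Rightarrow> nat triple \<Rightarrow> 'k" where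
  "linear_coeffs = (\<lambda>(r, s, t) e. if e = (1, 0, 0) then r else if e = (0, 1, 0) then s else t)"

lemma form_eval_linear_coeffs: "form_eval 1 (linear_coeffs m) (x, y, z) = linear_form to_ac x y z m"
proof -
  have "{(i, j, k). i + j + k = (1::nat)} = {(1, 0, 0), (0, 1, 0), (0, 0, 1)}" by auto
  then show ?thesis
    by (cases m) (simp add: form_eval_def linear_coeffs_def linear_form_def)
qed

lemma linear_map_is_morphism:
  fixes b c b' c' :: "'k::field"
  assumes inj: "\<And>v. linear_map M v = (0, 0, 0) \<Longrightarrow> v = (0, 0, 0)"
    and eq: "\<And>v. fermat_form p b c v = 0 \<Longrightarrow> fermat_form p b' c' (linear_map M v) = 0"
  shows "is_morphism_over TYPE('k) (fermat_curve p b c) (fermat_curve p b' c') ((`) (linear_map M))"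
  unfolding is_morphism_over_def
proof (intro conjI allI impI)
  show "(`) (linear_map M) ` fermat_curve p b c \<subseteq> fermat_curve p b' c'"
  proof clarify
    fix P assume "P \<in> fermat_curve p b c"
    then obtain v where P: "P = proj_point v" "v \<noteq> (0, 0, 0)" "fermat_form p b c v = 0"
      by (rule fermat_curve_cases)
    have "linear_map M v \<noteq> (0, 0, 0)" using inj P(2) by blast
    then show "linear_map M ` P \<in> fermat_curve p b' c'"
      unfolding P(1) linear_map_image_proj_point using eq[OF P(3)] by (simp add: proj_point_in_fermat_curve)
  qed
  fix u :: "'k alg_closure triple" assume u: "u \<noteq> (0, 0, 0) \<and> proj_point u \<in> fermat_curve p b c"
  obtain m0 m1 m2 where M: "M = (m0, m1, m2)" by (cases M)
  let ?F = "(linear_coeffs m0, linear_coeffs m1, linear_coeffs m2)"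
  have F: "forms_eval 1 ?F v = linear_map M v" for v
    unfolding forms_eval_def M linear_map_def by (cases v) (simp only: prod.case form_eval_linear_coeffs)
  have "forms_eval 1 ?F u \<noteq> (0, 0, 0)" unfolding F using inj u by blast
  moreover have "linear_map M ` proj_point v = proj_point (forms_eval 1 ?F v)" for v
    unfolding F by (rule linear_map_image_proj_point)
  ultimately show "\<exists>d (F :: (nat triple \<Rightarrow> 'k) triple). forms_eval d F u \<noteq> (0, 0, 0) \<and>
      (\<forall>v. v \<noteq> (0, 0, 0) \<and> proj_point v \<in> fermat_curve p b c \<and> forms_eval d F v \<noteq> (0, 0, 0) \<longrightarrow>
        linear_map M ` proj_point v = proj_point (forms_eval d F v))"
    by (intro exI[of _ 1] exI[of _ ?F]) simp
qed

lemma isomorphic_overI_linear: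
  fixes b c b' c' :: "'k::field"
  assumes NM: "\<And>v. linear_map N (linear_map M v) = v" and MN: "\<And>v. linear_map M (linear_map N v) = v"
    and k: "k \<noteq> 0" and eq: "\<And>v. fermat_form p b' c' (linear_map M v) = k * fermat_form p b c v"
  shows "isomorphic_over TYPE('k) (fermat_curve p b c) (fermat_curve p b' c')"
  unfolding isomorphic_over_def
proof (intro exI conjI ballI)
  have zero: "linear_map A (0, 0, 0) = (0, 0, 0)" for A :: "'k triple triple"
    by (simp add: linear_map_def linear_form_def split: prod.splits)
  show "is_morphism_over TYPE('k) (fermat_curve p b c) (fermat_curve p b' c') ((`) (linear_map M))"
  proof (rule linear_map_is_morphism)
    show "v = (0, 0, 0)" if "linear_map M v = (0, 0, 0)" for v
      using NM[of v] unfolding that zero by simp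
  qed (simp add: eq)
  show "is_morphism_over TYPE('k) (fermat_curve p b' c') (fermat_curve p b c) ((`) (linear_map N))"
  proof (rule linear_map_is_morphism)
    show "v = (0, 0, 0)" if "linear_map N v = (0, 0, 0)" for v
      using MN[of v] unfolding that zero by simp
    show "fermat_form p b c (linear_map N v) = 0" if "fermat_form p b' c' v = 0" for v
      using eq[of "linear_map N v"] that k by (simp add: MN)
  qed
  show "linear_map N ` linear_map M ` P = P" for P by (simp add: image_image NM)
  show "linear_map M ` linear_map N ` Q = Q" for Q by (simp add: image_image MN)
qed

text \<open>A projective map may be normalised to leave one coordinate unscaled, at the price of the
  factor \<open>inverse e0\<close>. As before, \<open>e0\<close>, \<open>e1\<close>,
  \<open>e2\<close> stand for a permutation of 1, b, c.\<close>

lemma scaled_fermat_form: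
  fixes b' c' \<mu>1 \<mu>2 e0 e1 e2 :: "'k::field"
  assumes "e0 \<noteq> 0" "b' * \<mu>1 ^ p = e1 / e0" "c' * \<mu>2 ^ p = e2 / e0"
  shows "x0 ^ p + to_ac b' * (to_ac \<mu>1 * x1) ^ p + to_ac c' * (to_ac \<mu>2 * x2) ^ p
    = to_ac (inverse e0) * (to_ac e0 * x0 ^ p + to_ac e1 * x1 ^ p + to_ac e2 * x2 ^ p)"
proof -
  have "to_ac (b' * \<mu>1 ^ p) = to_ac (e1 / e0)" "to_ac (c' * \<mu>2 ^ p) = to_ac (e2 / e0)"
    by (simp_all only: assms)
  then have h: "to_ac b' * to_ac \<mu>1 ^ p = to_ac e1 / to_ac e0" "to_ac c' * to_ac \<mu>2 ^ p = to_ac e2 / to_ac e0"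
    by simp_all
  have "x0 ^ p + to_ac b' * (to_ac \<mu>1 * x1) ^ p + to_ac c' * (to_ac \<mu>2 * x2) ^ p
    = x0 ^ p + (to_ac b' * to_ac \<mu>1 ^ p) * x1 ^ p + (to_ac c' * to_ac \<mu>2 ^ p) * x2 ^ p"
    by (simp add: power_mult_distrib mult.assoc)
  also have "\<dots> = to_ac (inverse e0) * (to_ac e0 * x0 ^ p + to_ac e1 * x1 ^ p + to_ac e2 * x2 ^ p)"
  proof -
    have "to_ac (inverse e0) * to_ac e0 = 1" using assms(1) by simp
    then show ?thesis
      unfolding h by (simp only: distrib_left mult.assoc [symmetric] mult_1_left divide_inverse to_ac_inverse mult.commute [of "inverse _"])
  qed
  finally show ?thesis .
qed

text \<open>In each case \<open>M\<close> permutes the coordinates and scales two of them by p-th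
  roots obtained from the pair; \<open>N\<close> is its inverse.\<close>

lemma powers_imp_isomorphic:
  fixes b c b' c' :: "'k::field"
  assumes nz: "b \<noteq> 0" "c \<noteq> 0" "b' \<noteq> 0" "c' \<noteq> 0"
    and q: "q \<in> {(b / b', c / c'), (b / c', b' / c), (c * b', b / (c * c')),
            (b * c', b' / (c * c')), (b * c' / c, c * b' / c'), (c * c', c * b' / b)}"
    and pw: "q \<in> nonzero_powers p \<times> nonzero_powers p"
  shows "isomorphic_over TYPE('k) (fermat_curve p b c) (fermat_curve p b' c')"
proof -
  obtain s t where st: "s \<noteq> 0" "t \<noteq> 0" "q = (s ^ p, t ^ p)"
    using pw unfolding nonzero_powers_def by auto
  note defs = linear_map_def linear_form_def split_paired_all
  note form = defs fermat_form_def
  consider "q = (b / b', c / c')" | "q = (b / c', b' / c)" | "q = (c * b', b / (c * c'))"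
    | "q = (b * c', b' / (c * c'))" | "q = (b * c' / c, c * b' / c')" | "q = (c * c', c * b' / b)"
    using q by (elim insertE emptyE)
  then show ?thesis
  proof cases
    case 1
    then have e: "b' * s ^ p = b / 1" "c' * t ^ p = c / 1" using st nz by simp_all
    show ?thesis
      by (rule isomorphic_overI_linear[where M = "((1, 0, 0), (0, s, 0), (0, 0, t))"
            and N = "((1, 0, 0), (0, inverse s, 0), (0, 0, inverse t))" and k = "to_ac (inverse 1)"])
        (use st scaled_fermat_form[OF _ e] in \<open>auto simp: form\<close>)
  next
    case 2
    then have "s ^ p = b / c'" "t ^ p = b' / c" using st by simp_all
    then have e: "b' * inverse t ^ p = c / 1" "c' * s ^ p = b / 1"
      using st nz by (simp_all add: power_inverse field_simps)
    show ?thesis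
      by (rule isomorphic_overI_linear[where M = "((1, 0, 0), (0, 0, inverse t), (0, s, 0))"
            and N = "((1, 0, 0), (0, 0, inverse s), (0, t, 0))" and k = "to_ac (inverse 1)"])
        (use st scaled_fermat_form[OF _ e] in \<open>auto simp: form add_ac\<close>)
  next
    case 3
    then have "s ^ p = c * b'" "t ^ p = b / (c * c')" using st by simp_all
    then have e: "b' * inverse s ^ p = 1 / c" "c' * t ^ p = b / c"
      using st nz by (simp_all add: power_inverse field_simps)
    show ?thesis
      by (rule isomorphic_overI_linear[where M = "((0, 0, 1), (inverse s, 0, 0), (0, t, 0))"
            and N = "((0, s, 0), (0, 0, inverse t), (1, 0, 0))" and k = "to_ac (inverse c)"])
        (use st nz scaled_fermat_form[OF nz(2) e] in \<open>auto simp: form add_ac\<close>)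
  next
    case 4
    then have h: "s ^ p = b * c'" "t ^ p = b' / (c * c')" using st by simp_all
    \<comment> \<open>The required power b b' / c is the product of the two members of the pair, so
      its root is s t.\<close>
    define r where "r = s * t"
    have r: "r \<noteq> 0" "r ^ p = s ^ p * t ^ p" using st by (simp_all add: r_def power_mult_distrib)
    have e: "b' * inverse r ^ p = c / b" "c' * inverse s ^ p = 1 / b"
      using nz unfolding power_inverse r(2) h by (simp_all add: field_simps)
    show ?thesis
      by (rule isomorphic_overI_linear[where M = "((0, 1, 0), (0, 0, inverse r), (inverse s, 0, 0))"
            and N = "((0, 0, s), (1, 0, 0), (0, r, 0))" and k = "to_ac (inverse b)"])
        (use st r(1) nz scaled_fermat_form[OF nz(1) e] in \<open>auto simp: form add_ac\<close>)
  next
    case 5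
    then have h: "s ^ p = b * c' / c" "t ^ p = c * b' / c'" using st by simp_all
    \<comment> \<open>Again the required power, now b b', is the product of the two members of the
      pair.\<close>
    define r where "r = s * t"
    have r: "r \<noteq> 0" "r ^ p = s ^ p * t ^ p" using st by (simp_all add: r_def power_mult_distrib)
    have e: "b' * inverse r ^ p = 1 / b" "c' * inverse s ^ p = c / b"
      using nz unfolding power_inverse r(2) h by (simp_all add: field_simps)
    show ?thesis
      by (rule isomorphic_overI_linear[where M = "((0, 1, 0), (inverse r, 0, 0), (0, 0, inverse s))"
            and N = "((0, r, 0), (1, 0, 0), (0, 0, s))" and k = "to_ac (inverse b)"])
        (use st r(1) nz scaled_fermat_form[OF nz(1) e] in \<open>auto simp: form add_ac\<close>)
  next
    case 6
    then have h: "s ^ p = c * c'" "t ^ p = c * b' / b" using st by simp_all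
    then have e: "b' * inverse t ^ p = b / c" "c' * inverse s ^ p = 1 / c"
      using nz unfolding power_inverse h by (simp_all add: field_simps)
    show ?thesis
      by (rule isomorphic_overI_linear[where M = "((0, 0, 1), (0, inverse t, 0), (inverse s, 0, 0))"
            and N = "((0, 0, s), (0, t, 0), (1, 0, 0))" and k = "to_ac (inverse c)"])
        (use st nz scaled_fermat_form[OF nz(2) e] in \<open>auto simp: form add_ac\<close>)
  qed
qed

theorem theorem3:
  fixes p :: nat and b c b' c' :: "'k::field_char_0"
  assumes "prime p" and "p \<ge> 5"
    and "b \<noteq> 0" and "c \<noteq> 0" and "b' \<noteq> 0" and "c' \<noteq> 0"
  shows "isomorphic_over TYPE('k) (fermat_curve p b c) (fermat_curve p b' c') \<longleftrightarrow>
    (\<exists>q \<in> {(b / b', c / c'), (b / c', b' / c), (c * b', b / (c * c')),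
            (b * c', b' / (c * c')), (b * c' / c, c * b' / c'), (c * c', c * b' / b)}.
       q \<in> nonzero_powers p \<times> nonzero_powers p)"
proof
  assume iso: "isomorphic_over TYPE('k) (fermat_curve p b c) (fermat_curve p b' c')"
  interpret fermat_over p b c using assms by unfold_locales
  show "\<exists>q \<in> {(b / b', c / c'), (b / c', b' / c), (c * b', b / (c * c')),
            (b * c', b' / (c * c')), (b * c' / c, c * b' / c'), (c * c', c * b' / b)}.
       q \<in> nonzero_powers p \<times> nonzero_powers p"
    using assms(5,6) iso by (rule isomorphic_imp_powers)
next
  assume "\<exists>q \<in> {(b / b', c / c'), (b / c', b' / c), (c * b', b / (c * c')),
            (b * c', b' / (c * c')), (b * c' / c, c * b' / c'), (c * c', c * b' / b)}.
       q \<in> nonzero_powers p \<times> nonzero_powers p"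
  then show "isomorphic_over TYPE('k) (fermat_curve p b c) (fermat_curve p b' c')"
    using powers_imp_isomorphic[OF assms(3-6)] by blast
qed

end
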